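(* Let $\{W,\widetilde W,Z\}$ be a data set for an LTONP interpolation problem with $Z^*$ pointwise stable, and assume that the Pick operator $\Lambda=WW^*-\widetilde W\widetilde W^*$ is non-negative. Let $\omega:\mathcal F\to\mathcal F'$ be the unitary operator determined by the data set, where $\mathcal F\subset\mathcal U\oplus\mathcal Z_\circ$, $\mathcal F'\subset\mathcal Y\oplus\mathcal Z_\circ$ and $\mathcal Z_\circ=\overline{\operatorname{Im}\Lambda}$. Then the LTONP interpolation problem is solvable and its solutions are given by $$F(\lambda)=G_{11}(\lambda)+\lambda G_{12}(\lambda)\bigl(I_{\mathcal Z_\circ}-\lambda G_{22}(\lambda)\bigr)^{-1}G_{21}(\lambda),\qquad\lambda\in\mathbb D,$$ where $$G=\begin{bmatrix} G_{11} & G_{12} \\ G_{21} & G_{22} \end{bmatrix}\in\mathcal S(\mathcal U\oplus\mathcal Z_\circ,\mathcal Y\oplus\mathcal Z_\circ)\quad\text{and}\quad G(0)|_{\mathcal F}=\omega .$$ Moreover, this gives a one-to-one correspondence between the set of all solutions $F$ and the set of all Schur class functions $G\in\mathcal S(\mathcal U\oplus\mathcal Z_\circ,\mathcal Y\oplus\mathcal Z_\circ)$ with $G(0)|_{\mathcal F}=\omega$.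
   Context: All spaces are complex Hilbert spaces and "operator" means bounded linear operator. An operator $T$ on a Hilbert space is pointwise stable if $T^nh\to0$ for every vector $h$. $\mathbb D$ is the open unit disc. For a Hilbert space $\mathcal V$, $\ell^2_+(\mathcal V)$ is the space of square summable unilateral sequences in $\mathcal V$, $S_{\mathcal V}$ is the unilateral forward shift on it, and $E_{\mathcal V}:\mathcal V\to\ell^2_+(\mathcal V)$, $E_{\mathcal V}v=(v,0,0,\dots)$. The Schur class $\mathcal S(\mathcal U,\mathcal Y)$ is the set of analytic functions $F$ on $\mathbb D$ whose values are operators from $\mathcal U$ to $\mathcal Y$ with $\sup_{\lambda\in\mathbb D}\|F(\lambda)\|\le1$; $T_F:\ell^2_+(\mathcal U)\to\ell^2_+(\mathcal Y)$ is the (block lower triangular) Toeplitz operator defined by the Taylor coefficients of $F$. An LTONP (left tangential operator Nevanlinna-Pick) data set is a triple of operators $Z:\mathcal Z\to\mathcal Z$, $W:\ell^2_+(\mathcal Y)\to\mathcal Z$, $\widetilde W:\ell^2_+(\mathcal U)\to\mathcal Z$ with $ZW=WS_{\mathcal Y}$ and $Z\widetilde W=\widetilde WS_{\mathcal U}$. A solution of the LTONP interpolation problem is a function $F\in\mathcal S(\mathcal U,\mathcal Y)$ with $WT_F=\widetilde W$. The problem is solvable if a solution exists. Put $B=WE_{\mathcal Y}$ and $\widetilde B=\widetilde WE_{\mathcal U}$; then $\Lambda-Z\Lambda Z^*=BB^*-\widetilde B\widetilde B^*$. Assume $\Lambda\ge0$, let $\mathcal Z_\circ=\overline{\operatorname{Im}\Lambda}$,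 and put $$K_1=\begin{bmatrix}\widetilde B&\Lambda^{1/2}\end{bmatrix}:\mathcal U\oplus\mathcal Z\to\mathcal Z,\quad K_2=\begin{bmatrix}B&Z\Lambda^{1/2}\end{bmatrix}:\mathcal Y\oplus\mathcal Z\to\mathcal Z,\quad \mathcal F=\overline{\operatorname{Im}K_1^*},\quad \mathcal F'=\overline{\operatorname{Im}K_2^*}.$$ Then $\mathcal F\subset\mathcal U\oplus\mathcal Z_\circ$, $\mathcal F'\subset\mathcal Y\oplus\mathcal Z_\circ$ and $K_1K_1^*=K_2K_2^*$. The unitary operator $\omega$ determined by the data set is the unique unitary operator $\omega:\mathcal F\to\mathcal F'$ with $\omega K_1^*=K_2^*$, i.e. $\omega(\widetilde B^*z\oplus\Lambda^{1/2}z)=B^*z\oplus\Lambda^{1/2}Z^*z$ for $z\in\mathcal Z$. *)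

theory Defs
  imports "HOL-Analysis.Analysis"
begin

section \<open>Complex Hilbert spaces\<close>

text \<open>
  A complex inner product space is presented as a real one whose real inner product is the real
  part of the complex inner product; the norm and the topology of the two structures are then the
  same. The complex inner product is linear in its first argument.
\<close>

class complex_inner = real_inner +
  fixes scaleC :: "complex \<Rightarrow> 'a \<Rightarrow> 'a" (infixr "*\<^sub>C" 75)
    and cinner :: "'a \<Rightarrow> 'a \<Rightarrow> complex"
  assumes scaleC_add_right: "c *\<^sub>C (x + y) = c *\<^sub>C x + c *\<^sub>C y"
    and scaleC_add_left: "(c + d) *\<^sub>C x = c *\<^sub>C x + d *\<^sub>C x"
    and scaleC_scaleC: "c *\<^sub>C d *\<^sub>C x = (c * d) *\<^sub>C x"
    and scaleR_scaleC: "r *\<^sub>R x = complex_of_real r *\<^sub>C x"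
    and cinner_commute: "cinner x y = cnj (cinner y x)"
    and cinner_add_left: "cinner (x + y) z = cinner x z + cinner y z"
    and cinner_scaleC_left: "cinner (c *\<^sub>C x) y = c * cinner x y"
    and inner_eq_Re_cinner: "inner x y = Re (cinner x y)"

class chilbert_space = complex_inner + complete_space

lemma norm_scaleC: "norm (c *\<^sub>C (x :: 'a :: complex_inner)) = norm c * norm x"
proof -
  have "Im (cinner x x) = 0"
    using cinner_commute[of x x] by (metis Reals_cnj_iff complex_is_Real_iff)
  then have x: "cinner x x = complex_of_real ((norm x)\<^sup>2)"
    by (simp add: complex_eq_iff power2_norm_eq_inner inner_eq_Re_cinner)
  have "cinner (c *\<^sub>C x) (c *\<^sub>C x) = c * cinner x (c *\<^sub>C x)"
    by (rule cinner_scaleC_left)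
  also have "cinner x (c *\<^sub>C x) = cnj c * cnj (cinner x x)"
    by (metis cinner_commute cinner_scaleC_left complex_cnj_mult)
  also have "c * (cnj c * cnj (cinner x x)) = complex_of_real ((norm c * norm x)\<^sup>2)"
    by (simp only: x power_mult_distrib of_real_mult mult.assoc[symmetric] complex_norm_square
        complex_cnj_complex_of_real)
  finally have "(norm (c *\<^sub>C x))\<^sup>2 = (norm c * norm x)\<^sup>2"
    by (simp add: power2_norm_eq_inner inner_eq_Re_cinner)
  then show ?thesis
    by (simp add: power2_eq_iff_nonneg)
qed

lemma Im_cinner: "Im (cinner x y) = inner ((- \<i>) *\<^sub>C (x :: 'a :: complex_inner)) y"
  by (simp add: inner_eq_Re_cinner cinner_scaleC_left)

instantiation complex :: chilbert_space
begin

definition scaleC_complex :: "complex \<Rightarrow> complex \<Rightarrow> complex" where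
  "scaleC_complex c x = c * x"

definition cinner_complex :: "complex \<Rightarrow> complex \<Rightarrow> complex" where
  "cinner_complex x y = x * cnj y"

instance
  by standard
    (simp_all add: scaleC_complex_def cinner_complex_def algebra_simps scaleR_conv_of_real
      inner_complex_def)

end

text \<open>The product type carries the orthogonal direct sum structure.\<close>

instantiation prod :: (complex_inner, complex_inner) complex_inner
begin

definition scaleC_prod :: "complex \<Rightarrow> 'a \<times> 'b \<Rightarrow> 'a \<times> 'b" where
  "scaleC_prod c x = (c *\<^sub>C fst x, c *\<^sub>C snd x)"

definition cinner_prod :: "'a \<times> 'b \<Rightarrow> 'a \<times> 'b \<Rightarrow> complex" where
  "cinner_prod x y = cinner (fst x) (fst y) + cinner (snd x) (snd y)"

instance
proof
  fix x y :: "'a \<times> 'b"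
  show "cinner x y = cnj (cinner y x)"
    unfolding cinner_prod_def
    by (metis cinner_commute complex_cnj_add)
qed (simp_all add: scaleC_prod_def cinner_prod_def scaleC_add_right scaleC_add_left scaleC_scaleC
      scaleR_scaleC scaleR_prod_def cinner_add_left cinner_scaleC_left inner_prod_def
      inner_eq_Re_cinner algebra_simps)

end

instance prod :: (chilbert_space, chilbert_space) chilbert_space ..


section \<open>Square summable unilateral sequences\<close>

typedef (overloaded) 'a ell2 = "{f :: nat \<Rightarrow> 'a :: real_normed_vector. summable (\<lambda>n. (norm (f n))\<^sup>2)}"
  by (rule exI[of _ "\<lambda>_. 0"]) simp

setup_lifting type_definition_ell2

lemma ell2_summable_add:
  fixes f g :: "nat \<Rightarrow> 'a :: real_normed_vector"
  assumes "summable (\<lambda>n. (norm (f n))\<^sup>2)" "summable (\<lambda>n. (norm (g n))\<^sup>2)"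
  shows "summable (\<lambda>n. (norm (f n + g n))\<^sup>2)"
proof (rule summable_comparison_test')
  show "summable (\<lambda>n. 2 * (norm (f n))\<^sup>2 + 2 * (norm (g n))\<^sup>2)"
    using assms by (intro summable_add summable_mult)
  show "norm ((norm (f n + g n))\<^sup>2) \<le> 2 * (norm (f n))\<^sup>2 + 2 * (norm (g n))\<^sup>2" for n
  proof -
    have "(norm (f n + g n))\<^sup>2 \<le> (norm (f n) + norm (g n))\<^sup>2"
      by (simp add: norm_triangle_ineq)
    also have "\<dots> \<le> 2 * (norm (f n))\<^sup>2 + 2 * (norm (g n))\<^sup>2"
      using sum_squares_bound[of "norm (f n)" "norm (g n)"] by (simp add: power2_sum)
    finally show ?thesis by simp
  qed
qed

lemma ell2_summable_inner:
  fixes f g :: "nat \<Rightarrow> 'a :: real_inner"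
  assumes "summable (\<lambda>n. (norm (f n))\<^sup>2)" "summable (\<lambda>n. (norm (g n))\<^sup>2)"
  shows "summable (\<lambda>n. inner (f n) (g n))"
proof (rule summable_comparison_test')
  show "summable (\<lambda>n. (norm (f n))\<^sup>2 + (norm (g n))\<^sup>2)"
    using assms by (intro summable_add)
  show "norm (inner (f n) (g n)) \<le> (norm (f n))\<^sup>2 + (norm (g n))\<^sup>2" for n
  proof -
    have "\<bar>inner (f n) (g n)\<bar> \<le> norm (f n) * norm (g n)"
      by (rule Cauchy_Schwarz_ineq2)
    also have "\<dots> \<le> (norm (f n))\<^sup>2 + (norm (g n))\<^sup>2"
      using sum_squares_bound[of "norm (f n)" "norm (g n)"]
        mult_nonneg_nonneg[OF norm_ge_zero norm_ge_zero, of "f n" "g n"]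
      by linarith
    finally show ?thesis by simp
  qed
qed

lemma ell2_summable_cinner:
  fixes f g :: "nat \<Rightarrow> 'a :: complex_inner"
  assumes "summable (\<lambda>n. (norm (f n))\<^sup>2)" "summable (\<lambda>n. (norm (g n))\<^sup>2)"
  shows "summable (\<lambda>n. cinner (f n) (g n))"
proof -
  have "summable (\<lambda>n. inner (f n) (g n))"
    using assms by (rule ell2_summable_inner)
  moreover have "summable (\<lambda>n. inner ((- \<i>) *\<^sub>C f n) (g n))"
    using assms by (intro ell2_summable_inner) (simp_all add: norm_scaleC)
  ultimately show ?thesis
    by (simp only: summable_complex_iff Im_cinner inner_eq_Re_cinner simp_thms)
qed

instantiation ell2 :: (real_normed_vector) real_vector
begin

lift_definition zero_ell2 :: "'a ell2" is "\<lambda>_. 0" by simp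

lift_definition plus_ell2 :: "'a ell2 \<Rightarrow> 'a ell2 \<Rightarrow> 'a ell2" is "\<lambda>f g n. f n + g n"
  by (rule ell2_summable_add)

lift_definition uminus_ell2 :: "'a ell2 \<Rightarrow> 'a ell2" is "\<lambda>f n. - f n" by simp

lift_definition minus_ell2 :: "'a ell2 \<Rightarrow> 'a ell2 \<Rightarrow> 'a ell2" is "\<lambda>f g n. f n - g n"
  using ell2_summable_add[of _ "\<lambda>n. - g n" for g] by fastforce

lift_definition scaleR_ell2 :: "real \<Rightarrow> 'a ell2 \<Rightarrow> 'a ell2" is "\<lambda>r f n. r *\<^sub>R f n"
  by (simp add: power_mult_distrib summable_mult)

instance
proof
  fix x y z :: "'a ell2" and r s :: real
  show "x + y + z = x + (y + z)" by transfer (simp add: add.assoc)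
  show "x + y = y + x" by transfer (simp add: add.commute)
  show "0 + x = x" by transfer simp
  show "- x + x = 0" by transfer simp
  show "x - y = x + - y" by transfer simp
  show "r *\<^sub>R (x + y) = r *\<^sub>R x + r *\<^sub>R y" by transfer (simp add: scaleR_add_right)
  show "(r + s) *\<^sub>R x = r *\<^sub>R x + s *\<^sub>R x" by transfer (simp add: scaleR_add_left)
  show "r *\<^sub>R s *\<^sub>R x = (r * s) *\<^sub>R x" by transfer simp
  show "1 *\<^sub>R x = x" by transfer simp
qed

end

instantiation ell2 :: (real_inner) real_inner
begin

lift_definition inner_ell2 :: "'a ell2 \<Rightarrow> 'a ell2 \<Rightarrow> real" is "\<lambda>f g. \<Sum>n. inner (f n) (g n)" .

definition norm_ell2 :: "'a ell2 \<Rightarrow> real" where "norm_ell2 x = sqrt (inner x x)"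

definition sgn_ell2 :: "'a ell2 \<Rightarrow> 'a ell2" where "sgn_ell2 x = x /\<^sub>R norm x"

definition dist_ell2 :: "'a ell2 \<Rightarrow> 'a ell2 \<Rightarrow> real" where "dist_ell2 x y = norm (x - y)"

definition uniformity_ell2 :: "('a ell2 \<times> 'a ell2) filter" where
  "uniformity_ell2 = (INF e\<in>{0 <..}. principal {(x, y). dist x y < e})"

definition open_ell2 :: "'a ell2 set \<Rightarrow> bool" where
  "open_ell2 S = (\<forall>x\<in>S. \<forall>\<^sub>F (x', y) in uniformity. x' = x \<longrightarrow> y \<in> S)"

instance
proof
  fix x y z :: "'a ell2" and r s :: real
  show "dist x y = norm (x - y)" by (rule dist_ell2_def)
  show "sgn x = x /\<^sub>R norm x" by (rule sgn_ell2_def)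
  show "norm x = sqrt (inner x x)" by (rule norm_ell2_def)
  show "(uniformity :: ('a ell2 \<times> 'a ell2) filter) = (INF e\<in>{0 <..}. principal {(x, y). dist x y < e})"
    by (rule uniformity_ell2_def)
  show "open S = (\<forall>x\<in>S. \<forall>\<^sub>F (x', y) in uniformity. x' = x \<longrightarrow> y \<in> S)" for S :: "'a ell2 set"
    by (rule open_ell2_def)
  show "inner x y = inner y x" by transfer (simp add: inner_commute)
  show "inner (x + y) z = inner x z + inner y z"
    by transfer (simp add: inner_add_left suminf_add ell2_summable_inner)
  show "inner (r *\<^sub>R x) y = r * inner x y"
    by transfer (simp add: suminf_mult ell2_summable_inner)
  show "0 \<le> inner x x"
    by transfer (simp add: suminf_nonneg ell2_summable_inner)
  show "(inner x x = 0) = (x = 0)"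
    by transfer (simp add: suminf_eq_zero_iff ell2_summable_inner fun_eq_iff)
qed

end

lemma power2_norm_ell2: "(norm x)\<^sup>2 = (\<Sum>n. (norm (Rep_ell2 x n))\<^sup>2)"
  by (simp add: power2_norm_eq_inner inner_ell2.rep_eq)

lemma sum_le_power2_norm_ell2: "(\<Sum>n<m. (norm (Rep_ell2 x n))\<^sup>2) \<le> (norm x)\<^sup>2"
  unfolding power2_norm_ell2 using Rep_ell2[of x] by (intro sum_le_suminf) auto

lemma norm_Rep_ell2_le: "norm (Rep_ell2 x n) \<le> norm x"
proof -
  have "(norm (Rep_ell2 x n))\<^sup>2 \<le> (\<Sum>k<Suc n. (norm (Rep_ell2 x k))\<^sup>2)"
    by (simp add: sum_nonneg)
  also have "\<dots> \<le> (norm x)\<^sup>2" by (rule sum_le_power2_norm_ell2)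
  finally show ?thesis by (simp add: power2_le_iff_abs_le)
qed

instance ell2 :: ("{real_inner, complete_space}") complete_space
proof
  fix X :: "nat \<Rightarrow> 'a ell2"
  assume X: "Cauchy X"
  have "Cauchy (\<lambda>k. Rep_ell2 (X k) n)" for n
  proof (rule metric_CauchyI)
    fix e :: real assume "0 < e"
    then obtain N where N: "\<And>k l. k \<ge> N \<Longrightarrow> l \<ge> N \<Longrightarrow> dist (X k) (X l) < e"
      using metric_CauchyD[OF X, of e] by blast
    show "\<exists>N. \<forall>k\<ge>N. \<forall>l\<ge>N. dist (Rep_ell2 (X k) n) (Rep_ell2 (X l) n) < e"
    proof (intro exI allI impI)
      fix k l assume kl: "k \<ge> N" "l \<ge> N"
      show "dist (Rep_ell2 (X k) n) (Rep_ell2 (X l) n) < e"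
        using N[OF kl] norm_Rep_ell2_le[of "X k - X l" n]
        by (simp add: dist_norm minus_ell2.rep_eq)
    qed
  qed
  then have "\<exists>y. (\<lambda>k. Rep_ell2 (X k) n) \<longlonglongrightarrow> y" for n
    using Cauchy_convergent convergent_def by blast
  then obtain y where y: "\<And>n. (\<lambda>k. Rep_ell2 (X k) n) \<longlonglongrightarrow> y n"
    by metis
  have bound: "\<exists>N. \<forall>k\<ge>N. \<forall>m. (\<Sum>n<m. (norm (Rep_ell2 (X k) n - y n))\<^sup>2) \<le> e\<^sup>2" if e: "0 < e" for e :: real
  proof -
    obtain N where N: "\<And>k l. k \<ge> N \<Longrightarrow> l \<ge> N \<Longrightarrow> dist (X k) (X l) < e"
      using metric_CauchyD[OF X e] by blast
    have "(\<Sum>n<m. (norm (Rep_ell2 (X k) n - y n))\<^sup>2) \<le> e\<^sup>2" if k: "k \<ge> N" for k m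
    proof (rule tendsto_upperbound)
      show "(\<lambda>l. \<Sum>n<m. (norm (Rep_ell2 (X k) n - Rep_ell2 (X l) n))\<^sup>2) \<longlonglongrightarrow>
          (\<Sum>n<m. (norm (Rep_ell2 (X k) n - y n))\<^sup>2)"
        by (intro tendsto_intros y)
      show "\<forall>\<^sub>F l in sequentially. (\<Sum>n<m. (norm (Rep_ell2 (X k) n - Rep_ell2 (X l) n))\<^sup>2) \<le> e\<^sup>2"
      proof (rule eventually_sequentiallyI)
        fix l assume l: "N \<le> l"
        have "(\<Sum>n<m. (norm (Rep_ell2 (X k) n - Rep_ell2 (X l) n))\<^sup>2) \<le> (norm (X k - X l))\<^sup>2"
          using sum_le_power2_norm_ell2[where x = "X k - X l" and m = m]
          by (simp add: minus_ell2.rep_eq)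
        also have "\<dots> \<le> e\<^sup>2"
          using N[OF k l] by (intro power_mono) (simp_all add: dist_norm)
        finally show "(\<Sum>n<m. (norm (Rep_ell2 (X k) n - Rep_ell2 (X l) n))\<^sup>2) \<le> e\<^sup>2" .
      qed
    qed simp
    then show ?thesis by blast
  qed
  have summ: "summable (\<lambda>n. (norm (Rep_ell2 (X k) n - y n))\<^sup>2)"
    if "\<forall>m. (\<Sum>n<m. (norm (Rep_ell2 (X k) n - y n))\<^sup>2) \<le> c" for k c
    using that by (intro summableI_nonneg_bounded[where x = c]) auto
  have "summable (\<lambda>n. (norm (y n))\<^sup>2)"
  proof -
    obtain k where "\<forall>m. (\<Sum>n<m. (norm (Rep_ell2 (X k) n - y n))\<^sup>2) \<le> 1\<^sup>2"
      using bound[OF zero_less_one] by blast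
    then have "summable (\<lambda>n. (norm (Rep_ell2 (X k) n - y n))\<^sup>2)"
      by (rule summ)
    then have "summable (\<lambda>n. (norm (y n - Rep_ell2 (X k) n))\<^sup>2)"
      by (simp add: norm_minus_commute)
    from ell2_summable_add[OF this, of "Rep_ell2 (X k)"] show ?thesis
      using Rep_ell2[of "X k"] by simp
  qed
  then have y_Rep: "Rep_ell2 (Abs_ell2 y) = y"
    by (simp add: Abs_ell2_inverse)
  have "X \<longlonglongrightarrow> Abs_ell2 y"
  proof (rule metric_LIMSEQ_I)
    fix e :: real assume e: "0 < e"
    then obtain N where N: "\<And>k m. k \<ge> N \<Longrightarrow> (\<Sum>n<m. (norm (Rep_ell2 (X k) n - y n))\<^sup>2) \<le> (e / 2)\<^sup>2"
      using bound[of "e / 2"] by auto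
    show "\<exists>N. \<forall>k\<ge>N. dist (X k) (Abs_ell2 y) < e"
    proof (intro exI allI impI)
      fix k assume k: "N \<le> k"
      have "(norm (X k - Abs_ell2 y))\<^sup>2 \<le> (e / 2)\<^sup>2"
        unfolding power2_norm_ell2 minus_ell2.rep_eq y_Rep
        using N[OF k] summ[of k "(e / 2)\<^sup>2"] by (intro suminf_le_const) blast+
      then have "norm (X k - Abs_ell2 y) \<le> e / 2"
        using e by (simp add: power2_le_iff_abs_le)
      then show "dist (X k) (Abs_ell2 y) < e"
        using e by (simp add: dist_norm)
    qed
  qed
  then show "convergent X"
    by (rule convergentI)
qed

instantiation ell2 :: (complex_inner) complex_inner
begin

lift_definition scaleC_ell2 :: "complex \<Rightarrow> 'a ell2 \<Rightarrow> 'a ell2" is "\<lambda>c f n. c *\<^sub>C f n"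
  by (simp add: norm_scaleC power_mult_distrib summable_mult)

lift_definition cinner_ell2 :: "'a ell2 \<Rightarrow> 'a ell2 \<Rightarrow> complex" is "\<lambda>f g. \<Sum>n. cinner (f n) (g n)" .

instance
proof
  fix x y z :: "'a ell2" and c d :: complex and r :: real
  show "c *\<^sub>C (x + y) = c *\<^sub>C x + c *\<^sub>C y" by transfer (simp add: scaleC_add_right)
  show "(c + d) *\<^sub>C x = c *\<^sub>C x + d *\<^sub>C x" by transfer (simp add: scaleC_add_left)
  show "c *\<^sub>C d *\<^sub>C x = (c * d) *\<^sub>C x" by transfer (simp add: scaleC_scaleC)
  show "r *\<^sub>R x = complex_of_real r *\<^sub>C x" by transfer (simp add: scaleR_scaleC)
  show "cinner (x + y) z = cinner x z + cinner y z"
    by transfer (simp add: cinner_add_left suminf_add ell2_summable_cinner)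
  show "cinner (c *\<^sub>C x) y = c * cinner x y"
    by transfer (simp add: cinner_scaleC_left suminf_mult ell2_summable_cinner)
  show "inner x y = Re (cinner x y)"
    by transfer (simp add: inner_eq_Re_cinner Re_suminf ell2_summable_cinner)
  show "cinner x y = cnj (cinner y x)"
  proof transfer
    fix f g :: "nat \<Rightarrow> 'a"
    assume fg: "summable (\<lambda>n. (norm (f n))\<^sup>2)" "summable (\<lambda>n. (norm (g n))\<^sup>2)"
    have "(\<lambda>n. cnj (cinner (g n) (f n))) sums cnj (\<Sum>n. cinner (g n) (f n))"
      unfolding sums_cnj using fg by (intro summable_sums ell2_summable_cinner)
    moreover have "(\<lambda>n. cnj (cinner (g n) (f n))) = (\<lambda>n. cinner (f n) (g n))"
      by (intro ext cinner_commute[symmetric])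
    ultimately show "(\<Sum>n. cinner (f n) (g n)) = cnj (\<Sum>n. cinner (g n) (f n))"
      by (simp add: sums_iff)
  qed
qed

end

instance ell2 :: (chilbert_space) chilbert_space ..

lift_definition shift :: "'a :: real_normed_vector ell2 \<Rightarrow> 'a ell2"
  is "\<lambda>f n. case n of 0 \<Rightarrow> 0 | Suc m \<Rightarrow> f m"
  by (subst summable_Suc_iff[symmetric]) simp

lift_definition embed0 :: "'a :: real_normed_vector \<Rightarrow> 'a ell2"
  is "\<lambda>v n. if n = 0 then v else 0"
  by (rule summable_finite[of "{0}"]) auto


section \<open>Bounded linear operators\<close>

text \<open>
  Since \<open>Z\<^sub>\<circ>\<close>, \<open>\<F>\<close> and \<open>\<F>'\<close> are closed subspaces depending on the data, operators are
  considered between subspaces \<open>H\<close> and \<open>K\<close> of the ambient types. They are extensional (undefined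
  outside \<open>H\<close>), so that two operators on \<open>H\<close> are equal iff they agree on \<open>H\<close>. For \<open>H = UNIV\<close>
  this is no restriction.
\<close>

definition operators :: "'a :: complex_inner set \<Rightarrow> 'b :: complex_inner set \<Rightarrow> ('a \<Rightarrow> 'b) set" where
  "operators H K = {T \<in> H \<rightarrow>\<^sub>E K.
     (\<forall>x\<in>H. \<forall>y\<in>H. T (x + y) = T x + T y) \<and>
     (\<forall>c. \<forall>x\<in>H. T (c *\<^sub>C x) = c *\<^sub>C T x) \<and>
     (\<exists>M. \<forall>x\<in>H. norm (T x) \<le> M * norm x)}"

definition opnorm_on :: "'a :: real_normed_vector set \<Rightarrow> ('a \<Rightarrow> 'b :: real_normed_vector) \<Rightarrow> real" where
  "opnorm_on H T = (SUP x\<in>{x\<in>H. norm x \<le> 1}. norm (T x))"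

definition unitary_operators :: "'a :: complex_inner set \<Rightarrow> 'b :: complex_inner set \<Rightarrow> ('a \<Rightarrow> 'b) set" where
  "unitary_operators H K = {T \<in> operators H K.
     T ` H = K \<and> (\<forall>x\<in>H. \<forall>y\<in>H. cinner (T x) (T y) = cinner x y)}"

text \<open>
  The definite descriptions below denote: adjoints exist for bounded operators between Hilbert
  spaces, and a non-negative operator has exactly one non-negative square root.
\<close>

definition cadjoint :: "('a :: chilbert_space \<Rightarrow> 'b :: chilbert_space) \<Rightarrow> 'b \<Rightarrow> 'a" where
  "cadjoint T = (THE S. S \<in> operators UNIV UNIV \<and> (\<forall>x y. cinner (T x) y = cinner x (S y)))"

definition nonneg_operator :: "('a :: chilbert_space \<Rightarrow> 'a) \<Rightarrow> bool" where
  "nonneg_operator T \<longleftrightarrow> T \<in> operators UNIV UNIV \<and>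
     (\<forall>x. cinner (T x) x \<in> \<real> \<and> 0 \<le> Re (cinner (T x) x))"

definition op_sqrt :: "('a :: chilbert_space \<Rightarrow> 'a) \<Rightarrow> 'a \<Rightarrow> 'a" where
  "op_sqrt T = (THE R. nonneg_operator R \<and> R \<circ> R = T)"

definition pointwise_stable :: "('a :: chilbert_space \<Rightarrow> 'a) \<Rightarrow> bool" where
  "pointwise_stable T \<longleftrightarrow> (\<forall>h. (\<lambda>n. (T ^^ n) h) \<longlonglongrightarrow> 0)"


section \<open>Schur class functions and Toeplitz operators\<close>

text \<open>Analyticity is complex differentiability in the operator norm.\<close>

definition op_analytic ::
  "'a :: complex_inner set \<Rightarrow> 'b :: complex_inner set \<Rightarrow> (complex \<Rightarrow> 'a \<Rightarrow> 'b) \<Rightarrow> bool" where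
  "op_analytic H K F \<longleftrightarrow> (\<forall>\<zeta>\<in>ball 0 1. \<exists>D\<in>operators H K.
     ((\<lambda>\<xi>. opnorm_on H (\<lambda>x. inverse (\<xi> - \<zeta>) *\<^sub>C (F \<xi> x - F \<zeta> x) - D x)) \<longlongrightarrow> 0) (at \<zeta>))"

definition schur_class ::
  "'a :: complex_inner set \<Rightarrow> 'b :: complex_inner set \<Rightarrow> (complex \<Rightarrow> 'a \<Rightarrow> 'b) set" where
  "schur_class H K = {F \<in> ball 0 1 \<rightarrow>\<^sub>E operators H K.
     op_analytic H K F \<and> (\<forall>\<zeta>\<in>ball 0 1. opnorm_on H (F \<zeta>) \<le> 1)}"

text \<open>
  \<open>taylor_coeff F n\<close> is the \<open>n\<close>-th coefficient of the power series of \<open>F\<close>, which converges on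
  the whole disc when \<open>F\<close> is analytic there.
\<close>

definition taylor_coeff :: "(complex \<Rightarrow> 'a :: complex_inner \<Rightarrow> 'b :: complex_inner) \<Rightarrow> nat \<Rightarrow> 'a \<Rightarrow> 'b" where
  "taylor_coeff F = (THE C. (\<forall>n. C n \<in> operators UNIV UNIV) \<and>
     (\<forall>\<zeta>\<in>ball 0 1. \<forall>u. (\<lambda>n. \<zeta> ^ n *\<^sub>C C n u) sums F \<zeta> u))"

text \<open>For \<open>F\<close> in the Schur class the sequence below is square summable.\<close>

definition toeplitz ::
  "(complex \<Rightarrow> 'u :: chilbert_space \<Rightarrow> 'y :: chilbert_space) \<Rightarrow> 'u ell2 \<Rightarrow> 'y ell2" where
  "toeplitz F h = Abs_ell2 (\<lambda>n. \<Sum>k\<le>n. taylor_coeff F (n - k) (Rep_ell2 h k))"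


section \<open>The interpolation problem\<close>

definition LTONP_data ::
  "('y :: chilbert_space ell2 \<Rightarrow> 'z :: chilbert_space) \<Rightarrow> ('u :: chilbert_space ell2 \<Rightarrow> 'z) \<Rightarrow> ('z \<Rightarrow> 'z) \<Rightarrow> bool"
  where
  "LTONP_data W W' Z \<longleftrightarrow>
     W \<in> operators UNIV UNIV \<and> W' \<in> operators UNIV UNIV \<and> Z \<in> operators UNIV UNIV \<and>
     Z \<circ> W = W \<circ> shift \<and> Z \<circ> W' = W' \<circ> shift"

definition LTONP_solutions ::
  "('y :: chilbert_space ell2 \<Rightarrow> 'z :: chilbert_space) \<Rightarrow> ('u :: chilbert_space ell2 \<Rightarrow> 'z) \<Rightarrow>
   (complex \<Rightarrow> 'u \<Rightarrow> 'y) set" where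
  "LTONP_solutions W W' = {F \<in> schur_class UNIV UNIV. W \<circ> toeplitz F = W'}"

definition pick_operator ::
  "('y :: chilbert_space ell2 \<Rightarrow> 'z :: chilbert_space) \<Rightarrow> ('u :: chilbert_space ell2 \<Rightarrow> 'z) \<Rightarrow> 'z \<Rightarrow> 'z"
  where
  "pick_operator W W' z = W (cadjoint W z) - W' (cadjoint W' z)"

definition pick_space ::
  "('y :: chilbert_space ell2 \<Rightarrow> 'z :: chilbert_space) \<Rightarrow> ('u :: chilbert_space ell2 \<Rightarrow> 'z) \<Rightarrow> 'z set"
  where
  "pick_space W W' = closure (range (pick_operator W W'))"

definition K1_op ::
  "('y :: chilbert_space ell2 \<Rightarrow> 'z :: chilbert_space) \<Rightarrow> ('u :: chilbert_space ell2 \<Rightarrow> 'z) \<Rightarrow> 'u \<times> 'z \<Rightarrow> 'z"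
  where
  "K1_op W W' = (\<lambda>(u, z). W' (embed0 u) + op_sqrt (pick_operator W W') z)"

definition K2_op ::
  "('y :: chilbert_space ell2 \<Rightarrow> 'z :: chilbert_space) \<Rightarrow> ('u :: chilbert_space ell2 \<Rightarrow> 'z) \<Rightarrow> ('z \<Rightarrow> 'z) \<Rightarrow>
   'y \<times> 'z \<Rightarrow> 'z" where
  "K2_op W W' Z = (\<lambda>(y, z). W (embed0 y) + Z (op_sqrt (pick_operator W W') z))"

definition F_space ::
  "('y :: chilbert_space ell2 \<Rightarrow> 'z :: chilbert_space) \<Rightarrow> ('u :: chilbert_space ell2 \<Rightarrow> 'z) \<Rightarrow> ('u \<times> 'z) set"
  where
  "F_space W W' = closure (range (cadjoint (K1_op W W')))"

definition F'_space ::
  "('y :: chilbert_space ell2 \<Rightarrow> 'z :: chilbert_space) \<Rightarrow> ('u :: chilbert_space ell2 \<Rightarrow> 'z) \<Rightarrow> ('z \<Rightarrow> 'z) \<Rightarrow>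
   ('y \<times> 'z) set" where
  "F'_space W W' Z = closure (range (cadjoint (K2_op W W' Z)))"

text \<open>
  The description of \<open>\<omega>\<close> is justified when the data satisfy \<open>\<Lambda> \<ge> 0\<close>: then
  \<open>K\<^sub>1 K\<^sub>1\<^sup>* = K\<^sub>2 K\<^sub>2\<^sup>*\<close>, so \<open>K\<^sub>1\<^sup>* z \<mapsto> K\<^sub>2\<^sup>* z\<close> is isometric.
\<close>

definition omega ::
  "('y :: chilbert_space ell2 \<Rightarrow> 'z :: chilbert_space) \<Rightarrow> ('u :: chilbert_space ell2 \<Rightarrow> 'z) \<Rightarrow> ('z \<Rightarrow> 'z) \<Rightarrow>
   'u \<times> 'z \<Rightarrow> 'y \<times> 'z" where
  "omega W W' Z = (THE \<omega>. \<omega> \<in> unitary_operators (F_space W W') (F'_space W W' Z) \<and>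
     \<omega> \<circ> cadjoint (K1_op W W') = cadjoint (K2_op W W' Z))"

text \<open>
  The space \<open>\<U> \<oplus> Z\<^sub>\<circ>\<close> is the closed subspace \<open>UNIV \<times> Z\<^sub>\<circ>\<close> of the direct sum of the ambient spaces.
\<close>

definition LTONP_parameters ::
  "('y :: chilbert_space ell2 \<Rightarrow> 'z :: chilbert_space) \<Rightarrow> ('u :: chilbert_space ell2 \<Rightarrow> 'z) \<Rightarrow> ('z \<Rightarrow> 'z) \<Rightarrow>
   (complex \<Rightarrow> 'u \<times> 'z \<Rightarrow> 'y \<times> 'z) set" where
  "LTONP_parameters W W' Z =
     {G \<in> schur_class (UNIV \<times> pick_space W W') (UNIV \<times> pick_space W W').
        restrict (G 0) (F_space W W') = omega W W' Z}"

text \<open>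
  The inverse of \<open>I - \<zeta> G\<^sub>2\<^sub>2(\<zeta>)\<close> is that of a map on \<open>Z\<^sub>\<circ>\<close>; it exists for
  \<open>G\<close> in the Schur class and \<open>\<zeta>\<close> in the unit disc, because then \<open>\<zeta> G\<^sub>2\<^sub>2(\<zeta>)\<close> has norm less than 1.
\<close>

definition redheffer ::
  "'z :: chilbert_space set \<Rightarrow> (complex \<Rightarrow> 'u :: chilbert_space \<times> 'z \<Rightarrow> 'y :: chilbert_space \<times> 'z) \<Rightarrow>
   complex \<Rightarrow> 'u \<Rightarrow> 'y" where
  "redheffer Z0 G = (\<lambda>\<zeta>\<in>ball 0 1. \<lambda>u.
     let G11 = (\<lambda>u. fst (G \<zeta> (u, 0))); G12 = (\<lambda>z. fst (G \<zeta> (0, z)));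
         G21 = (\<lambda>u. snd (G \<zeta> (u, 0))); G22 = (\<lambda>z. snd (G \<zeta> (0, z)))
     in G11 u + \<zeta> *\<^sub>C G12 (inv_into Z0 (\<lambda>z. z - \<zeta> *\<^sub>C G22 z) (G21 u)))"

end

theory Submission
  imports Defs "HOL-Complex_Analysis.Complex_Analysis"
begin

text \<open>
  A Schur class function is the same as a coefficient sequence whose lower triangular Toeplitz operator
  is a contraction, and the Redheffer formula describes the system \<open>G\<close> whose second output is fed back
  with delay one; the energy inequality for this loop bounds the states. The condition \<open>G(0)|\<F> = \<omega>\<close> is
  \<open>G(0) K\<^sub>1\<^sup>* = K\<^sub>2\<^sup>*\<close>, and because \<open>\<omega>\<close> is isometric it gives \<open>K\<^sub>2 G(\<lambda>) = K\<^sub>1\<close>. For the loop with input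
  \<open>u\<^sub>n\<close>, output \<open>y\<^sub>n\<close> and state \<open>x\<^sub>n\<close> this reads
  \<open>B y\<^sub>n + Z \<Lambda>\<^sup>1\<^sup>/\<^sup>2 x\<^sub>n\<^sub>+\<^sub>1 = B' u\<^sub>n + \<Lambda>\<^sup>1\<^sup>/\<^sup>2 x\<^sub>n\<close> with \<open>B'\<close> the paper's \<open>B\<close>-tilde. Applying \<open>Z\<^sup>n\<close> and
  summing telescopes; the remainder \<open>Z\<^sup>n \<Lambda>\<^sup>1\<^sup>/\<^sup>2 x\<^sub>n\<close> tends weakly to zero since the states are bounded and
  \<open>Z\<^sup>*\<close> is pointwise stable. This gives the interpolation condition, and the same argument applied to the
  difference of two systems shows that \<open>G\<close> is determined by \<open>F\<close>. Conversely a solution is realised by a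
  coisometric colligation whose state space contains \<open>Z\<^sub>\<circ>\<close>, and cutting the loop through \<open>Z\<^sub>\<circ>\<close> yields \<open>G\<close>.
\<close>

section \<open>Complex Hilbert spaces\<close>

text \<open>In coefficients the loop becomes a causal recursion with finite sums: linearity, energy
  balance and uniqueness are inductions on time, and the inverse of I - \<lambda> G_22(\<lambda>) is
  met only when the two power series are compared. Three facts on contractions carry the proof. Two
  operators A, B with |A h| = |B h| for all h are intertwined by a partial isometry; this yields
  \<omega>, the colligation M and the embedding V. A contraction that keeps the norm of f preserves
  all inner products with f. And since G(0) keeps the norm of K_1^* z, the energy bound on a column
  makes the later coefficients vanish on K_1^* z. Solvability comes from a constant parameter:
  \<omega> extended by zero. The colligation of a solution is the construction of \<omega> once
  more, for the data I, T, S on the sequence space, whose Pick operator is I - T T^*.\<close>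

interpretation scaleC: bounded_bilinear "scaleC :: complex \<Rightarrow> 'a \<Rightarrow> 'a::complex_inner"
proof
  show "(a + a') *\<^sub>C b = a *\<^sub>C b + a' *\<^sub>C (b::'a)" for a a' b by (rule scaleC_add_left)
  show "a *\<^sub>C (b + b') = a *\<^sub>C b + a *\<^sub>C (b'::'a)" for a b b' by (rule scaleC_add_right)
  show "(r *\<^sub>R a) *\<^sub>C b = r *\<^sub>R a *\<^sub>C (b::'a)" for r a b
    by (simp only: scaleR_scaleC[of r b] scaleR_scaleC[of r "a *\<^sub>C b"] scaleC_scaleC scaleR_conv_of_real)
  show "a *\<^sub>C (r *\<^sub>R b) = r *\<^sub>R a *\<^sub>C (b::'a)" for r a b
    by (simp add: scaleR_scaleC scaleC_scaleC mult.commute)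
  show "\<exists>K. \<forall>a (b::'a). norm (a *\<^sub>C b) \<le> norm a * norm b * K"
    by (rule exI[of _ 1]) (simp add: norm_scaleC)
qed

declare scaleC.zero_left [simp] scaleC.zero_right [simp]

lemma scaleC_one [simp]: "1 *\<^sub>C (x::'a::complex_inner) = x"
  using scaleR_scaleC[of 1 x] by simp

lemma cinner_scaleC_right: "cinner x (c *\<^sub>C y) = cnj c * cinner x (y::'a::complex_inner)"
  by (metis cinner_commute cinner_scaleC_left complex_cnj_mult)

lemma cinner_add_right: "cinner x (y + z) = cinner x y + cinner x (z::'a::complex_inner)"
  by (metis cinner_commute cinner_add_left complex_cnj_add)

lemma inner_scaleC_left: "inner (c *\<^sub>C x) y = inner x (cnj c *\<^sub>C (y::'a::complex_inner))"
  by (simp add: inner_eq_Re_cinner cinner_scaleC_left cinner_scaleC_right)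

text \<open>The imaginary part is the real inner product with i y. Projections, Riesz representation
  and adjoints can thus be developed for the real inner product and transferred afterwards.\<close>

lemma cinner_eq_Complex: "cinner x y = Complex (inner x y) (inner x (\<i> *\<^sub>C (y::'a::complex_inner)))"
  by (simp add: complex_eq_iff Im_cinner inner_eq_Re_cinner[of x y] inner_scaleC_left)

lemma fst_scaleC [simp]: "fst (c *\<^sub>C x) = c *\<^sub>C fst x"
  and snd_scaleC [simp]: "snd (c *\<^sub>C x) = c *\<^sub>C snd x"
  by (simp_all add: scaleC_prod_def)

lemma norm_prod_power2: "(norm (x::'a::real_inner \<times> 'b::real_inner))\<^sup>2 = (norm (fst x))\<^sup>2 + (norm (snd x))\<^sup>2"
  by (simp add: norm_prod_def)

lemma scaleC_Pair: "c *\<^sub>C (x, y) = (c *\<^sub>C x, c *\<^sub>C y)"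
  by (simp add: scaleC_prod_def)

lemma zero_if_inner_zero:
  assumes "\<And>y. inner x y = 0"
  shows "(x::'a::real_inner) = 0"
  using assms[of x] by simp

lemma eq_if_inner_eq:
  assumes "\<And>z. inner x z = inner y z"
  shows "(x::'a::real_inner) = y"
  using zero_if_inner_zero[of "x - y"] assms by (simp add: inner_diff_left)

lemma norm_cinner_le: "norm (cinner x (y::'a::complex_inner)) \<le> norm x * norm y"
proof -
  \<comment> \<open>A unimodular factor (zero if the inner product vanishes) that rotates the
    complex inner product onto its modulus, so the real Cauchy-Schwarz inequality applies.\<close>
  define u where "u = cnj (sgn (cinner x y))"
  have "u * cinner x y = of_real (norm (cinner x y))"
    by (cases "cinner x y = 0") (simp_all add: u_def sgn_eq complex_norm_square[symmetric] power2_eq_square mult.commute)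
  then have "norm (cinner x y) = inner (u *\<^sub>C x) y"
    by (simp add: inner_eq_Re_cinner cinner_scaleC_left)
  also have "\<dots> \<le> norm (u *\<^sub>C x) * norm y" by (rule norm_cauchy_schwarz)
  also have "\<dots> \<le> norm x * norm y"
    by (rule mult_right_mono) (auto simp: norm_scaleC u_def norm_sgn)
  finally show ?thesis .
qed

lemma bounded_linear_cinner_left: "bounded_linear (\<lambda>x. cinner x (y::'a::complex_inner))"
proof (rule bounded_linear_intro[where K = "norm y"])
  show "cinner (r *\<^sub>R x) y = r *\<^sub>R cinner x y" for r x
    unfolding scaleR_scaleC[of r x] cinner_scaleC_left scaleR_conv_of_real ..
qed (simp_all add: cinner_add_left norm_cinner_le)

lemma cinner_zero_left [simp]: "cinner 0 (y::'a::complex_inner) = 0"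
  using cinner_scaleC_left[of 0 0 y] by simp

lemma cinner_eq_zeroI: "(\<And>y. cinner x y = 0) \<Longrightarrow> (x::'a::complex_inner) = 0"
  by (rule zero_if_inner_zero) (simp add: inner_eq_Re_cinner)

lemma cinner_sum_left: "cinner (sum f A) y = (\<Sum>i\<in>A. cinner (f i) (y::'a::complex_inner))"
  by (induction A rule: infinite_finite_induct) (simp_all add: cinner_add_left)

lemma cinner_sum_right: "cinner y (sum f A) = (\<Sum>i\<in>A. cinner y (f i :: 'a::complex_inner))"
  using cinner_sum_left[of f A y] by (subst (1 2) cinner_commute) simp

lemma cinner_self: "cinner x x = complex_of_real ((norm (x::'a::complex_inner))\<^sup>2)"
proof -
  have "Im (cinner x x) = 0"
    using cinner_commute[of x x] by (metis Reals_cnj_iff complex_is_Real_iff)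
  then show ?thesis by (simp add: complex_eq_iff power2_norm_eq_inner inner_eq_Re_cinner)
qed

subsection \<open>Closed subspaces and orthogonal projection\<close>

definition closed_csubspace :: "'a::complex_inner set \<Rightarrow> bool" where
  "closed_csubspace S \<longleftrightarrow> closed S \<and> 0 \<in> S \<and> (\<forall>x\<in>S. \<forall>y\<in>S. x + y \<in> S) \<and> (\<forall>c. \<forall>x\<in>S. c *\<^sub>C x \<in> S)"

lemma closed_csubspaceD:
  assumes "closed_csubspace S"
  shows "closed S" "0 \<in> S" "x \<in> S \<Longrightarrow> y \<in> S \<Longrightarrow> x + y \<in> S" "x \<in> S \<Longrightarrow> c *\<^sub>C x \<in> S"
    "subspace S" "x \<in> S \<Longrightarrow> y \<in> S \<Longrightarrow> x - y \<in> S"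
proof -
  show *: "subspace S"
    using assms unfolding closed_csubspace_def subspace_def by (auto simp: scaleR_scaleC)
  then show "x \<in> S \<Longrightarrow> y \<in> S \<Longrightarrow> x - y \<in> S" by (rule subspace_diff)
qed (use assms in \<open>auto simp: closed_csubspace_def\<close>)

lemma closed_csubspace_UNIV [simp]: "closed_csubspace UNIV"
  by (simp add: closed_csubspace_def)

lemma closed_csubspace_Times:
  assumes "closed_csubspace S" "closed_csubspace T"
  shows "closed_csubspace (S \<times> T)"
  using assms by (auto simp: closed_csubspace_def closed_Times scaleC_Pair zero_prod_def)

lemma closed_csubspace_closure:
  assumes "0 \<in> S" "\<And>x y. x \<in> S \<Longrightarrow> y \<in> S \<Longrightarrow> x + y \<in> S" "\<And>c x. x \<in> S \<Longrightarrow> c *\<^sub>C x \<in> S"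
  shows "closed_csubspace (closure S)"
  unfolding closed_csubspace_def
proof (intro conjI ballI allI)
  show "0 \<in> closure S" using assms(1) closure_subset by blast
next
  fix x y assume "x \<in> closure S" "y \<in> closure S"
  then obtain f g where "\<forall>n. f n \<in> S" "f \<longlonglongrightarrow> x" "\<forall>n. g n \<in> S" "g \<longlonglongrightarrow> y"
    unfolding closure_sequential by blast
  then show "x + y \<in> closure S"
    unfolding closure_sequential
    by (intro exI[of _ "\<lambda>n. f n + g n"]) (auto intro: assms tendsto_intros)
next
  fix c x assume "x \<in> closure S"
  then obtain f where "\<forall>n. f n \<in> S" "f \<longlonglongrightarrow> x"
    unfolding closure_sequential by blast
  then show "c *\<^sub>C x \<in> closure S"
    unfolding closure_sequential
    by (intro exI[of _ "\<lambda>n. c *\<^sub>C f n"]) (auto intro: assms scaleC.tendsto)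
qed simp

text \<open>A quadratic that is nonnegative and vanishes at t = 0 has slope zero there. The test
  point -a / (b + 1) stands in for the minimiser -a / b so that b = 0 is covered.\<close>

lemma linear_coeff_zero:
  fixes a b :: real
  assumes "\<And>t. 0 \<le> 2 * t * a + t\<^sup>2 * b" "0 \<le> b"
  shows "a = 0"
proof (rule ccontr)
  assume a: "a \<noteq> 0"
  have "2 * (- a / (b + 1)) * a + (- a / (b + 1))\<^sup>2 * b = - (a\<^sup>2 * (b + 2) / (b + 1)\<^sup>2)"
    using assms(2) by (simp add: power2_eq_square field_simps add_nonneg_eq_0_iff)
  moreover have "a\<^sup>2 * (b + 2) / (b + 1)\<^sup>2 > 0"
    using a assms(2) by (intro divide_pos_pos mult_pos_pos) auto
  ultimately show False using assms(1)[of "- a / (b + 1)"] by linarith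
qed

lemma orthogonal_projection_exists:
  fixes S :: "'a::{real_inner,complete_space} set"
  assumes S: "closed S" "subspace S"
  shows "\<exists>p\<in>S. \<forall>s\<in>S. inner (x - p) s = 0"
proof -
  define d where "d = (INF s\<in>S. (norm (x - s))\<^sup>2)"
  have bdd: "bdd_below ((\<lambda>s. (norm (x - s))\<^sup>2) ` S)"
    by (rule bdd_belowI[of _ 0]) auto
  have ne: "S \<noteq> {}" using subspace_0[OF S(2)] by auto
  have low: "d \<le> (norm (x - s))\<^sup>2" if "s \<in> S" for s
    unfolding d_def using cINF_lower[OF bdd that] .
  have "\<exists>s\<in>S. (norm (x - s))\<^sup>2 < d + inverse (real (Suc n))" for n
    using cINF_less_iff[OF ne bdd, of "d + inverse (real (Suc n))"] by (simp add: d_def)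
  then obtain s where s: "\<And>n. s n \<in> S" "\<And>n. (norm (x - s n))\<^sup>2 < d + inverse (real (Suc n))"
    by metis
  \<comment> \<open>Parallelogram law: the midpoint of two almost minimal points lies in S, so it is
    at squared distance at least d from x, which forces the two points together.\<close>
  have par: "(norm (s n - s m))\<^sup>2 \<le> 2 * inverse (real (Suc n)) + 2 * inverse (real (Suc m))" for n m
  proof -
    have "(norm (s n - s m))\<^sup>2 = 2 * (norm (x - s n))\<^sup>2 + 2 * (norm (x - s m))\<^sup>2 - 4 * (norm (x - (1/2) *\<^sub>R (s n + s m)))\<^sup>2"
      by (simp add: power2_norm_eq_inner inner_simps inner_commute algebra_simps)
    moreover have "d \<le> (norm (x - (1/2) *\<^sub>R (s n + s m)))\<^sup>2"
      by (intro low subspace_scale subspace_add S s)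
    ultimately show ?thesis using s(2)[of n] s(2)[of m] by linarith
  qed
  have "Cauchy s"
  proof (rule metric_CauchyI)
    fix e :: real assume e: "0 < e"
    obtain N where N: "inverse (real (Suc N)) < e\<^sup>2 / 4"
      using reals_Archimedean[of "e\<^sup>2/4"] e by auto
    show "\<exists>N. \<forall>m\<ge>N. \<forall>n\<ge>N. dist (s m) (s n) < e"
    proof (intro exI allI impI)
      fix m n assume mn: "m \<ge> N" "n \<ge> N"
      have "inverse (real (Suc m)) \<le> inverse (real (Suc N))" "inverse (real (Suc n)) \<le> inverse (real (Suc N))"
        using mn by (auto intro: le_imp_inverse_le)
      then have "(norm (s m - s n))\<^sup>2 < e\<^sup>2" using par[of m n] N by linarith
      then show "dist (s m) (s n) < e"
        using e by (simp add: dist_norm power_less_imp_less_base)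
    qed
  qed
  then obtain p where p: "s \<longlonglongrightarrow> p" using Cauchy_convergent convergent_def by blast
  have pS: "p \<in> S" using closed_sequentially[OF S(1)] s(1) p by blast
  have pd: "(norm (x - p))\<^sup>2 \<le> d"
  proof (rule LIMSEQ_le)
    show "(\<lambda>n. (norm (x - s n))\<^sup>2) \<longlonglongrightarrow> (norm (x - p))\<^sup>2" by (intro tendsto_intros p)
    show "(\<lambda>n. d + inverse (real (Suc n))) \<longlonglongrightarrow> d"
      using tendsto_add[OF tendsto_const LIMSEQ_inverse_real_of_nat, of d] by simp
  qed (use s(2) less_imp_le in blast)
  have "inner (x - p) v = 0" if v: "v \<in> S" for v
  proof (rule linear_coeff_zero)
    fix t :: real
    have "(norm (x - p))\<^sup>2 \<le> (norm (x - (p - t *\<^sub>R v)))\<^sup>2"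
      using pd low[of "p - t *\<^sub>R v"] subspace_diff[OF S(2) pS subspace_scale[OF S(2) v, of t]] by linarith
    also have "x - (p - t *\<^sub>R v) = (x - p) + t *\<^sub>R v" by simp
    finally have "(norm (x - p))\<^sup>2 \<le> (norm (x - p + t *\<^sub>R v))\<^sup>2" .
    moreover have "(norm (x - p + t *\<^sub>R v))\<^sup>2 = (norm (x - p))\<^sup>2 + 2 * t * inner (x - p) v + t\<^sup>2 * (norm v)\<^sup>2"
      using dot_norm[of "x - p" "t *\<^sub>R v"] by (simp add: power_mult_distrib)
    ultimately show "0 \<le> 2 * t * inner (x - p) v + t\<^sup>2 * (norm v)\<^sup>2" by linarith
  qed simp
  then show ?thesis using pS by blast
qed

lemma riesz_representation:
  fixes f :: "'a::{real_inner,complete_space} \<Rightarrow> real"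
  assumes f: "bounded_linear f"
  shows "\<exists>c. \<forall>x. f x = inner c x"
proof (cases "\<forall>x. f x = 0")
  case True
  then show ?thesis by (intro exI[of _ 0]) simp
next
  case False
  interpret bounded_linear f by fact
  obtain x where x: "f x \<noteq> 0" using False by blast
  have "closed (f -` {0})"
    by (intro closed_vimage continuous_on continuous_on_id) auto
  moreover have "subspace (f -` {0})"
    by (auto simp: subspace_def zero add scaleR)
  ultimately obtain p where p: "f p = 0" "\<And>s. f s = 0 \<Longrightarrow> inner (x - p) s = 0"
    using orthogonal_projection_exists[of "f -` {0}" x] by auto
  define v where "v = x - p"
  have fv: "f v \<noteq> 0" using x p by (simp add: v_def diff)
  have "inner v y = (f y / f v) * inner v v" for y
  proof -
    have "f (y - (f y / f v) *\<^sub>R v) = 0" using fv by (simp add: diff scaleR)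
    from p(2)[OF this] show ?thesis by (simp add: v_def[symmetric] inner_diff_right)
  qed
  moreover have "inner v v \<noteq> 0" using fv zero by auto
  ultimately have "f y = inner ((f v / inner v v) *\<^sub>R v) y" for y
    using fv by (simp add: field_simps)
  then show ?thesis by blast
qed

subsection \<open>Operators and adjoints\<close>

lemma operators_UNIV_iff:
  "T \<in> operators UNIV UNIV \<longleftrightarrow> bounded_linear T \<and> (\<forall>c x. T (c *\<^sub>C x) = c *\<^sub>C T x)"
proof
  assume T: "T \<in> operators UNIV UNIV"
  then obtain M where M: "\<And>x. norm (T x) \<le> M * norm x" by (auto simp: operators_def)
  have "bounded_linear T"
    by (rule bounded_linear_intro[of _ M])
      (use T M in \<open>auto simp: operators_def scaleR_scaleC mult.commute\<close>)
  then show "bounded_linear T \<and> (\<forall>c x. T (c *\<^sub>C x) = c *\<^sub>C T x)"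
    using T by (auto simp: operators_def)
next
  assume *: "bounded_linear T \<and> (\<forall>c x. T (c *\<^sub>C x) = c *\<^sub>C T x)"
  then interpret bounded_linear T by simp
  show "T \<in> operators UNIV UNIV"
    using * bounded by (auto simp: operators_def add mult.commute)
qed

lemma operatorsD:
  assumes "T \<in> operators H K" "closed_csubspace H"
  shows "x \<in> H \<Longrightarrow> T x \<in> K" "x \<in> H \<Longrightarrow> y \<in> H \<Longrightarrow> T (x + y) = T x + T y"
    "x \<in> H \<Longrightarrow> T (c *\<^sub>C x) = c *\<^sub>C T x" "T 0 = 0" "x \<in> H \<Longrightarrow> y \<in> H \<Longrightarrow> T (x - y) = T x - T y"
    "(\<And>i. i \<in> I \<Longrightarrow> f i \<in> H) \<Longrightarrow> T (sum f I) = (\<Sum>i\<in>I. T (f i))"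
proof -
  note H = closed_csubspaceD[OF assms(2)]
  show *: "x \<in> H \<Longrightarrow> T x \<in> K" "\<And>x y. x \<in> H \<Longrightarrow> y \<in> H \<Longrightarrow> T (x + y) = T x + T y"
    "\<And>c x. x \<in> H \<Longrightarrow> T (c *\<^sub>C x) = c *\<^sub>C T x" for x
    using assms(1) by (auto simp: operators_def)
  show 0: "T 0 = 0" using *(2)[of 0 0] H(2) by simp
  show "T (x - y) = T x - T y" if "x \<in> H" "y \<in> H" for x y
    using *(2)[of "x - y" y] H(6) that by (simp add: algebra_simps)
  show "(\<And>i. i \<in> I \<Longrightarrow> f i \<in> H) \<Longrightarrow> T (sum f I) = (\<Sum>i\<in>I. T (f i))"
  proof (induction I rule: infinite_finite_induct)
    case (insert i I)
    then have "sum f I \<in> H" by (intro subspace_sum H) auto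
    with insert show ?case by (simp add: *(2))
  qed (simp_all add: 0)
qed

lemma restrict_operators:
  assumes "T \<in> operators H K" "closed_csubspace S" "S \<subseteq> H"
  shows "restrict T S \<in> operators S K"
proof -
  obtain M where M: "\<forall>x\<in>H. norm (T x) \<le> M * norm x" using assms(1) by (auto simp: operators_def)
  then have "\<forall>x\<in>S. norm (T x) \<le> M * norm x" using assms(3) by blast
  then show ?thesis
    using assms closed_csubspaceD(3,4)[OF assms(2)] by (auto simp: operators_def subset_iff)
qed

lemma operators_bounded_linear: "T \<in> operators UNIV UNIV \<Longrightarrow> bounded_linear T"
  and operators_scaleC: "T \<in> operators UNIV UNIV \<Longrightarrow> T (c *\<^sub>C x) = c *\<^sub>C T x"
  by (simp_all add: operators_UNIV_iff)

lemma operators_compose: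
  "S \<in> operators UNIV UNIV \<Longrightarrow> T \<in> operators UNIV UNIV \<Longrightarrow> (\<lambda>x. S (T x)) \<in> operators UNIV UNIV"
  by (simp add: operators_UNIV_iff bounded_linear_compose)

lemma operators_diff:
  "S \<in> operators UNIV UNIV \<Longrightarrow> T \<in> operators UNIV UNIV \<Longrightarrow> (\<lambda>x. S x - T x) \<in> operators UNIV UNIV"
  by (simp add: operators_UNIV_iff bounded_linear_sub scaleC.diff_right)

lemma operators_add:
  "S \<in> operators UNIV UNIV \<Longrightarrow> T \<in> operators UNIV UNIV \<Longrightarrow> (\<lambda>x. S x + T x) \<in> operators UNIV UNIV"
  by (simp add: operators_UNIV_iff bounded_linear_add scaleC_add_right)

lemma operators_Pair:
  "S \<in> operators UNIV UNIV \<Longrightarrow> T \<in> operators UNIV UNIV \<Longrightarrow> (\<lambda>x. (S x, T x)) \<in> operators UNIV UNIV"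
  by (simp add: operators_UNIV_iff bounded_linear_Pair scaleC_Pair)

lemma operators_simple [simp]:
  "(\<lambda>x. x) \<in> operators UNIV UNIV" "fst \<in> operators UNIV UNIV" "snd \<in> operators UNIV UNIV"
  by (simp_all add: operators_UNIV_iff bounded_linear_ident bounded_linear_fst bounded_linear_snd)

lemma closed_csubspace_closure_range:
  assumes T: "T \<in> operators UNIV UNIV"
  shows "closed_csubspace (closure (range T))"
proof (rule closed_csubspace_closure)
  interpret bounded_linear T by (rule operators_bounded_linear[OF T])
  show "0 \<in> range T" using zero by (metis rangeI)
  show "x + y \<in> range T" if "x \<in> range T" "y \<in> range T" for x y
    using that add by (metis (no_types, lifting) imageE rangeI)
  show "c *\<^sub>C x \<in> range T" if "x \<in> range T" for c x
    using that operators_scaleC[OF T] by (metis (no_types, lifting) imageE rangeI)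
qed

text \<open>Boundedness on the domain gives sequential continuity there. Two domains are allowed
  because \<omega> lives on F only, parameters on the sum with Z_o, and the extension of \<omega> on
  the whole space.\<close>

lemma operators_eq_on_closure:
  assumes S: "S \<in> operators H K" and T: "T \<in> operators H' K'" and H: "closed_csubspace H" and H': "closed_csubspace H'"
    and eq: "\<And>x. S (A x) = T (A x)" and A: "range A \<subseteq> H" "range A \<subseteq> H'" and x: "x \<in> closure (range A)"
  shows "S x = T x"
proof -
  have lim: "(\<lambda>n. R (f n)) \<longlonglongrightarrow> R x" if R: "R \<in> operators L M" and L: "closed_csubspace L"
    and f: "\<And>n. f n \<in> L" "f \<longlonglongrightarrow> x" "x \<in> L" for R :: "'a \<Rightarrow> 'b" and L M f
  proof -
    obtain B where B: "\<forall>x\<in>L. norm (R x) \<le> B * norm x" using R by (auto simp: operators_def)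
    have "(\<lambda>n. R (f n) - R x) \<longlonglongrightarrow> 0"
    proof (rule Lim_null_comparison[OF always_eventually])
      show "\<forall>n. norm (R (f n) - R x) \<le> B * norm (f n - x)"
        using B closed_csubspaceD(6)[OF L] f by (simp add: operatorsD(5)[OF R L, symmetric])
      show "(\<lambda>n. B * norm (f n - x)) \<longlonglongrightarrow> 0"
        by (intro tendsto_mult_right_zero tendsto_norm_zero LIM_zero f)
    qed
    then show ?thesis by (rule LIM_zero_cancel)
  qed
  obtain f where f: "\<And>n. f n \<in> range A" "f \<longlonglongrightarrow> x" using x unfolding closure_sequential by blast
  have xH: "x \<in> H" "x \<in> H'"
    using x closure_minimal[OF A(1) closed_csubspaceD(1)[OF H]] closure_minimal[OF A(2) closed_csubspaceD(1)[OF H']] by auto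
  have "(\<lambda>n. S (f n)) \<longlonglongrightarrow> S x" by (rule lim[OF S H _ f(2) xH(1)]) (use f(1) A in blast)
  moreover have "(\<lambda>n. T (f n)) \<longlonglongrightarrow> T x" by (rule lim[OF T H' _ f(2) xH(2)]) (use f(1) A in blast)
  moreover have "S (f n) = T (f n)" for n using f(1)[of n] eq by auto
  ultimately show ?thesis using LIMSEQ_unique by fastforce
qed

text \<open>Testing the real adjoint relation with i y and using that S is complex linear recovers
  the imaginary part.\<close>

lemma cinner_adjoint:
  assumes "T \<in> operators UNIV UNIV" "S \<in> operators UNIV UNIV" "\<And>x y. inner (T x) y = inner x (S y)"
  shows "cinner (T x) y = cinner x (S y)"
  using assms(3) operators_scaleC[OF assms(2), of "\<i>" y] assms(3)[of x "\<i> *\<^sub>C y"] by (simp add: cinner_eq_Complex)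

lemma adjoint_operator_exists:
  fixes T :: "'a::chilbert_space \<Rightarrow> 'b::chilbert_space"
  assumes T: "T \<in> operators UNIV UNIV"
  shows "\<exists>S\<in>operators UNIV UNIV. \<forall>x y. inner (T x) y = inner x (S y)"
proof -
  interpret T: bounded_linear T by (rule operators_bounded_linear[OF T])
  have "\<exists>c. \<forall>x. inner (T x) y = inner c x" for y
    by (intro riesz_representation bounded_linear_compose[OF bounded_linear_inner_left] T.bounded_linear_axioms)
  then obtain S where S: "\<And>x y. inner (T x) y = inner (S y) x" by metis
  obtain K where K: "K \<ge> 0" "\<And>x. norm (T x) \<le> norm x * K" using T.nonneg_bounded by blast
  have "bounded_linear S"
  proof (rule bounded_linear_intro[where K = K])
    show "S (x + y) = S x + S y" for x y
      by (rule eq_if_inner_eq) (simp add: inner_add_left S[symmetric] inner_add_right)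
    show "S (r *\<^sub>R x) = r *\<^sub>R S x" for r x
      by (rule eq_if_inner_eq) (simp add: S[symmetric])
    show "norm (S y) \<le> norm y * K" for y
    proof (cases "S y = 0")
      case False
      have "norm (S y) * norm (S y) = inner (T (S y)) y"
        by (simp add: S power2_norm_eq_inner[symmetric] power2_eq_square)
      also have "\<dots> \<le> norm (T (S y)) * norm y" by (rule norm_cauchy_schwarz)
      also have "\<dots> \<le> norm (S y) * K * norm y" by (rule mult_right_mono[OF K(2)]) simp
      finally show ?thesis using False by (simp add: mult.commute mult.left_commute)
    qed (simp add: K)
  qed
  moreover have "S (c *\<^sub>C x) = c *\<^sub>C S x" for c x
  proof (rule eq_if_inner_eq)
    fix z
    have "inner (S (c *\<^sub>C x)) z = inner (T z) (c *\<^sub>C x)" by (simp add: S)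
    also have "\<dots> = inner (T (cnj c *\<^sub>C z)) x"
      by (simp add: operators_scaleC[OF T] inner_scaleC_left)
    also have "\<dots> = inner (S x) (cnj c *\<^sub>C z)" by (simp add: S)
    finally show "inner (S (c *\<^sub>C x)) z = inner (c *\<^sub>C S x) z" by (simp add: inner_scaleC_left)
  qed
  ultimately show ?thesis unfolding operators_UNIV_iff[symmetric] using S by (metis inner_commute operators_UNIV_iff)
qed

lemma cadjoint_eqI:
  fixes T :: "'a::chilbert_space \<Rightarrow> 'b::chilbert_space"
  assumes "T \<in> operators UNIV UNIV" "S \<in> operators UNIV UNIV" "\<And>x y. inner (T x) y = inner x (S y)"
  shows "cadjoint T = S"
  unfolding cadjoint_def
proof (rule the_equality)
  show "S \<in> operators UNIV UNIV \<and> (\<forall>x y. cinner (T x) y = cinner x (S y))"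
    using cinner_adjoint[OF assms] assms(2) by blast
next
  fix S' assume S': "S' \<in> operators UNIV UNIV \<and> (\<forall>x y. cinner (T x) y = cinner x (S' y))"
  show "S' = S"
  proof
    fix y
    have "inner x (S' y) = inner x (S y)" for x
      by (metis S' assms(3) inner_eq_Re_cinner)
    then show "S' y = S y" by (metis eq_if_inner_eq inner_commute)
  qed
qed

lemma cadjoint_operators:
  fixes T :: "'a::chilbert_space \<Rightarrow> 'b::chilbert_space"
  shows "T \<in> operators UNIV UNIV \<Longrightarrow> cadjoint T \<in> operators UNIV UNIV"
  using adjoint_operator_exists[of T] cadjoint_eqI[of T] by blast

lemma inner_cadjoint:
  fixes T :: "'a::chilbert_space \<Rightarrow> 'b::chilbert_space"
  shows "T \<in> operators UNIV UNIV \<Longrightarrow> inner (T x) y = inner x (cadjoint T y)"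
  using adjoint_operator_exists[of T] cadjoint_eqI[of T] by blast

subsection \<open>Contractions\<close>

text \<open>In |T (g + t f)|^2 \<le> |g + t f|^2 the terms in t^2 cancel because |T f| = |f|. What
  remains is affine in t and nonnegative for every real t, so its slope vanishes. Only linearity
  along this line enters, which suits operators given on a subspace.\<close>

lemma contraction_isometric_vector:
  fixes T :: "'a::real_inner \<Rightarrow> 'b::real_inner"
  assumes H: "subspace H" and f: "f \<in> H" and g: "g \<in> H"
    and lin: "\<And>t. T (g + t *\<^sub>R f) = T g + t *\<^sub>R T f"
    and contr: "\<And>x. x \<in> H \<Longrightarrow> norm (T x) \<le> norm x" and iso: "norm (T f) = norm f"
  shows "inner (T g) (T f) = inner g f"
proof -
  have "inner g f - inner (T g) (T f) = 0"
  proof (rule ccontr)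
    assume ne: "inner g f - inner (T g) (T f) \<noteq> 0"
    define a where "a = inner g f - inner (T g) (T f)"
    define b where "b = (norm g)\<^sup>2 - (norm (T g))\<^sup>2"
    have *: "0 \<le> b + 2 * t * a" for t
    proof -
      have "g + t *\<^sub>R f \<in> H" using H f g by (intro subspace_add subspace_scale)
      from contr[OF this] have "(norm (T (g + t *\<^sub>R f)))\<^sup>2 \<le> (norm (g + t *\<^sub>R f))\<^sup>2"
        by (simp add: power_mono)
      then have "(norm (T g))\<^sup>2 + 2 * t * inner (T g) (T f) + t\<^sup>2 * (norm (T f))\<^sup>2
          \<le> (norm g)\<^sup>2 + 2 * t * inner g f + t\<^sup>2 * (norm f)\<^sup>2"
        unfolding lin power2_norm_eq_inner
        by (simp add: inner_add_left inner_add_right inner_commute power2_eq_square algebra_simps)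
      then show ?thesis by (simp add: iso a_def b_def algebra_simps)
    qed
    have "2 * (- (b + 1) / (2 * a)) * a = - (b + 1)" using ne by (simp add: a_def[symmetric])
    then show False using *[of "- (b + 1) / (2 * a)"] by linarith
  qed
  then show ?thesis by simp
qed

text \<open>
  On the closed subspace \<open>S\<close> spanned by the pairs \<open>(A h, B h)\<close> both coordinate maps have the same norm.
  Hence the projection of \<open>(2x, 0)\<close> onto \<open>S\<close> has as first coordinate the projection of \<open>x\<close> onto the
  closed range of \<open>A\<close>, and its second coordinate is the value \<open>M x\<close> of the required partial isometry.
\<close>

lemma contraction_exists:
  fixes A :: "'h::chilbert_space \<Rightarrow> 'a::chilbert_space" and B :: "'h \<Rightarrow> 'b::chilbert_space"
  assumes A: "A \<in> operators UNIV UNIV" and B: "B \<in> operators UNIV UNIV"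
    and eq: "\<And>h. norm (A h) = norm (B h)"
  obtains M where "M \<in> operators UNIV UNIV" "\<And>x. norm (M x) \<le> norm x" "\<And>h. M (A h) = B h"
    "\<And>x. M x \<in> closure (range B)" "\<And>x h. inner (M x) (B h) = inner x (A h)"
proof -
  interpret A: bounded_linear A by (rule operators_bounded_linear[OF A])
  interpret B: bounded_linear B by (rule operators_bounded_linear[OF B])
  define S where "S = closure (range (\<lambda>h. (A h, B h)))"
  have S: "closed_csubspace S"
    unfolding S_def
  proof (rule closed_csubspace_closure)
    show "0 \<in> range (\<lambda>h. (A h, B h))"
      by (intro range_eqI[of _ _ 0]) (simp add: A.zero B.zero zero_prod_def)
    show "x + y \<in> range (\<lambda>h. (A h, B h))" if xy: "x \<in> range (\<lambda>h. (A h, B h))" "y \<in> range (\<lambda>h. (A h, B h))" for x y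
    proof -
      obtain h k where "x = (A h, B h)" "y = (A k, B k)" using xy by blast
      then have "x + y = (A (h + k), B (h + k))" by (simp add: A.add B.add)
      then show ?thesis by blast
    qed
    show "c *\<^sub>C x \<in> range (\<lambda>h. (A h, B h))" if x: "x \<in> range (\<lambda>h. (A h, B h))" for c x
    proof -
      obtain h where "x = (A h, B h)" using x by blast
      then have "c *\<^sub>C x = (A (c *\<^sub>C h), B (c *\<^sub>C h))"
        by (simp add: scaleC_Pair operators_scaleC[OF A] operators_scaleC[OF B])
      then show ?thesis by blast
    qed
  qed
  note S' = closed_csubspaceD[OF S]
  have ABS: "(A h, B h) \<in> S" for h unfolding S_def by (rule subsetD[OF closure_subset]) blast
  have Snorm: "norm (fst s) = norm (snd s)" if "s \<in> S" for s
  proof -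
    have "S \<subseteq> {s. norm (fst s) = norm (snd s)}"
      unfolding S_def by (rule closure_minimal) (use eq in \<open>auto intro!: closed_Collect_eq continuous_intros\<close>)
    then show ?thesis using that by blast
  qed
  have Sinner: "inner (fst s) (fst t) = inner (snd s) (snd t)" if "s \<in> S" "t \<in> S" for s t
  proof -
    have "(norm (fst (s + t)))\<^sup>2 = (norm (snd (s + t)))\<^sup>2" using Snorm[OF S'(3)[OF that]] by simp
    moreover have "(norm (fst s))\<^sup>2 = (norm (snd s))\<^sup>2" "(norm (fst t))\<^sup>2 = (norm (snd t))\<^sup>2"
      using Snorm that by simp_all
    ultimately show ?thesis
      by (simp add: power2_norm_eq_inner inner_add_left inner_add_right inner_commute)
  qed
  have "\<forall>x. \<exists>p. p \<in> S \<and> (\<forall>s\<in>S. inner ((2 *\<^sub>R x, 0) - p) s = 0)"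
    using orthogonal_projection_exists[OF S'(1) S'(5)] by blast
  then obtain P where P: "\<And>x. P x \<in> S" "\<And>x s. s \<in> S \<Longrightarrow> inner ((2 *\<^sub>R x, 0) - P x) s = 0" by metis
  \<comment> \<open>Both coordinates of p in S contribute equally to \<open>inner p s\<close>; hence
    the factor 2 in (2x, 0), and hence \<open>P x\<close> is characterised by its first coordinate
    alone. Linearity of P follows from this.\<close>
  have uniq: "P x = p" if "p \<in> S" "\<And>s. s \<in> S \<Longrightarrow> inner (x - fst p) (fst s) = 0" for x p
  proof -
    have "inner (P x - p) s = 0" if "s \<in> S" for s
    proof -
      have "inner ((2 *\<^sub>R x, 0) - p) s = 2 * inner (x - fst p) (fst s)"
        using Sinner[OF \<open>p \<in> S\<close> that] by (simp add: inner_prod_def inner_diff_left)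
      then have "inner ((2 *\<^sub>R x, 0) - p) s = 0" using \<open>s \<in> S \<Longrightarrow> inner (x - fst p) (fst s) = 0\<close> that by simp
      moreover have "inner ((2 *\<^sub>R x, 0) - P x) s = 0" using P that by blast
      ultimately show ?thesis by (simp add: inner_diff_left)
    qed
    then have "inner (P x - p) (P x - p) = 0" using S'(6)[OF P(1) that(1)] by blast
    then show ?thesis by simp
  qed
  have orth: "inner (x - fst (P x)) (fst s) = 0" if "s \<in> S" for x s
    using P(2)[OF that, of x] Sinner[OF P(1) that, of x] by (simp add: inner_prod_def inner_diff_left)
  define M where "M x = snd (P x)" for x
  have contr: "norm (M x) \<le> norm x" for x
  proof -
    have "(norm (fst (P x)))\<^sup>2 = inner x (fst (P x))"
      using orth[OF P(1), of x x] by (simp add: inner_diff_left power2_norm_eq_inner)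
    also have "\<dots> \<le> norm x * norm (fst (P x))" by (rule norm_cauchy_schwarz)
    finally have "norm (fst (P x)) \<le> norm x"
      by (cases "fst (P x) = 0") (auto simp: power2_eq_square)
    then show ?thesis using Snorm[OF P(1), of x] by (simp add: M_def)
  qed
  have add: "P (x + y) = P x + P y" for x y
  proof (rule uniq)
    fix s assume s: "s \<in> S"
    show "inner (x + y - fst (P x + P y)) (fst s) = 0"
      using orth[OF s, of x] orth[OF s, of y] by (simp add: inner_diff_left inner_add_left)
  qed (intro S'(3) P)
  have scale: "P (c *\<^sub>C x) = c *\<^sub>C P x" for c x
  proof (rule uniq)
    fix s assume s: "s \<in> S"
    have "inner (c *\<^sub>C x - fst (c *\<^sub>C P x)) (fst s) = inner (x - fst (P x)) (fst (cnj c *\<^sub>C s))"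
      by (simp add: inner_scaleC_left[symmetric] scaleC.diff_right)
    also have "\<dots> = 0" using S'(4)[OF s] orth by blast
    finally show "inner (c *\<^sub>C x - fst (c *\<^sub>C P x)) (fst s) = 0" .
  qed (intro S'(4) P)
  have Mop: "M \<in> operators UNIV UNIV"
    unfolding operators_UNIV_iff
  proof
    show "bounded_linear M"
      by (rule bounded_linear_intro[where K = 1]) (simp_all add: M_def add scale scaleR_scaleC contr[unfolded M_def])
  qed (simp add: M_def scale)
  have MA: "M (A h) = B h" for h
    using uniq[OF ABS, of "A h" h] by (simp add: M_def)
  show ?thesis
  proof (rule that[OF Mop contr MA])
    fix x
    have "range (\<lambda>h. (A h, B h)) \<subseteq> snd -` closure (range B)" using closure_subset by fastforce
    moreover have "closed (snd -` closure (range B))"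
      by (intro closed_vimage) (auto intro: continuous_intros)
    ultimately have "S \<subseteq> snd -` closure (range B)" unfolding S_def by (rule closure_minimal)
    then show "M x \<in> closure (range B)" using P(1)[of x] by (auto simp: M_def)
  next
    fix x h
    interpret M: bounded_linear M by (rule operators_bounded_linear[OF Mop])
    \<comment> \<open>M keeps the norm of \<open>A h\<close>, so it preserves inner products with
      it; in operator form, M^* B = A.\<close>
    have "inner (M x) (M (A h)) = inner x (A h)"
      by (rule contraction_isometric_vector[OF subspace_UNIV]) (auto simp: M.add M.scaleR contr MA eq)
    then show "inner (M x) (B h) = inner x (A h)" by (simp add: MA)
  qed
qed

subsection \<open>Square roots of non-negative operators\<close>

text \<open>Symmetry is polarisation: the quadratic form is real at x, w and x + w, so the imaginary
  mixed terms cancel, and w = -i y turns this cancellation into the symmetry relation.\<close>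

lemma nonneg_operatorD:
  fixes T :: "'a::chilbert_space \<Rightarrow> 'a"
  assumes "nonneg_operator T"
  shows "T \<in> operators UNIV UNIV" "0 \<le> inner (T x) x" "inner (T x) y = inner x (T y)"
proof -
  show T: "T \<in> operators UNIV UNIV" and "0 \<le> inner (T x) x"
    using assms by (auto simp: nonneg_operator_def inner_eq_Re_cinner)
  interpret T: bounded_linear T by (rule operators_bounded_linear[OF T])
  have im: "inner (T v) (\<i> *\<^sub>C v) = 0" for v
  proof -
    have "cinner (T v) v \<in> \<real>" using assms by (simp add: nonneg_operator_def)
    then show ?thesis by (simp add: complex_is_Real_iff cinner_eq_Complex)
  qed
  define w where "w = (- \<i>) *\<^sub>C y"
  have "inner (T x) (\<i> *\<^sub>C w) + inner (T w) (\<i> *\<^sub>C x) = 0"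
    using im[of "x + w"] im[of x] im[of w]
    by (simp add: T.add inner_add_left inner_add_right scaleC_add_right)
  moreover have "\<i> *\<^sub>C w = y" by (simp add: w_def scaleC_scaleC)
  moreover have "inner (T w) (\<i> *\<^sub>C x) = - inner (T y) x"
    unfolding w_def operators_scaleC[OF T] inner_scaleC_left scaleC_scaleC by (simp add: scaleC.minus_left)
  ultimately show "inner (T x) y = inner x (T y)" by (simp add: inner_commute)
qed

lemma nonneg_operatorI:
  fixes T :: "'a::chilbert_space \<Rightarrow> 'a"
  assumes T: "T \<in> operators UNIV UNIV" and sa: "\<And>x y. inner (T x) y = inner x (T y)"
    and pos: "\<And>x. 0 \<le> inner (T x) x"
  shows "nonneg_operator T"
proof -
  have "cinner (T x) x \<in> \<real>" for x
    using cinner_adjoint[OF T T sa, of x x] cinner_commute[of x "T x"] by (metis Reals_cnj_iff)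
  then show ?thesis using T pos by (simp add: nonneg_operator_def inner_eq_Re_cinner)
qed

text \<open>The form attains its minimum 0 at x; moving in the direction T x, the linear coefficient
  |T x|^2 must vanish.\<close>

lemma nonneg_operator_kernel:
  fixes T :: "'a::chilbert_space \<Rightarrow> 'a"
  assumes T: "nonneg_operator T" and x: "inner (T x) x = 0"
  shows "T x = 0"
proof -
  note T' = nonneg_operatorD[OF T]
  interpret T: bounded_linear T by (rule operators_bounded_linear[OF T'(1)])
  have "inner (T x) (T x) = 0"
  proof (rule linear_coeff_zero)
    fix t :: real
    have "0 \<le> inner (T (x + t *\<^sub>R T x)) (x + t *\<^sub>R T x)" by (rule T')
    then show "0 \<le> 2 * t * inner (T x) (T x) + t\<^sup>2 * inner (T (T x)) (T x)"
      using T'(3)[of "T x" x]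
      by (simp add: T.add T.scaleR inner_add_left inner_add_right x power2_eq_square algebra_simps)
  qed (rule T')
  then show ?thesis by simp
qed

text \<open>
  With \<open>A = I - T\<close> the iteration \<open>X \<mapsto> (A + X\<^sup>2) / 2\<close> converges to \<open>I - T\<^sup>1\<^sup>/\<^sup>2\<close>. Its increments are
  dominated in norm by those of the increasing scalar iteration \<open>s \<mapsto> (1 + s\<^sup>2) / 2\<close>, so no monotone
  convergence theorem for operators is required.
\<close>

lemma sqrt_exists_contraction:
  fixes T :: "'a::chilbert_space \<Rightarrow> 'a"
  assumes T: "nonneg_operator T" and contr: "\<And>x. norm (T x) \<le> norm x"
  obtains R where "nonneg_operator R" "\<And>x. R (R x) = T x"
    "\<forall>S\<in>operators UNIV UNIV. (\<forall>x. S (T x) = T (S x)) \<longrightarrow> (\<forall>x. S (R x) = R (S x))"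
proof -
  note T' = nonneg_operatorD[OF T]
  interpret T: bounded_linear T by (rule operators_bounded_linear[OF T'(1)])
  define A where "A x = x - T x" for x
  have A: "A \<in> operators UNIV UNIV"
    unfolding A_def using operators_diff[OF operators_simple(1) T'(1)] .
  have Asa: "inner (A x) y = inner x (A y)" for x y
    by (simp add: A_def inner_diff_left inner_diff_right T'(3))
  have An: "norm (A x) \<le> norm x" for x
  proof -
    \<comment> \<open>Positivity at x - T x together with |T| \<le> 1 gives |T x|^2 \<le> <T x, x>,
      that is T^2 \<le> T, and this makes I - T a contraction.\<close>
    have "0 \<le> inner (T (x - T x)) (x - T x)" by (rule T')
    also have "\<dots> = inner (T x) x - 2 * inner (T x) (T x) + inner (T (T x)) (T x)"
      using T'(3)[of "T x" x] by (simp add: T.diff inner_diff_left inner_diff_right)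
    also have "inner (T (T x)) (T x) \<le> norm (T x) * norm (T x)"
      by (rule order_trans[OF norm_cauchy_schwarz mult_right_mono[OF contr]]) simp
    finally have "inner (T x) (T x) \<le> inner (T x) x"
      by (simp add: power2_norm_eq_inner[symmetric] power2_eq_square)
    then have "(norm (A x))\<^sup>2 \<le> (norm x)\<^sup>2"
      using T'(2)[of x] by (simp add: A_def power2_norm_eq_inner inner_diff_left inner_diff_right inner_commute)
    then show ?thesis by (simp add: power2_le_iff_abs_le)
  qed
  define s :: "nat \<Rightarrow> real" where "s n = ((\<lambda>s. (1 + s\<^sup>2) / 2) ^^ n) 0" for n
  define X :: "nat \<Rightarrow> 'a \<Rightarrow> 'a" where "X n = ((\<lambda>X x. (1/2) *\<^sub>R (A x + X (X x))) ^^ n) (\<lambda>_. 0)" for n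
  have s0: "s 0 = 0" and sS: "s (Suc n) = (1 + (s n)\<^sup>2) / 2" for n by (simp_all add: s_def)
  have X0: "X 0 = (\<lambda>_. 0)" and XS: "X (Suc n) x = (1/2) *\<^sub>R (A x + X n (X n x))" for n x
    by (simp_all add: X_def)
  have s01: "0 \<le> s n \<and> s n \<le> 1" for n
  proof (induction n)
    case (Suc n)
    then have "(s n)\<^sup>2 \<le> 1\<^sup>2" by (intro power_mono) auto
    then show ?case by (simp add: sS)
  qed (simp add: s0)
  have sinc: "s n \<le> s (Suc n)" for n
    using zero_le_power2[of "1 - s n"] by (simp add: sS power2_diff field_simps)
  have Xop: "X n \<in> operators UNIV UNIV" for n
  proof (induction n)
    case (Suc n)
    have "(\<lambda>x. (1/2) *\<^sub>R x) \<in> operators UNIV (UNIV::'a set)"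
      by (simp add: operators_UNIV_iff bounded_linear_scaleR_right scaleC.scaleR_right)
    from operators_compose[OF this operators_add[OF A operators_compose[OF Suc Suc]]]
    show ?case by (simp add: XS[abs_def])
  qed (simp add: X0 operators_UNIV_iff)
  have Xlin: "bounded_linear (X n)" for n by (rule operators_bounded_linear[OF Xop])
  have Xdiff: "X n (x - y) = X n x - X n y" for n x y
    using Xlin by (simp add: bounded_linear.linear linear_diff)
  have Xn: "norm (X n x) \<le> s n * norm x" for n x
  proof (induction n arbitrary: x)
    case (Suc n)
    have "norm (X n (X n x)) \<le> s n * (s n * norm x)"
      by (rule order_trans[OF Suc mult_left_mono[OF Suc]]) (use s01 in auto)
    then have "norm (A x + X n (X n x)) \<le> norm x + s n * (s n * norm x)"
      using An[of x] norm_triangle_ineq[of "A x" "X n (X n x)"] by linarith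
    then have "(1/2) * norm (A x + X n (X n x)) \<le> (1/2) * (norm x + s n * (s n * norm x))" by simp
    then show ?case unfolding XS sS norm_scaleR by (simp add: power2_eq_square algebra_simps)
  qed (simp add: X0 s0)
  have Xsa: "inner (X n x) y = inner x (X n y)" for n x y
    by (induction n arbitrary: x y) (simp_all add: X0 XS inner_add_left inner_add_right Asa)
  have Xstep: "norm (X (Suc n) x - X n x) \<le> (s (Suc n) - s n) * norm x" for n x
  proof (induction n arbitrary: x)
    case 0
    show ?case using An[of x] by (simp add: X0 XS s0 sS)
  next
    case (Suc n)
    let ?Y = "X (Suc n)" and ?t = "s (Suc n)"
    \<comment> \<open>The splitting Y^2 - X^2 = Y (Y - X) + (Y - X) X mirrors t^2 - s^2 = t (t - s)
      + (t - s) s, so the operator increments inherit the scalar bound.\<close>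
    have "?Y (?Y x) - X n (X n x) = ?Y (?Y x - X n x) + (?Y (X n x) - X n (X n x))"
      by (simp add: Xdiff)
    moreover have "norm (?Y (?Y x - X n x)) \<le> ?t * ((?t - s n) * norm x)"
      by (rule order_trans[OF Xn mult_left_mono[OF Suc]]) (use s01 in auto)
    moreover have "norm (?Y (X n x) - X n (X n x)) \<le> (?t - s n) * (s n * norm x)"
      by (rule order_trans[OF Suc mult_left_mono[OF Xn]]) (use sinc[of n] in auto)
    ultimately have "norm (?Y (?Y x) - X n (X n x)) \<le> ?t * ((?t - s n) * norm x) + (?t - s n) * (s n * norm x)"
      by (metis add_mono norm_triangle_le)
    moreover have "X (Suc (Suc n)) x - ?Y x = (1/2) *\<^sub>R (?Y (?Y x) - X n (X n x))"
      unfolding XS[of "Suc n"] XS[of n x] by (simp add: algebra_simps)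
    then have "norm (X (Suc (Suc n)) x - ?Y x) = (1/2) * norm (?Y (?Y x) - X n (X n x))" by simp
    ultimately have "norm (?Y (?Y x) - X n (X n x)) \<le> (?t\<^sup>2 - (s n)\<^sup>2) * norm x"
      and "norm (X (Suc (Suc n)) x - ?Y x) = (1/2) * norm (?Y (?Y x) - X n (X n x))"
      by (simp_all add: power2_eq_square algebra_simps)
    then have "norm (X (Suc (Suc n)) x - ?Y x) \<le> (1/2) * ((?t\<^sup>2 - (s n)\<^sup>2) * norm x)" by simp
    also have "(1/2) * ((?t\<^sup>2 - (s n)\<^sup>2) * norm x) = (s (Suc (Suc n)) - ?t) * norm x"
      unfolding sS[of "Suc n"] using sS[of n] by (simp add: field_simps)
    finally show ?case .
  qed
  have Xdist: "norm (X m x - X n x) \<le> (s m - s n) * norm x" if "n \<le> m" for m n x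
    using that
  proof (induction m rule: dec_induct)
    case (step m)
    have "norm (X (Suc m) x - X n x) \<le> norm (X (Suc m) x - X m x) + norm (X m x - X n x)"
      using norm_triangle_ineq[of "X (Suc m) x - X m x" "X m x - X n x"] by simp
    then show ?case using Xstep[of m x] step.IH by (simp add: algebra_simps)
  qed simp
  have "convergent s"
    by (rule Bseq_monoseq_convergent) (use s01 sinc in \<open>auto intro!: BseqI'[of _ 1] incseq_imp_monoseq incseq_SucI\<close>)
  then have Cs: "Cauchy s" by (rule convergent_Cauchy)
  have "convergent (\<lambda>n. X n x)" for x
  proof -
    have "Cauchy (\<lambda>n. X n x)"
    proof (rule metric_CauchyI)
      fix e :: real assume e: "0 < e"
      then have "0 < e / (norm x + 1)" by (simp add: add_nonneg_pos)
      then obtain N where N: "\<And>m n. N \<le> m \<Longrightarrow> N \<le> n \<Longrightarrow> dist (s m) (s n) < e / (norm x + 1)"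
        using metric_CauchyD[OF Cs] by blast
      have le: "dist (X m x) (X n x) < e" if "n \<le> m" "N \<le> n" for m n
      proof -
        have "s m - s n < e / (norm x + 1)" using N[of m n] that by (simp add: dist_real_def)
        then have "(s m - s n) * (norm x + 1) < e" by (simp add: pos_less_divide_eq add_nonneg_pos)
        moreover have "s n \<le> s m" using lift_Suc_mono_le[of s n m] sinc that by blast
        then have "(s m - s n) * norm x \<le> (s m - s n) * (norm x + 1)" by (intro mult_left_mono) auto
        ultimately show ?thesis using Xdist[OF that(1), of x] by (simp add: dist_norm)
      qed
      show "\<exists>N. \<forall>m\<ge>N. \<forall>n\<ge>N. dist (X m x) (X n x) < e"
        by (rule exI[of _ N]) (metis le dist_commute nat_le_linear)
    qed
    then show ?thesis by (rule Cauchy_convergent)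
  qed
  then obtain Y where Y: "\<And>x. (\<lambda>n. X n x) \<longlonglongrightarrow> Y x"
    unfolding convergent_def by metis
  have Yn: "norm (Y x) \<le> norm x" for x
  proof (rule LIMSEQ_le_const2[OF tendsto_norm[OF Y]])
    have "norm (X n x) \<le> norm x" for n
      using Xn[of n x] mult_right_mono[of "s n" 1 "norm x"] s01[of n] by simp
    then show "\<exists>N. \<forall>n\<ge>N. norm (X n x) \<le> norm x" by blast
  qed
  have Yadd: "Y (x + y) = Y x + Y y" for x y
    by (rule LIMSEQ_unique[OF Y]) (use tendsto_add[OF Y Y] Xlin in \<open>simp add: bounded_linear.linear linear_add\<close>)
  have YC: "Y (c *\<^sub>C x) = c *\<^sub>C Y x" for c x
    by (rule LIMSEQ_unique[OF Y]) (use scaleC.tendsto[OF tendsto_const Y] in \<open>simp add: operators_scaleC[OF Xop]\<close>)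
  have Yop: "Y \<in> operators UNIV UNIV"
    unfolding operators_UNIV_iff
    by (auto simp: Yadd YC Yn scaleR_scaleC intro!: bounded_linear_intro[where K = 1])
  have Ysa: "inner (Y x) y = inner x (Y y)" for x y
    by (rule LIMSEQ_unique[OF tendsto_inner[OF Y tendsto_const]])
      (use tendsto_inner[OF tendsto_const Y] in \<open>simp add: Xsa\<close>)
  have "(\<lambda>n. X n (X n x)) \<longlonglongrightarrow> Y (Y x)" for x
  proof -
    have "(\<lambda>n. X n (X n x - Y x)) \<longlonglongrightarrow> 0"
    proof (rule Lim_null_comparison)
      show "\<forall>\<^sub>F n in sequentially. norm (X n (X n x - Y x)) \<le> norm (X n x - Y x)"
      proof (rule always_eventually, rule allI)
        fix n
        show "norm (X n (X n x - Y x)) \<le> norm (X n x - Y x)"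
          using Xn[of n "X n x - Y x"] mult_right_mono[of "s n" 1 "norm (X n x - Y x)"] s01[of n] by simp
      qed
      show "(\<lambda>n. norm (X n x - Y x)) \<longlonglongrightarrow> 0"
        using tendsto_norm[OF tendsto_diff[OF Y[of x] tendsto_const[of "Y x"]]] by simp
    qed
    from tendsto_add[OF this Y[of "Y x"]] show ?thesis by (simp add: Xdiff)
  qed
  then have "(\<lambda>n. X (Suc n) x) \<longlonglongrightarrow> (1/2) *\<^sub>R (A x + Y (Y x))" for x
    unfolding XS by (intro tendsto_intros)
  then have Yeq: "Y x = (1/2) *\<^sub>R (A x + Y (Y x))" for x
    using LIMSEQ_unique[OF LIMSEQ_Suc[OF Y]] by blast
  interpret Y: bounded_linear Y by (rule operators_bounded_linear[OF Yop])
  define R where "R x = x - Y x" for x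
  have "R (R x) = T x" for x
  proof -
    have "2 *\<^sub>R Y x = A x + Y (Y x)" by (subst Yeq) simp
    then show ?thesis by (simp add: R_def Y.diff A_def scaleR_2 algebra_simps)
  qed
  moreover have "nonneg_operator R"
  proof (rule nonneg_operatorI)
    show "R \<in> operators UNIV UNIV"
      unfolding R_def using operators_diff[OF operators_simple(1) Yop] .
    show "inner (R x) y = inner x (R y)" for x y
      by (simp add: R_def inner_diff_left inner_diff_right Ysa)
    show "0 \<le> inner (R x) x" for x
    proof -
      have "inner (Y x) x \<le> norm x * norm x"
        by (rule order_trans[OF norm_cauchy_schwarz mult_right_mono[OF Yn]]) simp
      then show ?thesis by (simp add: R_def inner_diff_left power2_norm_eq_inner[symmetric] power2_eq_square)
    qed
  qed
  moreover have "S (R x) = R (S x)" if S: "S \<in> operators UNIV UNIV" and ST: "\<forall>x. S (T x) = T (S x)" for S x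
  proof -
    interpret S: bounded_linear S by (rule operators_bounded_linear[OF S])
    have SX: "S (X n x) = X n (S x)" for n x
      by (induction n arbitrary: x) (simp_all add: X0 XS S.zero S.scaleR S.add S.diff A_def ST)
    have "S (Y x) = Y (S x)"
      by (rule LIMSEQ_unique[OF S.tendsto[OF Y]]) (simp add: SX Y)
    then show ?thesis by (simp add: R_def S.diff)
  qed
  ultimately show ?thesis using that by blast
qed

text \<open>Dividing by a norm bound K reduces to the contractive case. The commutation clause
  serves uniqueness: any other root commutes with T, hence with this root.\<close>

lemma sqrt_exists:
  fixes T :: "'a::chilbert_space \<Rightarrow> 'a"
  assumes T: "nonneg_operator T"
  obtains R where "nonneg_operator R" "\<And>x. R (R x) = T x"
    "\<forall>S\<in>operators UNIV UNIV. (\<forall>x. S (T x) = T (S x)) \<longrightarrow> (\<forall>x. S (R x) = R (S x))"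
proof -
  note T' = nonneg_operatorD[OF T]
  interpret T: bounded_linear T by (rule operators_bounded_linear[OF T'(1)])
  obtain K where K: "K > 0" "\<And>x. norm (T x) \<le> norm x * K" using T.pos_bounded by blast
  define T1 where "T1 x = (1 / K) *\<^sub>R T x" for x
  have sc: "(\<lambda>x. r *\<^sub>R x) \<in> operators UNIV (UNIV::'a set)" for r
    by (simp add: operators_UNIV_iff bounded_linear_scaleR_right scaleC.scaleR_right)
  have "nonneg_operator T1"
  proof (rule nonneg_operatorI)
    show "T1 \<in> operators UNIV UNIV" unfolding T1_def by (rule operators_compose[OF sc T'(1)])
    show "inner (T1 x) y = inner x (T1 y)" for x y by (simp add: T1_def T'(3))
    show "0 \<le> inner (T1 x) x" for x using T'(2)[of x] K(1) by (simp add: T1_def)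
  qed
  moreover have "norm (T1 x) \<le> norm x" for x using K(2)[of x] K(1) by (simp add: T1_def divide_simps)
  ultimately obtain R where R: "nonneg_operator R" "\<And>x. R (R x) = T1 x"
    "\<forall>S\<in>operators UNIV UNIV. (\<forall>x. S (T1 x) = T1 (S x)) \<longrightarrow> (\<forall>x. S (R x) = R (S x))"
    using sqrt_exists_contraction[of T1] by blast
  note R' = nonneg_operatorD[OF R(1)]
  interpret R: bounded_linear R by (rule operators_bounded_linear[OF R'(1)])
  show ?thesis
  proof (rule that[of "\<lambda>x. sqrt K *\<^sub>R R x"])
    show "nonneg_operator (\<lambda>x. sqrt K *\<^sub>R R x)"
      using R'(2,3) K(1) by (intro nonneg_operatorI operators_compose[OF sc R'(1)]) auto
    show "sqrt K *\<^sub>R R (sqrt K *\<^sub>R R x) = T x" for x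
      using K(1) by (simp add: R.scaleR R(2) T1_def)
  next
    show "\<forall>S\<in>operators UNIV UNIV. (\<forall>x. S (T x) = T (S x)) \<longrightarrow>
        (\<forall>x. S (sqrt K *\<^sub>R R x) = sqrt K *\<^sub>R R (S x))"
    proof (intro ballI impI allI)
      fix S x assume S: "S \<in> operators UNIV UNIV" and ST: "\<forall>x. S (T x) = T (S x)"
      interpret S: bounded_linear S by (rule operators_bounded_linear[OF S])
      show "S (sqrt K *\<^sub>R R x) = sqrt K *\<^sub>R R (S x)"
        using R(3)[rule_format, OF S] by (simp add: S.scaleR T1_def ST)
    qed
  qed
qed

text \<open>With d = (R - P) x commutation gives (R + P) d = 0. Positivity splits this into R d = 0
  and P d = 0, and then |d|^2 = <(R - P) d, x> = 0.\<close>

lemma sqrt_unique: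
  fixes R P :: "'a::chilbert_space \<Rightarrow> 'a"
  assumes R: "nonneg_operator R" and P: "nonneg_operator P" and eq: "\<And>x. R (R x) = P (P x)"
    and comm: "\<And>x. P (R x) = R (P x)"
  shows "R = P"
proof
  fix x
  note R' = nonneg_operatorD[OF R] and P' = nonneg_operatorD[OF P]
  interpret R: bounded_linear R by (rule operators_bounded_linear[OF R'(1)])
  interpret P: bounded_linear P by (rule operators_bounded_linear[OF P'(1)])
  define d where "d = R x - P x"
  have "R d + P d = 0" by (simp add: d_def R.diff P.diff eq comm)
  then have "inner (R d) d + inner (P d) d = 0" by (simp add: inner_add_left[symmetric])
  then have "inner (R d) d = 0" "inner (P d) d = 0" using R'(2)[of d] P'(2)[of d] by linarith+
  then have "R d = 0" "P d = 0" using nonneg_operator_kernel R P by blast+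
  then have "inner d d = 0" by (subst (2) d_def) (simp add: inner_diff_right R'(3)[symmetric] P'(3)[symmetric])
  then show "R x = P x" by (simp add: d_def)
qed

lemma op_sqrt:
  fixes T :: "'a::chilbert_space \<Rightarrow> 'a"
  assumes T: "nonneg_operator T"
  shows "nonneg_operator (op_sqrt T)" "op_sqrt T (op_sqrt T x) = T x"
proof -
  obtain R where R: "nonneg_operator R" "\<And>x. R (R x) = T x"
    "\<forall>S\<in>operators UNIV UNIV. (\<forall>x. S (T x) = T (S x)) \<longrightarrow> (\<forall>x. S (R x) = R (S x))"
    by (rule sqrt_exists[OF T]) (rule that; assumption)
  have "op_sqrt T = R"
    unfolding op_sqrt_def
  proof (rule the_equality)
    show "nonneg_operator R \<and> R \<circ> R = T" using R by auto
  next
    fix P assume P: "nonneg_operator P \<and> P \<circ> P = T"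
    then have PP: "P (P x) = T x" for x by (auto simp: fun_eq_iff)
    have "P (R x) = R (P x)" for x
    proof (rule R(3)[rule_format])
      show "P \<in> operators UNIV UNIV" using P by (simp add: nonneg_operator_def)
      show "P (T x) = T (P x)" for x by (simp add: PP[symmetric])
    qed
    then have "R = P" by (intro sqrt_unique) (use R P PP in auto)
    then show "P = R" ..
  qed
  then show "nonneg_operator (op_sqrt T)" "op_sqrt T (op_sqrt T x) = T x" using R by simp_all
qed

section \<open>Square summable sequences\<close>

lemma Rep_ell2_operator: "(\<lambda>x::'a::complex_inner ell2. Rep_ell2 x n) \<in> operators UNIV UNIV"
  unfolding operators_UNIV_iff
  by (auto intro!: bounded_linear_intro[where K = 1] simp: plus_ell2.rep_eq scaleR_ell2.rep_eq
      scaleC_ell2.rep_eq norm_Rep_ell2_le)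

lemma ell2_eqI: "(\<And>n. Rep_ell2 x n = Rep_ell2 y n) \<Longrightarrow> x = y"
  by (metis Rep_ell2_inject ext)

lemma inner_ell2_sums:
  "(\<lambda>n. inner (Rep_ell2 x n) (Rep_ell2 y n)) sums inner x (y::'a::real_inner ell2)"
  unfolding inner_ell2.rep_eq
  by (rule summable_sums[OF ell2_summable_inner]) (use Rep_ell2 in auto)

lemma ell2_bounded_sums:
  fixes f :: "nat \<Rightarrow> 'a::real_inner"
  assumes "\<And>N. (\<Sum>n\<le>N. (norm (f n))\<^sup>2) \<le> c"
  shows "Rep_ell2 (Abs_ell2 f) = f" "(norm (Abs_ell2 f))\<^sup>2 \<le> c"
proof -
  have *: "(\<Sum>n<N. (norm (f n))\<^sup>2) \<le> c" for N
    by (rule order_trans[OF sum_mono2 assms[of N]]) auto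
  have s: "summable (\<lambda>n. (norm (f n))\<^sup>2)"
    by (rule summableI_nonneg_bounded[OF _ *]) simp
  then show r: "Rep_ell2 (Abs_ell2 f) = f" by (simp add: Abs_ell2_inverse)
  show "(norm (Abs_ell2 f))\<^sup>2 \<le> c"
    unfolding power2_norm_ell2 r by (rule suminf_le_const[OF s *])
qed

lemma Rep_embed0: "Rep_ell2 (embed0 v) n = (if n = 0 then v else 0)"
  by (simp add: embed0.rep_eq)

lemma Rep_shift: "Rep_ell2 (shift x) n = (case n of 0 \<Rightarrow> 0 | Suc m \<Rightarrow> Rep_ell2 x m)"
  by (simp add: shift.rep_eq)

text \<open>The adjoint of \<open>shift\<close>, as \<open>inner_shift\<close> shows.\<close>

lift_definition bshift :: "'a :: real_normed_vector ell2 \<Rightarrow> 'a ell2" is "\<lambda>f n. f (Suc n)"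
  by (subst summable_Suc_iff)

lemma inner_embed0: "inner (embed0 v) y = inner v (Rep_ell2 y 0)"
  using sums_unique2[OF inner_ell2_sums[of "embed0 v" y]] sums_finite[of "{0}" "\<lambda>n. inner (Rep_ell2 (embed0 v) n) (Rep_ell2 y n)"]
  by (simp add: Rep_embed0)

lemma inner_shift: "inner (shift x) y = inner x (bshift y)"
proof -
  have "(\<lambda>n. inner (Rep_ell2 (shift x) (Suc n)) (Rep_ell2 y (Suc n))) sums inner (shift x) y"
    using inner_ell2_sums[of "shift x" y] by (subst sums_Suc_iff) (simp add: Rep_shift)
  then show ?thesis
    using sums_unique2[OF inner_ell2_sums[of x "bshift y"]] by (simp add: Rep_shift bshift.rep_eq)
qed

lemma bshift_shift: "bshift (shift x) = x"
  by (rule ell2_eqI) (simp add: bshift.rep_eq Rep_shift)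

lemma embed0_shift_decomp: "embed0 (Rep_ell2 x 0) + shift (bshift x) = x"
  by (rule ell2_eqI) (simp add: plus_ell2.rep_eq Rep_embed0 Rep_shift bshift.rep_eq split: nat.split)

lemma norm_shift: "norm (shift x) = norm (x::'a::real_inner ell2)"
  by (simp add: norm_eq_sqrt_inner inner_shift bshift_shift)

lemma norm_embed0: "norm (embed0 v) = norm (v::'a::real_inner)"
  by (simp add: norm_eq_sqrt_inner inner_embed0 Rep_embed0)

lemma norm_bshift: "(norm (x::'a::real_inner ell2))\<^sup>2 = (norm (Rep_ell2 x 0))\<^sup>2 + (norm (bshift x))\<^sup>2"
proof -
  have "inner x x = inner (embed0 (Rep_ell2 x 0) + shift (bshift x)) x"
    by (simp add: embed0_shift_decomp)
  then show ?thesis by (simp add: power2_norm_eq_inner inner_add_left inner_embed0 inner_shift)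
qed

lemma embed0_operator: "embed0 \<in> operators UNIV (UNIV::'a::complex_inner ell2 set)"
  unfolding operators_UNIV_iff
  by (auto intro!: bounded_linear_intro[where K = 1] ell2_eqI simp: norm_embed0 Rep_embed0
      plus_ell2.rep_eq scaleR_ell2.rep_eq scaleC_ell2.rep_eq)

lemma bshift_operator: "bshift \<in> operators UNIV (UNIV::'a::complex_inner ell2 set)"
proof -
  have "norm (bshift x) \<le> norm x" for x :: "'a ell2"
    using norm_bshift[of x] by (simp add: power2_le_imp_le)
  then show ?thesis
    unfolding operators_UNIV_iff
    by (auto intro!: bounded_linear_intro[where K = 1] ell2_eqI simp: bshift.rep_eq
        plus_ell2.rep_eq scaleR_ell2.rep_eq scaleC_ell2.rep_eq)
qed

instance chilbert_space \<subseteq> banach ..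

section \<open>Power series with operator coefficients\<close>

text \<open>Zeros of a nontrivial power series are isolated. The constant term is read off at 0
  because the isolation theorem concerns a nonzero coefficient of positive index.\<close>

lemma scalar_power_series_zero:
  fixes a :: "nat \<Rightarrow> complex"
  assumes "\<And>\<zeta>. \<zeta> \<in> ball 0 1 \<Longrightarrow> (\<lambda>n. a n * \<zeta> ^ n) sums 0"
  shows "a n = 0"
proof (cases "n = 0")
  case True
  then show ?thesis using assms[of 0] by simp
next
  case False
  show ?thesis
  proof (rule ccontr)
    assume "a n \<noteq> 0"
    obtain s :: real where s: "0 < s" "\<And>z. z \<in> cball 0 s - {0} \<Longrightarrow> (\<lambda>_::complex. 0::complex) z \<noteq> 0"
      by (rule powser_0_nonzero[where r = 1 and a = a and \<xi> = 0 and f = "\<lambda>_. 0" and m = n])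
        (use assms False \<open>a n \<noteq> 0\<close> in auto)
    then show False using s(2)[of "of_real s"] by auto
  qed
qed

lemma power_series_unique:
  fixes a b :: "nat \<Rightarrow> 'a::complex_inner"
  assumes "\<And>\<zeta>. \<zeta> \<in> ball 0 1 \<Longrightarrow> (\<lambda>n. \<zeta> ^ n *\<^sub>C a n) sums f \<zeta>"
    and "\<And>\<zeta>. \<zeta> \<in> ball 0 1 \<Longrightarrow> (\<lambda>n. \<zeta> ^ n *\<^sub>C b n) sums f \<zeta>"
  shows "a n = b n"
proof -
  have "cinner (a n - b n) y = 0" for y
  proof (rule scalar_power_series_zero[of "\<lambda>n. cinner (a n - b n) y"])
    fix \<zeta> :: complex assume z: "\<zeta> \<in> ball 0 1"
    then have "(\<lambda>n. \<zeta> ^ n *\<^sub>C (a n - b n)) sums 0"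
      using sums_diff[OF assms(1)[OF z] assms(2)[OF z]] by (simp add: scaleC.diff_right)
    from bounded_linear.sums[OF bounded_linear_cinner_left this, of y]
    show "(\<lambda>n. cinner (a n - b n) y * \<zeta> ^ n) sums 0"
      by (simp add: cinner_scaleC_left mult.commute)
  qed
  then have "a n - b n = 0" by (rule cinner_eq_zeroI)
  then show ?thesis by simp
qed

section \<open>Coefficient sequences of contractive lower triangular Toeplitz operators\<close>

definition conv :: "(nat \<Rightarrow> 'a \<Rightarrow> 'b::comm_monoid_add) \<Rightarrow> (nat \<Rightarrow> 'a) \<Rightarrow> nat \<Rightarrow> 'b" where
  "conv C w n = (\<Sum>k\<le>n. C (n - k) (w k))"

definition schur_coeffs :: "'a::complex_inner set \<Rightarrow> 'b::complex_inner set \<Rightarrow> (nat \<Rightarrow> 'a \<Rightarrow> 'b) set" where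
  "schur_coeffs H K = {C. (\<forall>n. C n \<in> operators H K) \<and>
     (\<forall>w N. range w \<subseteq> H \<longrightarrow> (\<Sum>n\<le>N. (norm (conv C w n))\<^sup>2) \<le> (\<Sum>n\<le>N. (norm (w n))\<^sup>2))}"

definition power_series_fun :: "'a set \<Rightarrow> (nat \<Rightarrow> 'a \<Rightarrow> 'b::complex_inner) \<Rightarrow> complex \<Rightarrow> 'a \<Rightarrow> 'b" where
  "power_series_fun H C = (\<lambda>\<zeta>\<in>ball 0 1. \<lambda>x\<in>H. \<Sum>n. \<zeta> ^ n *\<^sub>C C n x)"

text \<open>Contractive coefficients already give convergence and operator values on the disc.
  Contractivity of the function or of the Toeplitz operator is left open, so both directions of the
  equivalence can start here.\<close>

locale bounded_coeffs =
  fixes H :: "'a::chilbert_space set" and K :: "'b::chilbert_space set" and C :: "nat \<Rightarrow> 'a \<Rightarrow> 'b"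
  assumes H: "closed_csubspace H" and K: "closed_csubspace K"
    and C: "\<And>n. C n \<in> operators H K"
    and C_le: "\<And>n x. x \<in> H \<Longrightarrow> norm (C n x) \<le> norm x"
begin

abbreviation "F \<equiv> power_series_fun H C"

lemma C_lin:
  "x \<in> H \<Longrightarrow> C n x \<in> K" "x \<in> H \<Longrightarrow> y \<in> H \<Longrightarrow> C n (x + y) = C n x + C n y"
  "x \<in> H \<Longrightarrow> C n (c *\<^sub>C x) = c *\<^sub>C C n x" "C n 0 = 0" "x \<in> H \<Longrightarrow> y \<in> H \<Longrightarrow> C n (x - y) = C n x - C n y"
  "(\<And>i. i \<in> I \<Longrightarrow> f i \<in> H) \<Longrightarrow> C n (sum f I) = (\<Sum>i\<in>I. C n (f i))"
  using operatorsD[OF C H] by blast+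

lemma summable_norm:
  assumes "\<zeta> \<in> ball 0 1" "x \<in> H"
  shows "summable (\<lambda>n. norm (\<zeta> ^ n *\<^sub>C C n x))"
proof (rule summable_comparison_test')
  show "summable (\<lambda>n. norm \<zeta> ^ n * norm x)"
    using assms by (intro summable_mult2 summable_geometric) simp
  show "norm (norm (\<zeta> ^ n *\<^sub>C C n x)) \<le> norm \<zeta> ^ n * norm x" for n
    using C_le[OF assms(2), of n] by (simp add: norm_scaleC norm_power mult_left_mono)
qed

lemma F_sums:
  assumes "\<zeta> \<in> ball 0 1" "x \<in> H"
  shows "(\<lambda>n. \<zeta> ^ n *\<^sub>C C n x) sums F \<zeta> x"
  using summable_sums[OF summable_norm_cancel[OF summable_norm[OF assms]]] assms
  by (simp add: power_series_fun_def)

lemma F_tail: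
  assumes "\<zeta> \<in> ball 0 1" "x \<in> H"
  shows "norm (F \<zeta> x - (\<Sum>j<m. \<zeta> ^ j *\<^sub>C C j x)) \<le> norm \<zeta> ^ m / (1 - norm \<zeta>) * norm x"
proof -
  have "(\<lambda>n. \<zeta> ^ (n + m) *\<^sub>C C (n + m) x) sums (F \<zeta> x - (\<Sum>j<m. \<zeta> ^ j *\<^sub>C C j x))"
    by (rule sums_split_initial_segment[OF F_sums[OF assms]])
  moreover have "(\<lambda>n. norm \<zeta> ^ n * (norm \<zeta> ^ m * norm x)) sums (1 / (1 - norm \<zeta>) * (norm \<zeta> ^ m * norm x))"
    using assms by (intro sums_mult2 geometric_sums) simp
  ultimately have "norm (F \<zeta> x - (\<Sum>j<m. \<zeta> ^ j *\<^sub>C C j x)) \<le> 1 / (1 - norm \<zeta>) * (norm \<zeta> ^ m * norm x)"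
  proof (rule norm_sums_le)
    show "norm (\<zeta> ^ (n + m) *\<^sub>C C (n + m) x) \<le> norm \<zeta> ^ n * (norm \<zeta> ^ m * norm x)" for n
      using C_le[OF assms(2), of "n + m"]
      by (simp add: norm_scaleC norm_power norm_mult power_add mult.assoc mult_left_mono)
  qed
  then show ?thesis by simp
qed

lemma F_bound:
  assumes "\<zeta> \<in> ball 0 1" "x \<in> H"
  shows "norm (F \<zeta> x) \<le> 1 / (1 - norm \<zeta>) * norm x"
  using F_tail[OF assms, of 0] by simp

lemma F_operator:
  assumes z: "\<zeta> \<in> ball 0 1"
  shows "F \<zeta> \<in> operators H K"
proof -
  have "F \<zeta> x \<in> K" if x: "x \<in> H" for x
  proof (rule closed_sequentially[OF closed_csubspaceD(1)[OF K]])
    show "(\<Sum>j<m. \<zeta> ^ j *\<^sub>C C j x) \<in> K" for m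
      by (intro subspace_sum closed_csubspaceD[OF K] C_lin x)
    show "(\<lambda>m. \<Sum>j<m. \<zeta> ^ j *\<^sub>C C j x) \<longlonglongrightarrow> F \<zeta> x"
      using F_sums[OF z x] by (simp add: sums_def)
  qed
  moreover have "F \<zeta> (x + y) = F \<zeta> x + F \<zeta> y" if "x \<in> H" "y \<in> H" for x y
    by (rule sums_unique2[OF F_sums[OF z closed_csubspaceD(3)[OF H that]]])
      (use sums_add[OF F_sums[OF z that(1)] F_sums[OF z that(2)]] in \<open>simp add: C_lin that scaleC_add_right\<close>)
  moreover have "F \<zeta> (c *\<^sub>C x) = c *\<^sub>C F \<zeta> x" if "x \<in> H" for c x
    by (rule sums_unique2[OF F_sums[OF z closed_csubspaceD(4)[OF H that]]])
      (use bounded_linear.sums[OF scaleC.bounded_linear_right F_sums[OF z that], of c] in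
        \<open>simp add: C_lin that scaleC_scaleC mult.commute\<close>)
  moreover have "F \<zeta> \<in> extensional H" using z by (simp add: power_series_fun_def)
  ultimately show ?thesis
    using F_bound[OF z] unfolding operators_def PiE_def by blast
qed

text \<open>A Cauchy product: convolution of coefficients is multiplication of generating functions.
  The n-th partial sum differs from F(\<zeta>) applied to the n-th partial sum of p by n tails, each
  of size |\<zeta>|^n B / (1 - |\<zeta>|), and n |\<zeta>|^n tends to 0.\<close>

lemma F_conv_sums:
  assumes z: "\<zeta> \<in> ball 0 1" and w: "\<And>k. w k \<in> H" and B: "\<And>k. norm (w k) \<le> B"
    and p: "(\<lambda>k. \<zeta> ^ k *\<^sub>C w k) sums p" "p \<in> H"
  shows "(\<lambda>n. \<zeta> ^ n *\<^sub>C conv C w n) sums F \<zeta> p"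
proof -
  note H' = closed_csubspaceD[OF H]
  note F = operatorsD[OF F_operator[OF z] H]
  let ?r = "norm \<zeta>"
  let ?S = "\<lambda>n. \<Sum>i<n. \<zeta> ^ i *\<^sub>C conv C w i"
  let ?P = "\<lambda>n. \<Sum>k<n. \<zeta> ^ k *\<^sub>C w k"
  have r: "0 \<le> ?r" "?r < 1" using z by auto
  have PH: "?P n \<in> H" for n by (intro subspace_sum H' w)
  have S: "?S n = (\<Sum>k<n. \<zeta> ^ k *\<^sub>C (\<Sum>j<n - k. \<zeta> ^ j *\<^sub>C C j (w k)))" for n
  proof -
    have "?S n = (\<Sum>i<n. \<Sum>k\<le>i. \<zeta> ^ (k + (i - k)) *\<^sub>C C (i - k) (w k))"
      by (simp add: conv_def scaleC.sum_right)
    also have "\<dots> = (\<Sum>(k,j)\<in>{(k,j). k + j < n}. \<zeta> ^ (k + j) *\<^sub>C C j (w k))"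
      by (rule sum.triangle_reindex[symmetric])
    also have "{(k,j). k + j < n} = (SIGMA k:{..<n}. {..<n - k})" by auto
    also have "(\<Sum>(k,j)\<in>(SIGMA k:{..<n}. {..<n - k}). \<zeta> ^ (k + j) *\<^sub>C C j (w k))
        = (\<Sum>k<n. \<Sum>j<n - k. \<zeta> ^ (k + j) *\<^sub>C C j (w k))"
      by (rule sum.Sigma[symmetric]) auto
    finally show ?thesis by (simp add: scaleC.sum_right scaleC_scaleC power_add)
  qed
  have diff: "norm (?S n - F \<zeta> (?P n)) \<le> real n * ?r ^ n * (B / (1 - ?r))" for n
  proof -
    have "F \<zeta> (?P n) = (\<Sum>k<n. \<zeta> ^ k *\<^sub>C F \<zeta> (w k))"
      by (simp add: F(6) F(3) H'(4) w)
    then have "norm (F \<zeta> (?P n) - ?S n) = norm (\<Sum>k<n. \<zeta> ^ k *\<^sub>C (F \<zeta> (w k) - (\<Sum>j<n - k. \<zeta> ^ j *\<^sub>C C j (w k))))"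
      unfolding S by (simp add: sum_subtractf scaleC.diff_right)
    also have "\<dots> \<le> (\<Sum>k<n. ?r ^ n * (B / (1 - ?r)))"
    proof (rule sum_norm_le)
      fix k assume k: "k \<in> {..<n}"
      have "norm (F \<zeta> (w k) - (\<Sum>j<n - k. \<zeta> ^ j *\<^sub>C C j (w k))) \<le> ?r ^ (n - k) / (1 - ?r) * norm (w k)"
        by (rule F_tail[OF z w])
      also have "\<dots> \<le> ?r ^ (n - k) / (1 - ?r) * B"
        using r by (intro mult_left_mono B) auto
      finally have "?r ^ k * norm (F \<zeta> (w k) - (\<Sum>j<n - k. \<zeta> ^ j *\<^sub>C C j (w k))) \<le> ?r ^ k * (?r ^ (n - k) / (1 - ?r) * B)"
        by (rule mult_left_mono) simp
      also have "\<dots> = ?r ^ n * (B / (1 - ?r))"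
        using k by (simp add: power_add[symmetric] mult.assoc[symmetric])
      finally show "norm (\<zeta> ^ k *\<^sub>C (F \<zeta> (w k) - (\<Sum>j<n - k. \<zeta> ^ j *\<^sub>C C j (w k)))) \<le> ?r ^ n * (B / (1 - ?r))"
        by (simp add: norm_scaleC norm_power)
    qed
    finally show ?thesis by (simp add: norm_minus_commute)
  qed
  have "(\<lambda>n. ?S n - F \<zeta> (?P n)) \<longlonglongrightarrow> 0"
  proof (rule Lim_null_comparison[OF always_eventually])
    show "\<forall>n. norm (?S n - F \<zeta> (?P n)) \<le> real n * ?r ^ n * (B / (1 - ?r))" using diff by blast
    show "(\<lambda>n. real n * ?r ^ n * (B / (1 - ?r))) \<longlonglongrightarrow> 0"
      using powser_times_n_limit_0[of ?r] r by (intro tendsto_mult_left_zero) auto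
  qed
  moreover have "(\<lambda>n. F \<zeta> (?P n)) \<longlonglongrightarrow> F \<zeta> p"
  proof (rule LIM_zero_cancel, rule Lim_null_comparison[OF always_eventually])
    show "\<forall>n. norm (F \<zeta> (?P n) - F \<zeta> p) \<le> 1 / (1 - ?r) * norm (?P n - p)"
      using F_bound[OF z] H'(6) PH p(2) by (simp add: F(5)[symmetric])
    show "(\<lambda>n. 1 / (1 - ?r) * norm (?P n - p)) \<longlonglongrightarrow> 0"
      using p(1) by (intro tendsto_mult_right_zero tendsto_norm_zero LIM_zero) (simp add: sums_def)
  qed
  ultimately show ?thesis using tendsto_add unfolding sums_def by fastforce
qed

end

lemma schur_coeffsD:
  assumes "C \<in> schur_coeffs H K"
  shows "C n \<in> operators H K"
    "(\<And>k. w k \<in> H) \<Longrightarrow> (\<Sum>n\<le>N. (norm (conv C w n))\<^sup>2) \<le> (\<Sum>n\<le>N. (norm (w n))\<^sup>2)"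
  using assms by (auto simp: schur_coeffs_def)

text \<open>The contraction property tested on the impulse x at time 0.\<close>

lemma schur_coeffs_column:
  assumes C: "C \<in> schur_coeffs H K" and H: "closed_csubspace H" and x: "x \<in> H"
  shows "(\<Sum>n\<le>N. (norm (C n x))\<^sup>2) \<le> (norm x)\<^sup>2" "norm (C n x) \<le> norm x"
proof -
  define w where "w k = (if k = 0 then x else 0)" for k :: nat
  have *: "conv C w n = C n x" for n
  proof -
    have "conv C w n = (\<Sum>k\<le>n. if k = 0 then C (n - k) x else 0)"
      unfolding conv_def w_def
      by (rule sum.cong) (auto simp: operatorsD(4)[OF schur_coeffsD(1)[OF C] H])
    then show ?thesis by simp
  qed
  have "(\<Sum>n\<le>N. (norm (conv C w n))\<^sup>2) \<le> (\<Sum>n\<le>N. (norm (w n))\<^sup>2)" for N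
    by (rule schur_coeffsD(2)[OF C]) (simp add: w_def x closed_csubspaceD(2)[OF H])
  moreover have "(\<Sum>n\<le>N. (norm (w n))\<^sup>2) = (norm x)\<^sup>2" for N
  proof -
    have "(\<Sum>n\<le>N. (norm (w n))\<^sup>2) = (\<Sum>n\<le>N. if n = 0 then (norm x)\<^sup>2 else 0)"
      by (rule sum.cong) (auto simp: w_def)
    then show ?thesis by simp
  qed
  ultimately show "(\<Sum>n\<le>N. (norm (C n x))\<^sup>2) \<le> (norm x)\<^sup>2" for N by (simp add: *)
  from this[of n] have "(norm (C n x))\<^sup>2 \<le> (norm x)\<^sup>2"
    by (rule order_trans[rotated]) (rule member_le_sum, auto)
  then show "norm (C n x) \<le> norm x" by (rule power2_le_imp_le) simp
qed

lemma bounded_coeffs_schur: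
  assumes "C \<in> schur_coeffs H K" "closed_csubspace H" "closed_csubspace K"
  shows "bounded_coeffs H K C"
  using assms schur_coeffsD(1) schur_coeffs_column(2) by unfold_locales blast+

lemma power_series_fun_0:
  fixes C :: "nat \<Rightarrow> 'a::chilbert_space \<Rightarrow> 'b::chilbert_space"
  assumes "bounded_coeffs H K C" "x \<in> H"
  shows "power_series_fun H C 0 x = C 0 x"
proof -
  interpret bounded_coeffs H K C by fact
  have "(\<lambda>n. 0 ^ n *\<^sub>C C n x) sums (\<Sum>n\<in>{0}. 0 ^ n *\<^sub>C C n x)"
    by (rule sums_finite) (auto simp: power_0_left)
  then show ?thesis using sums_unique2[OF F_sums[of 0 x]] assms(2) by auto
qed

section \<open>From coefficient sequences to Schur class functions\<close>

lemma opnorm_on_bounds: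
  assumes "0 \<in> H" "\<And>x. x \<in> H \<Longrightarrow> norm (T x) \<le> c * norm x" "0 \<le> c"
  shows "0 \<le> opnorm_on H T" "opnorm_on H T \<le> c"
proof -
  have le: "norm (T x) \<le> c" if "x \<in> {x\<in>H. norm x \<le> 1}" for x
    using assms(2)[of x] mult_left_mono[of "norm x" 1 c] that assms(3) by simp
  show "opnorm_on H T \<le> c"
    unfolding opnorm_on_def by (rule cSUP_least) (use assms(1) le in auto)
  have "norm (T 0) \<le> opnorm_on H T"
    unfolding opnorm_on_def by (rule cSUP_upper) (use assms(1) le in \<open>auto intro!: bdd_aboveI[of _ c]\<close>)
  then show "0 \<le> opnorm_on H T" using norm_ge_zero order_trans by blast
qed

text \<open>A real supremum carries information only over a bounded set; the constant M, of whatever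
  size, secures this.\<close>

lemma norm_le_opnorm_on:
  assumes "closed_csubspace H" "\<And>x. x \<in> H \<Longrightarrow> norm (T x) \<le> M * norm x"
    "\<And>c x. x \<in> H \<Longrightarrow> T (c *\<^sub>C x) = c *\<^sub>C T x" "x \<in> H"
  shows "norm (T x) \<le> opnorm_on H T * norm x"
proof (cases "x = 0")
  case True
  then show ?thesis using assms(3)[of x 0] assms(4) by simp
next
  case False
  define c where "c = complex_of_real (1 / norm x)"
  have "norm (T (c *\<^sub>C x)) \<le> opnorm_on H T"
    unfolding opnorm_on_def
  proof (rule cSUP_upper)
    show "c *\<^sub>C x \<in> {x\<in>H. norm x \<le> 1}"
      using False closed_csubspaceD(4)[OF assms(1,4)] by (simp add: c_def norm_scaleC norm_divide)
    show "bdd_above ((\<lambda>x. norm (T x)) ` {x \<in> H. norm x \<le> 1})"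
    proof (rule bdd_aboveI2)
      fix y assume "y \<in> {x\<in>H. norm x \<le> 1}"
      then show "norm (T y) \<le> \<bar>M\<bar>"
        using assms(2)[of y] mult_right_mono[OF abs_ge_self[of M] norm_ge_zero[of y]]
          mult_left_mono[of "norm y" 1 "\<bar>M\<bar>"] by simp
    qed
  qed
  then show ?thesis using False assms(3,4) by (simp add: c_def norm_scaleC norm_divide divide_simps)
qed

text \<open>
  The Toeplitz inequality is tested on the input \<open>w\<^sub>k = \<zeta>\<^sup>-\<^sup>k x\<close>: its output at time \<open>n\<close> is \<open>\<zeta>\<^sup>-\<^sup>n\<close> times the
  \<open>n\<close>-th partial sum of \<open>F(\<zeta>) x\<close>, and the growing weights \<open>|\<zeta>|\<^sup>-\<^sup>2\<^sup>n\<close> single out the limit.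
\<close>

lemma schur_coeffs_contraction:
  fixes H :: "'a::chilbert_space set" and K :: "'b::chilbert_space set"
  assumes C: "C \<in> schur_coeffs H K" and H: "closed_csubspace H" and K: "closed_csubspace K"
    and z: "\<zeta> \<in> ball 0 1" and x: "x \<in> H"
  shows "norm (power_series_fun H C \<zeta> x) \<le> norm x"
proof (cases "\<zeta> = 0")
  case True
  then show ?thesis
    using power_series_fun_0[OF bounded_coeffs_schur[OF C H K] x] schur_coeffs_column(2)[OF C H x] by simp
next
  case False
  interpret bounded_coeffs H K C by (rule bounded_coeffs_schur[OF C H K])
  define r where "r = inverse (norm \<zeta>)"
  have r: "1 < r" using z False by (simp add: r_def one_less_inverse)
  define w where "w k = inverse \<zeta> ^ k *\<^sub>C x" for k
  define s where "s n = (\<Sum>j\<le>n. \<zeta> ^ j *\<^sub>C C j x)" for n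
  have s: "s \<longlonglongrightarrow> F \<zeta> x"
    using F_sums[OF z x] unfolding sums_def_le s_def .
  have wH: "w k \<in> H" for k unfolding w_def by (rule closed_csubspaceD(4)[OF H x])
  have nw: "(norm (w k))\<^sup>2 = r ^ (2 * k) * (norm x)\<^sup>2" for k
    by (simp add: w_def norm_scaleC norm_power r_def norm_inverse power_mult_distrib power_mult[symmetric] mult.commute)
  have "conv C w n = inverse \<zeta> ^ n *\<^sub>C s n" for n
  proof -
    have "conv C w n = (\<Sum>k\<le>n. inverse \<zeta> ^ k *\<^sub>C C (n - k) x)"
      unfolding conv_def w_def by (simp add: C_lin x)
    also have "\<dots> = (\<Sum>k\<le>n. inverse \<zeta> ^ (n - k) *\<^sub>C C k x)"
      by (subst sum.nat_diff_reindex[where n = "Suc n", symmetric, unfolded lessThan_Suc_atMost]) simp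
    also have "\<dots> = (\<Sum>k\<le>n. inverse \<zeta> ^ n *\<^sub>C \<zeta> ^ k *\<^sub>C C k x)"
      using False by (intro sum.cong) (auto simp: scaleC_scaleC power_diff divide_simps)
    finally show ?thesis by (simp add: s_def scaleC.sum_right)
  qed
  then have nc: "(norm (conv C w n))\<^sup>2 = r ^ (2 * n) * (norm (s n))\<^sup>2" for n
    by (simp add: norm_scaleC norm_power r_def norm_inverse power_mult_distrib power_mult[symmetric] mult.commute)
  have main: "(\<Sum>n\<le>N. r ^ (2 * n) * (norm (s n))\<^sup>2) \<le> (\<Sum>n\<le>N. r ^ (2 * n) * (norm x)\<^sup>2)" for N
    using schur_coeffsD(2)[OF assms(1), of w N] wH by (simp add: nc nw)
  show ?thesis
  proof (rule ccontr)
    assume "\<not> ?thesis"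
    then have lt: "(norm x)\<^sup>2 < (norm (F \<zeta> x))\<^sup>2" by (simp add: power_strict_mono)
    define d where "d = ((norm (F \<zeta> x))\<^sup>2 - (norm x)\<^sup>2) / 2"
    have d: "0 < d" "(norm x)\<^sup>2 + d < (norm (F \<zeta> x))\<^sup>2" using lt by (auto simp: d_def field_simps)
    have "(\<lambda>n. (norm (s n))\<^sup>2) \<longlonglongrightarrow> (norm (F \<zeta> x))\<^sup>2" by (intro tendsto_intros s)
    from order_tendstoD(1)[OF this d(2)] obtain n0 where
      n0: "\<And>n. n \<ge> n0 \<Longrightarrow> (norm x)\<^sup>2 + d < (norm (s n))\<^sup>2"
      unfolding eventually_sequentially by blast
    \<comment> \<open>A bounds what the terms before n0 can contribute in favour of the input. Each
      later term exceeds its counterpart by at least d, as its weight is at least 1, so M d \<le> A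
      would hold for every M.\<close>
    define A where "A = (\<Sum>n<n0. r ^ (2 * n) * (norm x)\<^sup>2)"
    have "real M * d \<le> A" for M
    proof -
      have split: "(\<Sum>n<n0 + M. f n) = (\<Sum>n<n0. f n) + (\<Sum>n<M. f (n0 + n))" for f :: "nat \<Rightarrow> real"
        by (induction M) simp_all
      have "(\<Sum>n<n0 + M. r ^ (2 * n) * (norm (s n))\<^sup>2) \<le> (\<Sum>n<n0 + M. r ^ (2 * n) * (norm x)\<^sup>2)"
        using main[of "n0 + M - 1"] by (cases "n0 + M") (simp_all add: lessThan_Suc_atMost)
      then have "(\<Sum>n<M. r ^ (2 * (n0 + n)) * (norm (s (n0 + n)))\<^sup>2) \<le> A + (\<Sum>n<M. r ^ (2 * (n0 + n)) * (norm x)\<^sup>2)"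
        unfolding split A_def[symmetric]
        using sum_nonneg[of "{..<n0}" "\<lambda>n. r ^ (2 * n) * (norm (s n))\<^sup>2"] r by simp
      moreover have "(\<Sum>n<M. d + r ^ (2 * (n0 + n)) * (norm x)\<^sup>2) \<le> (\<Sum>n<M. r ^ (2 * (n0 + n)) * (norm (s (n0 + n)))\<^sup>2)"
      proof (rule sum_mono)
        fix n
        have "1 \<le> r ^ (2 * (n0 + n))" using r by (simp add: one_le_power)
        then have "d + r ^ (2 * (n0 + n)) * (norm x)\<^sup>2 \<le> r ^ (2 * (n0 + n)) * ((norm x)\<^sup>2 + d)"
          using d(1) by (simp add: distrib_left)
        also have "\<dots> \<le> r ^ (2 * (n0 + n)) * (norm (s (n0 + n)))\<^sup>2"
          using n0[of "n0 + n"] r by (intro mult_left_mono) auto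
        finally show "d + r ^ (2 * (n0 + n)) * (norm x)\<^sup>2 \<le> r ^ (2 * (n0 + n)) * (norm (s (n0 + n)))\<^sup>2" .
      qed
      ultimately show ?thesis by (simp add: sum.distrib)
    qed
    moreover obtain M :: nat where "A / d < real M" using reals_Archimedean2 by blast
    ultimately show False using d(1) by (metis divide_less_eq not_less)
  qed
qed

text \<open>The second derivative of the geometric series; its terms dominate the remainders of the
  difference quotients of the powers on a disc of radius r.\<close>

lemma summable_second_diffs:
  fixes r :: real
  assumes "0 < r" "r < 1"
  shows "summable (\<lambda>n. real n * real (n - Suc 0) * r ^ (n - 2))"
proof -
  have 1: "summable (\<lambda>n. diffs (\<lambda>_. 1) n * x ^ n)" if "norm x < 1" for x :: real
    by (rule termdiff_converges[OF that]) (simp add: summable_geometric)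
  have "summable (\<lambda>n. diffs (diffs (\<lambda>_. 1)) n * r ^ n)"
    by (rule termdiff_converges[OF _ 1]) (use assms in auto)
  then have "summable (\<lambda>n. real (n + 2) * real (n + 2 - Suc 0) * r ^ (n + 2 - 2))"
    by (simp add: diffs_def algebra_simps)
  then show ?thesis by (subst summable_iff_shift[of _ 2, symmetric])
qed

lemma schur_coeffs_imp_schur_class:
  fixes H :: "'a::chilbert_space set" and K :: "'b::chilbert_space set"
  assumes C: "C \<in> schur_coeffs H K" and H: "closed_csubspace H" and K: "closed_csubspace K"
  shows "power_series_fun H C \<in> schur_class H K"
proof -
  interpret bounded_coeffs H K C by (rule bounded_coeffs_schur[OF C H K])
  note H' = closed_csubspaceD[OF H]
  have "op_analytic H K F"
    unfolding op_analytic_def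
  proof
    fix \<zeta> :: complex assume z: "\<zeta> \<in> ball 0 1"
    define r where "r = (1 + norm \<zeta>) / 2"
    have r: "norm \<zeta> < r" "0 < r" "r < 1" using z by (auto simp: r_def add_pos_nonneg)
    \<comment> \<open>By Taylor's estimate, q n |\<xi> - \<zeta>| bounds the error of the difference
      quotient of the n-th power for arguments of modulus at most r. Summed over n, the error for F
      is of order |\<xi> - \<zeta>| in operator norm.\<close>
    define q where "q n = real n * real (n - Suc 0) * r ^ (n - 2)" for n
    have q: "summable q" unfolding q_def by (rule summable_second_diffs[OF r(2,3)])
    define D where "D = (\<lambda>x\<in>H. \<Sum>n. (of_nat n * \<zeta> ^ (n - Suc 0)) *\<^sub>C C n x)"
    have sumD: "summable (\<lambda>n. real n * norm \<zeta> ^ (n - Suc 0))"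
    proof -
      have "summable (\<lambda>n. diffs (\<lambda>_. 1) n * norm \<zeta> ^ n)"
        by (rule termdiff_converges[where K = 1]) (use z in \<open>auto simp: summable_geometric\<close>)
      then have "summable (\<lambda>n. real (n + 1) * norm \<zeta> ^ (n + 1 - Suc 0))" by (simp add: diffs_def)
      then show ?thesis by (subst summable_iff_shift[of _ 1, symmetric])
    qed
    have nD: "norm ((of_nat n * \<zeta> ^ (n - Suc 0)) *\<^sub>C C n x) \<le> real n * norm \<zeta> ^ (n - Suc 0) * norm x" if "x \<in> H" for n x
      using C_le[OF that, of n] by (simp add: norm_scaleC norm_mult norm_power mult_left_mono)
    have Dsums: "(\<lambda>n. (of_nat n * \<zeta> ^ (n - Suc 0)) *\<^sub>C C n x) sums D x" if x: "x \<in> H" for x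
    proof -
      have "summable (\<lambda>n. (of_nat n * \<zeta> ^ (n - Suc 0)) *\<^sub>C C n x)"
        by (rule summable_comparison_test'[OF summable_mult2[OF sumD, of "norm x"]]) (rule nD[OF x])
      then show ?thesis using x by (simp add: D_def summable_sums)
    qed
    have D: "D \<in> operators H K"
    proof -
      have "D x \<in> K" if x: "x \<in> H" for x
      proof (rule closed_sequentially[OF closed_csubspaceD(1)[OF K]])
        show "(\<Sum>n<m. (of_nat n * \<zeta> ^ (n - Suc 0)) *\<^sub>C C n x) \<in> K" for m
          by (intro subspace_sum closed_csubspaceD[OF K] C_lin x)
        show "(\<lambda>m. \<Sum>n<m. (of_nat n * \<zeta> ^ (n - Suc 0)) *\<^sub>C C n x) \<longlonglongrightarrow> D x"
          using Dsums[OF x] by (simp add: sums_def)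
      qed
      moreover have "D (x + y) = D x + D y" if "x \<in> H" "y \<in> H" for x y
        by (rule sums_unique2[OF Dsums[OF H'(3)[OF that]]])
          (use sums_add[OF Dsums[OF that(1)] Dsums[OF that(2)]] in \<open>simp add: C_lin that scaleC_add_right\<close>)
      moreover have "D (c *\<^sub>C x) = c *\<^sub>C D x" if "x \<in> H" for c x
        by (rule sums_unique2[OF Dsums[OF H'(4)[OF that]]])
          (use bounded_linear.sums[OF scaleC.bounded_linear_right Dsums[OF that], of c] in
            \<open>simp add: C_lin that scaleC_scaleC mult.commute mult.left_commute\<close>)
      moreover have "D \<in> extensional H" by (simp add: D_def)
      moreover have "norm (D x) \<le> (\<Sum>n. real n * norm \<zeta> ^ (n - Suc 0)) * norm x" if x: "x \<in> H" for x
        by (rule norm_sums_le[OF Dsums[OF x] sums_mult2[OF summable_sums[OF sumD]] nD[OF x]])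
      ultimately show ?thesis unfolding operators_def PiE_def by blast
    qed
    let ?T = "\<lambda>\<xi> x. inverse (\<xi> - \<zeta>) *\<^sub>C (F \<xi> x - F \<zeta> x) - D x"
    have bound: "norm (?T \<xi> x) \<le> (suminf q * norm (\<xi> - \<zeta>)) * norm x"
      if xi: "norm \<xi> < r" "\<xi> \<noteq> \<zeta>" and x: "x \<in> H" for \<xi> x
    proof -
      have xi1: "\<xi> \<in> ball 0 1" using xi r by auto
      have 1: "(\<lambda>n. inverse (\<xi> - \<zeta>) *\<^sub>C (\<xi> ^ n *\<^sub>C C n x - \<zeta> ^ n *\<^sub>C C n x) - (of_nat n * \<zeta> ^ (n - Suc 0)) *\<^sub>C C n x) sums ?T \<xi> x"
        by (intro sums_diff bounded_linear.sums[OF scaleC.bounded_linear_right] F_sums Dsums x z xi1)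
      have 2: "(\<lambda>n. q n * norm (\<xi> - \<zeta>) * norm x) sums (suminf q * norm (\<xi> - \<zeta>) * norm x)"
        by (intro sums_mult2 summable_sums q)
      have 3: "norm (inverse (\<xi> - \<zeta>) *\<^sub>C (\<xi> ^ n *\<^sub>C C n x - \<zeta> ^ n *\<^sub>C C n x) - (of_nat n * \<zeta> ^ (n - Suc 0)) *\<^sub>C C n x)
          \<le> q n * norm (\<xi> - \<zeta>) * norm x" for n
      proof -
        have "inverse (\<xi> - \<zeta>) *\<^sub>C (\<xi> ^ n *\<^sub>C C n x - \<zeta> ^ n *\<^sub>C C n x) - (of_nat n * \<zeta> ^ (n - Suc 0)) *\<^sub>C C n x
          = ((\<xi> ^ n - \<zeta> ^ n) / (\<xi> - \<zeta>) - of_nat n * \<zeta> ^ (n - Suc 0)) *\<^sub>C C n x"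
          by (simp only: scaleC.diff_left[symmetric] scaleC_scaleC) (simp add: divide_inverse mult.commute)
        moreover have "norm ((\<xi> ^ n - \<zeta> ^ n) / (\<xi> - \<zeta>) - of_nat n * \<zeta> ^ (n - Suc 0)) \<le> q n * norm (\<xi> - \<zeta>)"
          using lemma_termdiff3[of "\<xi> - \<zeta>" \<zeta> r n] xi r by (simp add: q_def)
        ultimately show ?thesis
          using C_le[OF x, of n] by (auto simp: norm_scaleC intro: mult_mono order_trans[OF norm_ge_zero])
      qed
      show ?thesis by (rule norm_sums_le[OF 1 2 3])
    qed
    have "((\<lambda>\<xi>. opnorm_on H (?T \<xi>)) \<longlongrightarrow> 0) (at \<zeta>)"
    proof (rule Lim_null_comparison)
      have "((\<lambda>\<xi>. norm (\<xi> - \<zeta>)) \<longlongrightarrow> norm (\<zeta> - \<zeta>)) (at \<zeta>)" by (intro tendsto_intros)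
      then show "((\<lambda>\<xi>. suminf q * norm (\<xi> - \<zeta>)) \<longlongrightarrow> 0) (at \<zeta>)"
        by (intro tendsto_mult_right_zero) simp
      have q0: "0 \<le> suminf q" by (rule suminf_nonneg[OF q]) (use r in \<open>simp add: q_def\<close>)
      show "\<forall>\<^sub>F \<xi> in at \<zeta>. norm (opnorm_on H (?T \<xi>)) \<le> suminf q * norm (\<xi> - \<zeta>)"
        unfolding eventually_at
      proof (intro exI[of _ "r - norm \<zeta>"] conjI ballI impI)
        fix \<xi> assume "\<xi> \<noteq> \<zeta> \<and> dist \<xi> \<zeta> < r - norm \<zeta>"
        then have xi: "norm \<xi> < r" "\<xi> \<noteq> \<zeta>"
          using norm_triangle_ineq2[of \<xi> \<zeta>] by (auto simp: dist_norm)
        show "norm (opnorm_on H (?T \<xi>)) \<le> suminf q * norm (\<xi> - \<zeta>)"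
          using opnorm_on_bounds[OF H'(2) bound[OF xi]] q0 by simp
      qed (use r in simp)
    qed
    then show "\<exists>D\<in>operators H K. ((\<lambda>\<xi>. opnorm_on H (\<lambda>x. inverse (\<xi> - \<zeta>) *\<^sub>C (F \<xi> x - F \<zeta> x) - D x)) \<longlongrightarrow> 0) (at \<zeta>)"
      using D by blast
  qed
  moreover have "F \<in> ball 0 1 \<rightarrow>\<^sub>E operators H K"
    using F_operator by (auto simp: power_series_fun_def)
  moreover have "opnorm_on H (F \<zeta>) \<le> 1" if "\<zeta> \<in> ball 0 1" for \<zeta>
    by (rule opnorm_on_bounds[OF H'(2)]) (use schur_coeffs_contraction[OF assms that] in auto)
  ultimately show ?thesis by (simp add: schur_class_def)
qed

subsection \<open>Toeplitz contractions from contractive analytic functions\<close>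

text \<open>The terms form a geometric progression whose ratio is an M-th root of unity; for indices
  below M this ratio is 1 only if n = m.\<close>

lemma sum_roots_of_unity:
  assumes "n < M" "m < M"
  shows "(\<Sum>j<M. cis (2 * pi * real j / real M) ^ n * cnj (cis (2 * pi * real j / real M)) ^ m)
    = (if n = m then of_nat M else 0)"
proof -
  define e where "e k = cis (2 * pi * real k / real M)" for k :: nat
  define c where "c = e n * cnj (e m)"
  have M: "0 < M" using assms by simp
  have cnj_e: "e k * cnj (e k) = 1" for k by (simp add: e_def cis_cnj cis_mult)
  have pw: "cis (2 * pi * real j / real M) ^ n * cnj (cis (2 * pi * real j / real M)) ^ m = c ^ j" for j
    by (simp add: c_def e_def cis_cnj Complex.DeMoivre power_mult_distrib mult_ac)
  have eM: "e k ^ M = 1" for k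
    using M cis_multiple_2pi[of "real k"] by (simp add: e_def Complex.DeMoivre)
  have cM: "c ^ M = 1"
    by (simp add: c_def power_mult_distrib eM complex_cnj_power[symmetric])
  have eq: "(\<Sum>j<M. cis (2 * pi * real j / real M) ^ n * cnj (cis (2 * pi * real j / real M)) ^ m) = (\<Sum>j<M. c ^ j)"
    by (simp only: pw)
  show ?thesis
  proof (cases "n = m")
    case True
    then have "c = 1" by (simp add: c_def cnj_e)
    then show ?thesis using True unfolding eq by simp
  next
    case False
    have "c \<noteq> 1"
    proof
      assume "c = 1"
      then have "e n * (cnj (e m) * e m) = e m" by (simp add: c_def mult.assoc[symmetric])
      then have "e n = e m" using cnj_e[of m] by (simp add: mult.commute)
      moreover have "inj_on e {..<M}"
        using Complex.bij_betw_roots_unity[OF M] unfolding e_def bij_betw_def by blast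
      ultimately show False using assms False by (auto dest: inj_onD)
    qed
    then have "(\<Sum>j<M. c ^ j) = 0" using cM geometric_sum[of c M] by simp
    then show ?thesis using False unfolding eq by simp
  qed
qed

text \<open>The discrete counterpart of the mean over a circle, exact here because the polynomial
  has degree below M.\<close>

lemma parseval_roots_of_unity:
  fixes q :: "nat \<Rightarrow> 'a::complex_inner" and r :: real
  shows "(\<Sum>j<M. (norm (\<Sum>n<M. (of_real r * cis (2 * pi * real j / real M)) ^ n *\<^sub>C q n))\<^sup>2)
    = real M * (\<Sum>n<M. r ^ (2 * n) * (norm (q n))\<^sup>2)"
proof -
  let ?e = "\<lambda>j. cis (2 * pi * real j / real M)"
  have "complex_of_real (\<Sum>j<M. (norm (\<Sum>n<M. (of_real r * ?e j) ^ n *\<^sub>C q n))\<^sup>2)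
    = (\<Sum>j<M. \<Sum>m<M. \<Sum>n<M. (of_real r ^ (n + m) * cinner (q n) (q m)) * (?e j ^ n * cnj (?e j) ^ m))"
    by (simp add: cinner_self[symmetric] cinner_sum_left cinner_sum_right cinner_scaleC_left
        cinner_scaleC_right power_mult_distrib power_add sum_distrib_left mult_ac del: of_real_power)
  also have "\<dots> = (\<Sum>m<M. \<Sum>n<M. (of_real r ^ (n + m) * cinner (q n) (q m)) * (\<Sum>j<M. ?e j ^ n * cnj (?e j) ^ m))"
    by (subst sum.swap, rule sum.cong[OF refl], subst sum.swap) (simp add: sum_distrib_left)
  also have "\<dots> = (\<Sum>m<M. \<Sum>n<M. if n = m then of_real r ^ (n + m) * cinner (q n) (q m) * of_nat M else 0)"
    by (intro sum.cong refl) (simp add: sum_roots_of_unity)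
  also have "\<dots> = complex_of_real (real M * (\<Sum>n<M. r ^ (2 * n) * (norm (q n))\<^sup>2))"
    by (simp add: cinner_self sum_distrib_left mult_2[symmetric] mult_ac)
  finally show ?thesis by (simp only: of_real_eq_iff)
qed

text \<open>
  The contractivity of \<open>F\<close> is averaged over the points \<open>r \<omega>\<^sup>j\<close> with \<open>\<omega>\<close> a primitive \<open>M\<close>-th root of unity,
  followed by \<open>M \<rightarrow> \<infinity>\<close> and \<open>r \<rightarrow> 1\<close>.
\<close>

lemma (in bounded_coeffs) contraction_imp_schur_coeffs:
  assumes contr: "\<And>\<zeta> x. \<zeta> \<in> ball 0 1 \<Longrightarrow> x \<in> H \<Longrightarrow> norm (F \<zeta> x) \<le> norm x"
  shows "C \<in> schur_coeffs H K"
proof -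
  note H' = closed_csubspaceD[OF H]
  have "(\<Sum>n\<le>N. (norm (conv C w0 n))\<^sup>2) \<le> (\<Sum>n\<le>N. (norm (w0 n))\<^sup>2)" if w0: "range w0 \<subseteq> H" for w0 N
  proof -
    \<comment> \<open>Cutting the input after time N leaves the outputs up to N unchanged by
      causality and makes the generating function of the input a polynomial.\<close>
    define w where "w k = (if k \<le> N then w0 k else 0)" for k
    have w: "w k \<in> H" for k using w0 H'(2) by (auto simp: w_def)
    define B where "B = (\<Sum>k\<le>N. norm (w0 k))"
    have sumB: "(\<Sum>k\<le>n. norm (w k)) \<le> B" for n
    proof -
      have "(\<Sum>k\<le>n. norm (w k)) = (\<Sum>k\<in>{..n} \<inter> {..N}. norm (w0 k))"
        by (rule sum.mono_neutral_cong_right) (auto simp: w_def)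
      also have "\<dots> \<le> B" unfolding B_def by (rule sum_mono2) auto
      finally show ?thesis .
    qed
    have wB: "norm (w k) \<le> B" for k
      by (rule order_trans[OF _ sumB[of k]]) (rule member_le_sum, auto)
    define g where "g = conv C w"
    have gB: "norm (g n) \<le> B" for n
    proof -
      have "norm (g n) \<le> (\<Sum>k\<le>n. norm (w k))"
        unfolding g_def conv_def by (rule sum_norm_le) (rule C_le[OF w])
      then show ?thesis using sumB[of n] by linarith
    qed
    have key: "(\<Sum>n\<le>N. r ^ (2 * n) * (norm (g n))\<^sup>2) \<le> (\<Sum>n\<le>N. r ^ (2 * n) * (norm (w n))\<^sup>2)"
      if r: "0 < r" "r < 1" for r :: real
    proof -
      \<comment> \<open>Bounds, for |\<zeta>| = r, the part of the output series of index M and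
        beyond; B bounds all outputs.\<close>
      define \<epsilon> where "\<epsilon> M = r ^ M / (1 - r) * B" for M
      have est: "(\<Sum>n\<le>N. r ^ (2 * n) * (norm (g n))\<^sup>2) \<le> (\<Sum>n\<le>N. r ^ (2 * n) * (norm (w n))\<^sup>2) + (2 * B * \<epsilon> M + (\<epsilon> M)\<^sup>2)"
        if M: "N < M" for M
      proof -
        let ?l = "\<lambda>j. of_real r * cis (2 * pi * real j / real M)"
        have nl: "norm (?l j) = r" for j using r by (simp add: norm_mult)
        have lb: "?l j \<in> ball 0 1" for j using r by (simp add: norm_mult)
        let ?p = "\<lambda>j. \<Sum>k<M. ?l j ^ k *\<^sub>C w k"
        let ?q = "\<lambda>j. \<Sum>n<M. ?l j ^ n *\<^sub>C g n"
        have pH: "?p j \<in> H" for j by (intro subspace_sum H' w)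
        have pB: "norm (?p j) \<le> B" for j
        proof -
          have "norm (?p j) \<le> (\<Sum>k<M. norm (w k))"
          proof (rule sum_norm_le)
            fix k
            have "r ^ k \<le> 1" using r by (simp add: power_le_one)
            then show "norm (?l j ^ k *\<^sub>C w k) \<le> norm (w k)"
              using nl[of j] r by (simp add: norm_scaleC norm_power mult_left_le_one_le)
          qed
          then show ?thesis using sumB[of "M - 1"] M by (cases M) (auto simp: lessThan_Suc_atMost)
        qed
        have ps: "(\<lambda>k. ?l j ^ k *\<^sub>C w k) sums ?p j" for j
          by (rule sums_finite) (use M in \<open>auto simp: w_def\<close>)
        have gs: "(\<lambda>n. ?l j ^ n *\<^sub>C g n) sums F (?l j) (?p j)" for j
          unfolding g_def by (rule F_conv_sums[OF lb w wB ps pH])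
        have tail: "norm (F (?l j) (?p j) - ?q j) \<le> \<epsilon> M" for j
        proof -
          have 1: "(\<lambda>n. ?l j ^ (n + M) *\<^sub>C g (n + M)) sums (F (?l j) (?p j) - ?q j)"
            by (rule sums_split_initial_segment[OF gs])
          have 2: "(\<lambda>n. r ^ n * (r ^ M * B)) sums (1 / (1 - r) * (r ^ M * B))"
            using r by (intro sums_mult2 geometric_sums) simp
          have "norm (F (?l j) (?p j) - ?q j) \<le> 1 / (1 - r) * (r ^ M * B)"
          proof (rule norm_sums_le[OF 1 2])
            fix n
            have "norm (?l j ^ (n + M) *\<^sub>C g (n + M)) = r ^ (n + M) * norm (g (n + M))"
              unfolding norm_scaleC norm_power nl ..
            also have "\<dots> \<le> r ^ (n + M) * B"
              using r gB[of "n + M"] by (intro mult_left_mono) auto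
            finally show "norm (?l j ^ (n + M) *\<^sub>C g (n + M)) \<le> r ^ n * (r ^ M * B)"
              by (simp only: power_add mult.assoc)
          qed
          then show ?thesis by (simp add: \<epsilon>_def)
        qed
        have qle: "(norm (?q j))\<^sup>2 \<le> (norm (?p j))\<^sup>2 + (2 * B * \<epsilon> M + (\<epsilon> M)\<^sup>2)" for j
        proof -
          have e0: "0 \<le> \<epsilon> M" using tail[of 0] norm_ge_zero order_trans by blast
          have "norm (?q j) \<le> norm (F (?l j) (?p j)) + norm (F (?l j) (?p j) - ?q j)"
            using norm_triangle_ineq4[of "F (?l j) (?p j)" "F (?l j) (?p j) - ?q j"] by simp
          also have "\<dots> \<le> norm (?p j) + \<epsilon> M" by (rule add_mono[OF contr[OF lb pH] tail])
          finally have "(norm (?q j))\<^sup>2 \<le> (norm (?p j) + \<epsilon> M)\<^sup>2" by (rule power_mono) simp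
          also have "\<dots> = (norm (?p j))\<^sup>2 + 2 * norm (?p j) * \<epsilon> M + (\<epsilon> M)\<^sup>2"
            by (simp add: power2_sum)
          also have "2 * norm (?p j) * \<epsilon> M \<le> 2 * B * \<epsilon> M"
            using pB[of j] e0 by (intro mult_right_mono) auto
          finally show ?thesis by simp
        qed
        have "real M * (\<Sum>n<M. r ^ (2 * n) * (norm (g n))\<^sup>2) = (\<Sum>j<M. (norm (?q j))\<^sup>2)"
          by (rule parseval_roots_of_unity[symmetric])
        also have "\<dots> \<le> (\<Sum>j<M. (norm (?p j))\<^sup>2 + (2 * B * \<epsilon> M + (\<epsilon> M)\<^sup>2))"
          by (rule sum_mono) (rule qle)
        also have "\<dots> = real M * (\<Sum>n<M. r ^ (2 * n) * (norm (w n))\<^sup>2) + real M * (2 * B * \<epsilon> M + (\<epsilon> M)\<^sup>2)"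
          by (simp add: sum.distrib parseval_roots_of_unity)
        finally have "(\<Sum>n<M. r ^ (2 * n) * (norm (g n))\<^sup>2) \<le> (\<Sum>n<M. r ^ (2 * n) * (norm (w n))\<^sup>2) + (2 * B * \<epsilon> M + (\<epsilon> M)\<^sup>2)"
          using M unfolding distrib_left[symmetric] by (subst (asm) mult_le_cancel_left_pos) auto
        moreover have "(\<Sum>n\<le>N. r ^ (2 * n) * (norm (g n))\<^sup>2) \<le> (\<Sum>n<M. r ^ (2 * n) * (norm (g n))\<^sup>2)"
          using M r by (intro sum_mono2) auto
        moreover have "(\<Sum>n<M. r ^ (2 * n) * (norm (w n))\<^sup>2) = (\<Sum>n\<le>N. r ^ (2 * n) * (norm (w n))\<^sup>2)"
          using M by (intro sum.mono_neutral_right) (auto simp: w_def)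
        ultimately show ?thesis by linarith
      qed
      have e: "\<epsilon> \<longlonglongrightarrow> 0"
        unfolding \<epsilon>_def using r
        by (intro tendsto_mult_left_zero tendsto_divide_zero LIMSEQ_realpow_zero) auto
      have "(\<lambda>M. (\<Sum>n\<le>N. r ^ (2 * n) * (norm (w n))\<^sup>2) + (2 * B * \<epsilon> M + (\<epsilon> M)\<^sup>2))
          \<longlonglongrightarrow> (\<Sum>n\<le>N. r ^ (2 * n) * (norm (w n))\<^sup>2) + (2 * B * 0 + 0\<^sup>2)"
        by (intro tendsto_intros e)
      moreover have "\<exists>M0. \<forall>M\<ge>M0. (\<Sum>n\<le>N. r ^ (2 * n) * (norm (g n))\<^sup>2)
          \<le> (\<Sum>n\<le>N. r ^ (2 * n) * (norm (w n))\<^sup>2) + (2 * B * \<epsilon> M + (\<epsilon> M)\<^sup>2)"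
        using est by (intro exI[of _ "Suc N"]) auto
      ultimately show ?thesis using LIMSEQ_le_const by fastforce
    qed
    have "(\<Sum>n\<le>N. (norm (g n))\<^sup>2) \<le> (\<Sum>n\<le>N. (norm (w n))\<^sup>2)"
    proof (rule tendsto_le[of "at_left (1::real)"])
      show "((\<lambda>r. \<Sum>n\<le>N. r ^ (2 * n) * (norm (w n))\<^sup>2) \<longlongrightarrow> (\<Sum>n\<le>N. (norm (w n))\<^sup>2)) (at_left 1)"
        by (rule tendsto_eq_intros refl | simp)+
      show "((\<lambda>r. \<Sum>n\<le>N. r ^ (2 * n) * (norm (g n))\<^sup>2) \<longlongrightarrow> (\<Sum>n\<le>N. (norm (g n))\<^sup>2)) (at_left 1)"
        by (rule tendsto_eq_intros refl | simp)+
      show "\<forall>\<^sub>F r in at_left (1::real). (\<Sum>n\<le>N. r ^ (2 * n) * (norm (g n))\<^sup>2) \<le> (\<Sum>n\<le>N. r ^ (2 * n) * (norm (w n))\<^sup>2)"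
        using eventually_at_left_real[of 0 "1::real"] by (rule eventually_mono) (auto intro: key)
    qed simp
    moreover have "g n = conv C w0 n" if "n \<le> N" for n
      using that unfolding g_def conv_def by (intro sum.cong) (auto simp: w_def)
    ultimately show ?thesis by (simp add: w_def)
  qed
  then show ?thesis using C by (auto simp: schur_coeffs_def)
qed

lemma schur_class_scalar_holomorphic:
  assumes F: "F \<in> schur_class H K" and H: "closed_csubspace H" and x: "x \<in> H"
  shows "(\<lambda>\<zeta>. cinner (F \<zeta> x) y) holomorphic_on ball 0 1"
  unfolding holomorphic_on_open[OF open_ball]
proof
  fix \<zeta> :: complex assume z: "\<zeta> \<in> ball 0 1"
  have Fop: "F \<xi> \<in> operators H K" if "\<xi> \<in> ball 0 1" for \<xi>
    using F that by (auto simp: schur_class_def)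
  obtain D where D: "D \<in> operators H K"
    and lim: "((\<lambda>\<xi>. opnorm_on H (\<lambda>x. inverse (\<xi> - \<zeta>) *\<^sub>C (F \<xi> x - F \<zeta> x) - D x)) \<longlongrightarrow> 0) (at \<zeta>)"
    using F z unfolding schur_class_def op_analytic_def by blast
  let ?T = "\<lambda>\<xi> x. inverse (\<xi> - \<zeta>) *\<^sub>C (F \<xi> x - F \<zeta> x) - D x"
  have le: "norm (?T \<xi> x) \<le> opnorm_on H (?T \<xi>) * norm x" if xi: "\<xi> \<in> ball 0 1" for \<xi>
  proof -
    obtain M1 where M1: "\<forall>x\<in>H. norm (F \<xi> x) \<le> M1 * norm x"
      using Fop[OF xi] by (auto simp: operators_def)
    obtain M2 where M2: "\<forall>x\<in>H. norm (F \<zeta> x) \<le> M2 * norm x"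
      using Fop[OF z] by (auto simp: operators_def)
    obtain M3 where M3: "\<forall>x\<in>H. norm (D x) \<le> M3 * norm x"
      using D by (auto simp: operators_def)
    show ?thesis
    proof (rule norm_le_opnorm_on[OF H _ _ x])
      fix x assume x: "x \<in> H"
      have "norm (?T \<xi> x) \<le> norm (inverse (\<xi> - \<zeta>)) * norm (F \<xi> x - F \<zeta> x) + norm (D x)"
        using norm_triangle_ineq4[of "inverse (\<xi> - \<zeta>) *\<^sub>C (F \<xi> x - F \<zeta> x)" "D x"] by (simp add: norm_scaleC)
      moreover have "norm (F \<xi> x - F \<zeta> x) \<le> M1 * norm x + M2 * norm x"
        by (rule order_trans[OF norm_triangle_ineq4 add_mono[OF bspec[OF M1 x] bspec[OF M2 x]]])
      then have "norm (inverse (\<xi> - \<zeta>)) * norm (F \<xi> x - F \<zeta> x) + norm (D x)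
          \<le> norm (inverse (\<xi> - \<zeta>)) * (M1 * norm x + M2 * norm x) + M3 * norm x"
        by (intro add_mono mult_left_mono M3[rule_format] x) auto
      ultimately show "norm (?T \<xi> x) \<le> (norm (inverse (\<xi> - \<zeta>)) * (M1 + M2) + M3) * norm x"
        by (simp add: algebra_simps)
    next
      fix c x assume x: "x \<in> H"
      show "?T \<xi> (c *\<^sub>C x) = c *\<^sub>C ?T \<xi> x"
        by (simp add: operatorsD(3)[OF Fop[OF xi] H x] operatorsD(3)[OF Fop[OF z] H x]
            operatorsD(3)[OF D H x] scaleC.diff_right scaleC_scaleC mult.commute)
    qed
  qed
  have T0: "((\<lambda>\<xi>. ?T \<xi> x) \<longlongrightarrow> 0) (at \<zeta>)"
  proof (rule Lim_null_comparison)
    show "((\<lambda>\<xi>. opnorm_on H (?T \<xi>) * norm x) \<longlongrightarrow> 0) (at \<zeta>)"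
      by (rule tendsto_mult_left_zero[OF lim])
    show "\<forall>\<^sub>F \<xi> in at \<zeta>. norm (?T \<xi> x) \<le> opnorm_on H (?T \<xi>) * norm x"
      using eventually_at_ball'[of 1 0 UNIV] le z
      by (metis (mono_tags, lifting) UNIV_I eventually_at_topological open_ball)
  qed
  have "((\<lambda>\<xi>. (cinner (F \<xi> x) y - cinner (F \<zeta> x) y) / (\<xi> - \<zeta>)) \<longlongrightarrow> cinner (D x) y) (at \<zeta>)"
  proof -
    interpret bounded_linear "\<lambda>v. cinner v y" by (rule bounded_linear_cinner_left)
    have "((\<lambda>\<xi>. cinner (?T \<xi> x) y + cinner (D x) y) \<longlongrightarrow> cinner 0 y + cinner (D x) y) (at \<zeta>)"
      by (intro tendsto_add tendsto T0 tendsto_const)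
    moreover have "cinner (?T \<xi> x) y + cinner (D x) y = (cinner (F \<xi> x) y - cinner (F \<zeta> x) y) / (\<xi> - \<zeta>)" for \<xi>
      by (simp add: diff cinner_scaleC_left divide_inverse mult.commute)
    ultimately show ?thesis by simp
  qed
  then show "\<exists>f'. ((\<lambda>\<zeta>. cinner (F \<zeta> x) y) has_field_derivative f') (at \<zeta>)"
    unfolding has_field_derivative_iff by blast
qed

text \<open>Cauchy's inequality on the circle of radius r, followed by r tending to 1.\<close>

lemma bounded_holomorphic_coeff:
  assumes f: "f holomorphic_on ball 0 1" and B: "\<And>\<zeta>. \<zeta> \<in> ball 0 1 \<Longrightarrow> norm (f \<zeta>) \<le> B"
  shows "norm ((deriv ^^ n) f 0 / fact n) \<le> B"
proof -
  have le: "norm ((deriv ^^ n) f 0 / fact n) * r ^ n \<le> B" if r: "0 < r" "r < 1" for r :: real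
  proof -
    have sub: "cball 0 r \<subseteq> ball (0::complex) 1" using r by auto
    have "norm ((deriv ^^ n) f 0) \<le> fact n * B / r ^ n"
    proof (rule Cauchy_inequality)
      show "f holomorphic_on ball 0 r" by (rule holomorphic_on_subset[OF f]) (use r in auto)
      show "continuous_on (cball 0 r) f"
        by (rule continuous_on_subset[OF holomorphic_on_imp_continuous_on[OF f] sub])
      show "norm (f x) \<le> B" if "norm (0 - x) = r" for x using that r by (intro B) auto
    qed (rule r)
    then show ?thesis using r by (simp add: norm_divide divide_simps mult.commute)
  qed
  show ?thesis
  proof (rule tendsto_upperbound[of _ _ "at_left (1::real)"])
    show "((\<lambda>r. norm ((deriv ^^ n) f 0 / fact n) * r ^ n) \<longlongrightarrow> norm ((deriv ^^ n) f 0 / fact n)) (at_left 1)"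
      by (rule tendsto_eq_intros refl | simp)+
    show "\<forall>\<^sub>F r in at_left (1::real). norm ((deriv ^^ n) f 0 / fact n) * r ^ n \<le> B"
      using eventually_at_left_real[of 0 "1::real"] by (rule eventually_mono) (auto intro: le)
  qed simp
qed

text \<open>The Taylor expansion is taken weakly: the coefficients of the scalar functions
  <F(\<zeta>) x, y> are linear in x and conjugate linear in y by uniqueness of power series, are
  bounded by |x| |y|, and so define operators through Riesz representation.\<close>

lemma schur_class_imp_schur_coeffs:
  fixes H :: "'a::chilbert_space set" and K :: "'b::chilbert_space set"
  assumes F: "F \<in> schur_class H K" and H: "closed_csubspace H" and K: "closed_csubspace K"
  obtains C where "C \<in> schur_coeffs H K" "F = power_series_fun H C"
proof -
  note H' = closed_csubspaceD[OF H] and K' = closed_csubspaceD[OF K]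
  have Fop: "F \<zeta> \<in> operators H K" if "\<zeta> \<in> ball 0 1" for \<zeta>
    using F that by (auto simp: schur_class_def)
  have contr: "norm (F \<zeta> x) \<le> norm x" if z: "\<zeta> \<in> ball 0 1" and x: "x \<in> H" for \<zeta> x
  proof -
    obtain M where M: "\<forall>x\<in>H. norm (F \<zeta> x) \<le> M * norm x"
      using Fop[OF z] by (auto simp: operators_def)
    have "norm (F \<zeta> x) \<le> opnorm_on H (F \<zeta>) * norm x"
      by (rule norm_le_opnorm_on[OF H M[rule_format] operatorsD(3)[OF Fop[OF z] H] x])
    also have "\<dots> \<le> 1 * norm x"
      by (rule mult_right_mono) (use F z in \<open>auto simp: schur_class_def\<close>)
    finally show ?thesis by simp
  qed
  define a where "a n x y = (deriv ^^ n) (\<lambda>\<zeta>. cinner (F \<zeta> x) y) 0 / fact n" for n x y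
  have a: "(\<lambda>n. a n x y * \<zeta> ^ n) sums cinner (F \<zeta> x) y" if "x \<in> H" "\<zeta> \<in> ball 0 1" for x y \<zeta>
    using holomorphic_power_series[OF schur_class_scalar_holomorphic[OF F H that(1)] that(2), of y]
    by (simp add: a_def)
  have a_le: "norm (a n x y) \<le> norm x * norm y" if "x \<in> H" for n x y
    unfolding a_def
  proof (rule bounded_holomorphic_coeff[OF schur_class_scalar_holomorphic[OF F H that]])
    fix \<zeta> :: complex assume "\<zeta> \<in> ball 0 1"
    then show "norm (cinner (F \<zeta> x) y) \<le> norm x * norm y"
      using order_trans[OF norm_cinner_le mult_right_mono[OF contr[OF _ that] norm_ge_zero]] by blast
  qed
  have a_unique: "a n x y = b n" if x: "x \<in> H" and b: "\<And>\<zeta>. \<zeta> \<in> ball 0 1 \<Longrightarrow> (\<lambda>n. b n * \<zeta> ^ n) sums cinner (F \<zeta> x) y" for b n x y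
  proof -
    have "a n x y - b n = 0"
    proof (rule scalar_power_series_zero[of "\<lambda>n. a n x y - b n"])
      fix \<zeta> :: complex assume z: "\<zeta> \<in> ball 0 1"
      show "(\<lambda>n. (a n x y - b n) * \<zeta> ^ n) sums 0"
        using sums_diff[OF a[OF x z, of y] b[OF z]] by (simp add: algebra_simps)
    qed
    then show ?thesis by simp
  qed
  have a_add_right: "a n x (y + y') = a n x y + a n x y'" if "x \<in> H" for n x y y'
  proof (rule a_unique[OF that])
    fix \<zeta> :: complex assume z: "\<zeta> \<in> ball 0 1"
    show "(\<lambda>n. (a n x y + a n x y') * \<zeta> ^ n) sums cinner (F \<zeta> x) (y + y')"
      using sums_add[OF a[OF that z, of y] a[OF that z, of y']] by (simp add: cinner_add_right distrib_right)
  qed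
  have a_scale_right: "a n x (c *\<^sub>C y) = cnj c * a n x y" if "x \<in> H" for n x c y
    by (rule a_unique[OF that]) (use sums_mult[OF a[OF that]] in \<open>simp add: cinner_scaleC_right algebra_simps\<close>)
  have a_add_left: "a n (x + x') y = a n x y + a n x' y" if "x \<in> H" "x' \<in> H" for n x x' y
  proof (rule a_unique[OF H'(3)[OF that]])
    fix \<zeta> :: complex assume z: "\<zeta> \<in> ball 0 1"
    show "(\<lambda>n. (a n x y + a n x' y) * \<zeta> ^ n) sums cinner (F \<zeta> (x + x')) y"
      using sums_add[OF a[OF that(1) z, of y] a[OF that(2) z, of y]] operatorsD(2)[OF Fop[OF z] H that]
      by (simp add: cinner_add_left distrib_right)
  qed
  have a_scale_left: "a n (c *\<^sub>C x) y = c * a n x y" if "x \<in> H" for n x c y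
    by (rule a_unique[OF H'(4)[OF that]])
      (use sums_mult[OF a[OF that]] operatorsD(3)[OF Fop H that] in \<open>simp add: cinner_scaleC_left algebra_simps\<close>)
  have "\<exists>v. \<forall>y. Re (a n x y) = inner v y" if x: "x \<in> H" for n x
  proof (rule riesz_representation, rule bounded_linear_intro[where K = "norm x"])
    show "Re (a n x (y + y')) = Re (a n x y) + Re (a n x y')" for y y' by (simp add: a_add_right[OF x])
    show "Re (a n x (r *\<^sub>R y)) = r *\<^sub>R Re (a n x y)" for r y
      by (simp add: scaleR_scaleC[of r y] a_scale_right[OF x])
    show "norm (Re (a n x y)) \<le> norm y * norm x" for y
      using a_le[OF x, of n y] abs_Re_le_cmod[of "a n x y"] by (simp add: mult.commute)
  qed
  then have "\<exists>c. \<forall>n x. x \<in> H \<longrightarrow> (\<forall>y. Re (a n x y) = inner (c n x) y)"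
    by (intro choice allI) blast
  then obtain c where c: "\<And>n x y. x \<in> H \<Longrightarrow> Re (a n x y) = inner (c n x) y" by blast
  have ca: "cinner (c n x) y = a n x y" if x: "x \<in> H" for n x y
    by (simp add: complex_eq_iff cinner_eq_Complex c[OF x, symmetric] a_scale_right[OF x])
  \<comment> \<open>The component d of the coefficient orthogonal to K vanishes, since <F(\<zeta>)
    x, d> is identically zero.\<close>
  have cK: "c n x \<in> K" if x: "x \<in> H" for n x
  proof -
    obtain p where p: "p \<in> K" "\<And>s. s \<in> K \<Longrightarrow> inner (c n x - p) s = 0"
      using orthogonal_projection_exists[OF K'(1,5)] by blast
    define d where "d = c n x - p"
    have "a n x d = 0"
    proof (rule a_unique[OF x])
      fix \<zeta> :: complex assume z: "\<zeta> \<in> ball 0 1"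
      have FK: "F \<zeta> x \<in> K" by (rule operatorsD(1)[OF Fop[OF z] H x])
      have "cinner d (F \<zeta> x) = 0"
        using p(2)[OF FK] p(2)[OF K'(4)[OF FK]] by (simp add: cinner_eq_Complex d_def complex_eq_iff)
      then have "cinner (F \<zeta> x) d = 0" by (metis cinner_commute complex_cnj_zero)
      then show "(\<lambda>n. 0 * \<zeta> ^ n) sums cinner (F \<zeta> x) d" by simp
    qed
    then have "inner (c n x) d = 0" using c[OF x, of n d] by simp
    moreover have "inner p d = 0" using p(2)[OF p(1)] by (simp add: d_def inner_commute)
    ultimately have "inner d d = 0" by (simp add: d_def inner_diff_left)
    then show ?thesis using p(1) by (simp add: d_def)
  qed
  define C where "C n = restrict (c n) H" for n
  have inner_eq: "u = v" if "\<And>y. cinner u y = cinner v y" for u v :: 'b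
    by (rule eq_if_inner_eq) (simp add: inner_eq_Re_cinner that)
  have c_le: "norm (c n x) \<le> norm x" if x: "x \<in> H" for n x
  proof (cases "c n x = 0")
    case False
    have "norm (c n x) * norm (c n x) = Re (a n x (c n x))"
      by (simp add: c[OF x] power2_norm_eq_inner[symmetric] power2_eq_square)
    also have "\<dots> \<le> norm x * norm (c n x)"
      using a_le[OF x, of n "c n x"] complex_Re_le_cmod[of "a n x (c n x)"] by linarith
    finally show ?thesis using False by simp
  qed simp
  interpret bounded_coeffs H K C
  proof
    fix n
    have "c n (x + y) = c n x + c n y" if "x \<in> H" "y \<in> H" for x y
      by (rule inner_eq) (simp add: cinner_add_left ca that H' a_add_left)
    moreover have "c n (k *\<^sub>C x) = k *\<^sub>C c n x" if "x \<in> H" for k x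
      by (rule inner_eq) (simp add: cinner_scaleC_left ca that H' a_scale_left)
    moreover have "norm (c n x) \<le> 1 * norm x" if "x \<in> H" for x using c_le[OF that] by simp
    ultimately show "C n \<in> operators H K"
      unfolding operators_def C_def using H'(3,4) cK by (auto intro!: exI[of _ 1])
    show "norm (C n x) \<le> norm x" if "x \<in> H" for x using c_le[OF that] that by (simp add: C_def)
  qed (rule H K)+
  have FF: "power_series_fun H C \<zeta> x = F \<zeta> x" if z: "\<zeta> \<in> ball 0 1" and x: "x \<in> H" for \<zeta> x
  proof (rule inner_eq)
    fix y
    have "(\<lambda>n. a n x y * \<zeta> ^ n) sums cinner (power_series_fun H C \<zeta> x) y"
      using bounded_linear.sums[OF bounded_linear_cinner_left F_sums[OF z x], of y]
      by (simp add: cinner_scaleC_left C_def x ca mult.commute)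
    then show "cinner (power_series_fun H C \<zeta> x) y = cinner (F \<zeta> x) y"
      using sums_unique2 a[OF x z] by blast
  qed
  have "F = power_series_fun H C"
  proof
    fix \<zeta>
    show "F \<zeta> = power_series_fun H C \<zeta>"
    proof (cases "\<zeta> \<in> ball 0 1")
      case True
      have "F \<zeta> x = power_series_fun H C \<zeta> x" if "x \<notin> H" for x
        using Fop[OF True] F_operator[OF True] that by (auto simp: operators_def PiE_def extensional_def)
      then show ?thesis using FF[OF True] by fastforce
    next
      case False
      then show ?thesis using F by (auto simp: schur_class_def power_series_fun_def PiE_def extensional_def)
    qed
  qed
  moreover have "C \<in> schur_coeffs H K"
    by (rule contraction_imp_schur_coeffs) (use FF contr in auto)
  ultimately show ?thesis using that by blast
qed

section \<open>The feedback loop\<close>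

text \<open>
  \<open>feedback G (u, x) n\<close> is the output at time \<open>n\<close> of the system with transfer function \<open>G\<close> when the
  initial input is \<open>(u, x)\<close> and from then on the second output is fed back with delay one.
\<close>

fun feedback :: "(nat \<Rightarrow> 'u::comm_monoid_add \<times> 'z::comm_monoid_add \<Rightarrow> 'y::comm_monoid_add \<times> 'z) \<Rightarrow> 'u \<times> 'z \<Rightarrow> nat \<Rightarrow> 'y \<times> 'z" where
  "feedback G p n = G n p + (\<Sum>k<n. G (n - Suc k) (0, snd (feedback G p k)))"

declare feedback.simps [simp del]

text \<open>The signal entering G in the loop: the initial input, then the state returned from the
  previous step. As a coefficient sequence it can be superposed by \<open>conv\<close>.\<close>

definition loop_input :: "(nat \<Rightarrow> 'u::comm_monoid_add \<times> 'z::comm_monoid_add \<Rightarrow> 'y::comm_monoid_add \<times> 'z) \<Rightarrow> nat \<Rightarrow> 'u \<times> 'z \<Rightarrow> 'u \<times> 'z" where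
  "loop_input G n p = (case n of 0 \<Rightarrow> p | Suc k \<Rightarrow> (0, snd (feedback G p k)))"

lemma conv_loop_input: "conv G (\<lambda>n. loop_input G n p) n = feedback G p n"
  unfolding conv_def feedback.simps[of G p n]
  by (subst sum.atMost_shift) (simp add: loop_input_def)

lemma feedback_unique:
  assumes "\<And>n. r n = G n p + (\<Sum>k<n. G (n - Suc k) (0, snd (r k)))"
  shows "r n = feedback G p n"
proof (induction n rule: less_induct)
  case (less n)
  then show ?case by (subst assms, subst feedback.simps) simp
qed

text \<open>X solves the loop equation at the frequency \<zeta>. As \<zeta> G_22(\<zeta>) is a
  strict contraction, I - \<zeta> G_22(\<zeta>) is injective, and this identifies X as the preimage;
  the caller supplies X as the generating function of the states.\<close>

lemma inv_into_feedback:
  assumes T: "T \<in> operators (UNIV \<times> Z0) (UNIV \<times> Z0)" and Z0: "closed_csubspace Z0"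
    and contr: "\<And>p. p \<in> UNIV \<times> Z0 \<Longrightarrow> norm (T p) \<le> norm p"
    and z: "norm \<zeta> < 1" and X: "X \<in> Z0" and eq: "T (u, \<zeta> *\<^sub>C X) = (Y, X)"
  shows "fst (T (u, 0)) + \<zeta> *\<^sub>C fst (T (0, inv_into Z0 (\<lambda>z. z - \<zeta> *\<^sub>C snd (T (0, z))) (snd (T (u, 0))))) = Y"
proof -
  note Z0' = closed_csubspaceD[OF Z0]
  have H: "closed_csubspace (UNIV \<times> Z0)" by (intro closed_csubspace_Times Z0 closed_csubspace_UNIV)
  note T' = operatorsD[OF T H]
  have split: "T (u, \<zeta> *\<^sub>C X) = T (u, 0) + \<zeta> *\<^sub>C T (0, X)"
    using T'(2)[of "(u, 0)" "(0, \<zeta> *\<^sub>C X)"] T'(3)[of "(0, X)" \<zeta>] X Z0' by (simp add: scaleC_Pair)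
  have "inj_on (\<lambda>z. z - \<zeta> *\<^sub>C snd (T (0, z))) Z0"
  proof (rule inj_onI)
    fix x y assume xy: "x \<in> Z0" "y \<in> Z0" and e: "x - \<zeta> *\<^sub>C snd (T (0, x)) = y - \<zeta> *\<^sub>C snd (T (0, y))"
    have d: "x - y \<in> Z0" by (rule Z0'(6)[OF xy])
    have "T (0, x - y) = T (0, x) - T (0, y)" using T'(5)[of "(0, x)" "(0, y)"] xy by simp
    moreover have "x - y = \<zeta> *\<^sub>C snd (T (0, x)) - \<zeta> *\<^sub>C snd (T (0, y))" using e by (simp add: algebra_simps)
    ultimately have "x - y = \<zeta> *\<^sub>C snd (T (0, x - y))" by (simp add: scaleC.diff_right)
    then have "norm (x - y) = norm \<zeta> * norm (snd (T (0, x - y)))" by (metis norm_scaleC)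
    also have "\<dots> \<le> norm \<zeta> * norm (x - y)"
      using contr[of "(0, x - y)"] norm_snd_le[of "snd (T (0, x - y))" "fst (T (0, x - y))"] d by (intro mult_left_mono) auto
    finally have "(1 - norm \<zeta>) * norm (x - y) \<le> 0" by (simp add: algebra_simps)
    then show "x = y" using z by (simp add: mult_le_0_iff)
  qed
  then have "inv_into Z0 (\<lambda>z. z - \<zeta> *\<^sub>C snd (T (0, z))) (snd (T (u, 0))) = X"
    by (rule inv_into_f_eq[OF _ X]) (use arg_cong[OF eq, of snd] in \<open>simp add: split algebra_simps\<close>)
  then show ?thesis using arg_cong[OF eq, of fst] by (simp add: split)
qed

locale feedback_loop =
  fixes Z0 :: "'z::chilbert_space set" and G :: "nat \<Rightarrow> 'u::chilbert_space \<times> 'z \<Rightarrow> 'y::chilbert_space \<times> 'z"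
  assumes Z0: "closed_csubspace Z0"
    and G: "G \<in> schur_coeffs (UNIV \<times> Z0) (UNIV \<times> Z0)"
begin

lemma H: "closed_csubspace (UNIV \<times> Z0 :: ('v::chilbert_space \<times> 'z) set)"
  by (intro closed_csubspace_Times Z0 closed_csubspace_UNIV)

lemmas Z0' = closed_csubspaceD[OF Z0]

lemma G_lin:
  "p \<in> UNIV \<times> Z0 \<Longrightarrow> G n p \<in> UNIV \<times> Z0"
  "p \<in> UNIV \<times> Z0 \<Longrightarrow> q \<in> UNIV \<times> Z0 \<Longrightarrow> G n (p + q) = G n p + G n q"
  "p \<in> UNIV \<times> Z0 \<Longrightarrow> G n (c *\<^sub>C p) = c *\<^sub>C G n p" "G n 0 = 0"
  "p \<in> UNIV \<times> Z0 \<Longrightarrow> q \<in> UNIV \<times> Z0 \<Longrightarrow> G n (p - q) = G n p - G n q"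
  "(\<And>i. i \<in> I \<Longrightarrow> f i \<in> UNIV \<times> Z0) \<Longrightarrow> G n (sum f I) = (\<Sum>i\<in>I. G n (f i))"
  by (rule operatorsD[OF schur_coeffsD(1)[OF G] H]; assumption?)+

lemma feedback_in: "p \<in> UNIV \<times> Z0 \<Longrightarrow> feedback G p n \<in> UNIV \<times> Z0"
proof (induction n rule: less_induct)
  case (less n)
  have "snd (feedback G p k) \<in> Z0" if "k < n" for k using less.IH[OF that less.prems] by auto
  then show ?case
    by (subst feedback.simps, intro closed_csubspaceD(3)[OF H] subspace_sum[OF closed_csubspaceD(5)[OF H]] G_lin(1) less.prems)
      auto
qed

lemma snd_feedback_in: "p \<in> UNIV \<times> Z0 \<Longrightarrow> snd (feedback G p n) \<in> Z0"
  using feedback_in[of p n] by auto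

lemma loop_input_in: "p \<in> UNIV \<times> Z0 \<Longrightarrow> loop_input G n p \<in> UNIV \<times> Z0"
  by (auto simp: loop_input_def snd_feedback_in split: nat.split)

lemma feedback_add:
  assumes "p \<in> UNIV \<times> Z0" "q \<in> UNIV \<times> Z0"
  shows "feedback G (p + q) n = feedback G p n + feedback G q n"
proof (rule feedback_unique[symmetric])
  fix n
  have "G m (0, snd (feedback G p k + feedback G q k)) = G m (0, snd (feedback G p k)) + G m (0, snd (feedback G q k))" for m k
    using G_lin(2)[of "(0, snd (feedback G p k))" "(0, snd (feedback G q k))" m] snd_feedback_in assms by simp
  then show "feedback G p n + feedback G q n = G n (p + q) + (\<Sum>k<n. G (n - Suc k) (0, snd (feedback G p k + feedback G q k)))"
    by (subst (1 2) feedback.simps) (simp add: G_lin(2) assms sum.distrib algebra_simps)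
qed

lemma feedback_scaleC:
  assumes "p \<in> UNIV \<times> Z0"
  shows "feedback G (c *\<^sub>C p) n = c *\<^sub>C feedback G p n"
proof (rule feedback_unique[symmetric])
  fix n
  have "G m (0, snd (c *\<^sub>C feedback G p k)) = c *\<^sub>C G m (0, snd (feedback G p k))" for m k
    using G_lin(3)[of "(0, snd (feedback G p k))" m c] snd_feedback_in assms by (simp add: scaleC_Pair)
  then show "c *\<^sub>C feedback G p n = G n (c *\<^sub>C p) + (\<Sum>k<n. G (n - Suc k) (0, snd (c *\<^sub>C feedback G p k)))"
    by (subst (1) feedback.simps) (simp add: G_lin(3) assms scaleC.sum_right scaleC_add_right)
qed

text \<open>Associativity of convolution, by reindexing the triangle of time pairs: the closed loop
  is G driven by its total input.\<close>

lemma conv_feedback: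
  assumes w: "\<And>k. w k \<in> UNIV \<times> Z0"
  shows "conv G (conv (loop_input G) w) n = conv (\<lambda>n p. feedback G p n) w n"
proof -
  have "conv G (conv (loop_input G) w) n = (\<Sum>k\<le>n. \<Sum>j\<le>k. G (n - (j + (k - j))) (loop_input G (k - j) (w j)))"
    by (simp add: conv_def G_lin(6) loop_input_in w)
  also have "\<dots> = (\<Sum>(j,i)\<in>{(j,i). j + i \<le> n}. G (n - (j + i)) (loop_input G i (w j)))"
    by (rule sum.triangle_reindex_eq[symmetric])
  also have "{(j,i). j + i \<le> n} = (SIGMA j:{..n}. {..n - j})" by auto
  also have "(\<Sum>(j,i)\<in>(SIGMA j:{..n}. {..n - j}). G (n - (j + i)) (loop_input G i (w j)))
      = (\<Sum>j\<le>n. \<Sum>i\<le>n - j. G (n - (j + i)) (loop_input G i (w j)))"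
    by (rule sum.Sigma[symmetric]) auto
  also have "\<dots> = conv (\<lambda>n p. feedback G p n) w n"
    unfolding conv_def[of "\<lambda>n p. feedback G p n"] conv_loop_input[symmetric] by (simp add: conv_def)
  finally show ?thesis .
qed

lemma conv_loop_input_Suc:
  "conv (loop_input G) w (Suc n) = w (Suc n) + (0, snd (conv (\<lambda>n p. feedback G p n) w n))"
proof -
  have "(\<Sum>k\<le>n. loop_input G (Suc n - k) (w k)) = (\<Sum>k\<le>n. (0, snd (feedback G (w k) (n - k))))"
    by (intro sum.cong refl) (simp add: loop_input_def Suc_diff_le)
  also have "\<dots> = (0, snd (\<Sum>k\<le>n. feedback G (w k) (n - k)))"
    by (simp add: prod_eq_iff fst_sum snd_sum)
  finally show ?thesis by (simp add: conv_def loop_input_def add.commute)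
qed

text \<open>The contraction property is applied to the total input. There each state appears
  orthogonally to the external input, which after time 0 has no state component, so all states but
  the last cancel against the output side.\<close>

lemma feedback_energy:
  assumes w: "\<And>k. w k \<in> UNIV \<times> Z0" and w0: "\<And>k. snd (w (Suc k)) = 0"
  shows "(\<Sum>n\<le>N. (norm (fst (conv (\<lambda>n p. feedback G p n) w n)))\<^sup>2) + (norm (snd (conv (\<lambda>n p. feedback G p n) w N)))\<^sup>2
    \<le> (\<Sum>n\<le>N. (norm (w n))\<^sup>2)"
proof -
  let ?out = "conv (\<lambda>n p. feedback G p n) w" and ?v = "conv (loop_input G) w"
  have vH: "?v k \<in> UNIV \<times> Z0" for k
    unfolding conv_def by (intro subspace_sum closed_csubspaceD(5)[OF H] loop_input_in w)
  have "(\<Sum>n\<le>N. (norm (?out n))\<^sup>2) \<le> (\<Sum>n\<le>N. (norm (?v n))\<^sup>2)"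
    using schur_coeffsD(2)[OF G, of ?v N] vH by (simp add: conv_feedback w)
  moreover have "(\<Sum>n\<le>N. (norm (?v n))\<^sup>2) + (norm (snd (?out N)))\<^sup>2 = (\<Sum>n\<le>N. (norm (w n))\<^sup>2) + (\<Sum>n\<le>N. (norm (snd (?out n)))\<^sup>2)"
  proof (induction N)
    case 0
    have "?v 0 = w 0" by (simp add: conv_def loop_input_def)
    then show ?case by simp
  next
    case (Suc N)
    have "(norm (?v (Suc N)))\<^sup>2 = (norm (w (Suc N)))\<^sup>2 + (norm (snd (?out N)))\<^sup>2"
      unfolding conv_loop_input_Suc by (simp add: norm_prod_power2 w0)
    then show ?case using Suc by simp
  qed
  moreover have "(\<Sum>n\<le>N. (norm (?out n))\<^sup>2) = (\<Sum>n\<le>N. (norm (fst (?out n)))\<^sup>2) + (\<Sum>n\<le>N. (norm (snd (?out n)))\<^sup>2)"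
    by (simp add: norm_prod_power2 sum.distrib)
  ultimately show ?thesis by linarith
qed

lemma conv_feedback_impulse:
  assumes "\<And>k. w (Suc k) = 0"
  shows "conv (\<lambda>n p. feedback G p n) w n = feedback G (w 0) n"
proof -
  have 0: "feedback G 0 n = 0" for n using feedback_scaleC[of 0 0 n] Z0'(2) by (simp add: zero_prod_def)
  have "conv (\<lambda>n p. feedback G p n) w n = (\<Sum>k\<le>n. if k = 0 then feedback G (w 0) n else 0)"
    unfolding conv_def by (intro sum.cong refl) (use assms 0 in \<open>auto simp: gr0_conv_Suc\<close>)
  then show ?thesis by simp
qed

lemma norm_snd_feedback_le:
  assumes p: "p \<in> UNIV \<times> Z0"
  shows "norm (snd (feedback G p n)) \<le> norm p"
proof -
  define w where "w k = (if k = 0 then p else 0)" for k :: nat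
  have "(\<Sum>k\<le>n. (norm (w k))\<^sup>2) = (\<Sum>k\<le>n. if k = 0 then (norm p)\<^sup>2 else 0)"
    by (rule sum.cong) (auto simp: w_def)
  then have *: "(\<Sum>k\<le>n. (norm (w k))\<^sup>2) = (norm p)\<^sup>2" by simp
  have c: "conv (\<lambda>n p. feedback G p n) w n = feedback G p n"
    by (subst conv_feedback_impulse) (simp_all add: w_def)
  have "(norm (snd (conv (\<lambda>n p. feedback G p n) w n)))\<^sup>2 \<le> (\<Sum>k\<le>n. (norm (w k))\<^sup>2)"
  proof (rule order_trans[OF _ feedback_energy])
    show "w k \<in> UNIV \<times> Z0" for k using p Z0'(2) by (auto simp: w_def zero_prod_def)
    show "snd (w (Suc k)) = 0" for k by (simp add: w_def)
  qed (simp add: sum_nonneg)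
  then show ?thesis unfolding c * by (rule power2_le_imp_le) simp
qed

definition transfer :: "nat \<Rightarrow> 'u \<Rightarrow> 'y" where
  "transfer n u = fst (feedback G (u, 0) n)"

lemma conv_transfer: "conv transfer u n = fst (conv (\<lambda>n p. feedback G p n) (\<lambda>k. (u k, 0)) n)"
  by (simp add: conv_def transfer_def fst_sum)

lemma transfer_schur: "transfer \<in> schur_coeffs UNIV UNIV"
proof -
  have en: "(\<Sum>n\<le>N. (norm (conv transfer u n))\<^sup>2) \<le> (\<Sum>n\<le>N. (norm (u n))\<^sup>2)" for u N
  proof -
    have "(\<Sum>n\<le>N. (norm (conv transfer u n))\<^sup>2) + (norm (snd (conv (\<lambda>n p. feedback G p n) (\<lambda>k. (u k, 0)) N)))\<^sup>2
        \<le> (\<Sum>n\<le>N. (norm (u n, 0::'z))\<^sup>2)"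
      unfolding conv_transfer by (rule feedback_energy) (use Z0'(2) in auto)
    then show ?thesis by (simp add: norm_prod_power2) (smt (verit) zero_le_power2)
  qed
  have "transfer n \<in> operators UNIV UNIV" for n
  proof -
    have add: "transfer n (x + y) = transfer n x + transfer n y" for x y
      using feedback_add[of "(x, 0)" "(y, 0)" n] Z0'(2) by (simp add: transfer_def)
    have sc: "transfer n (c *\<^sub>C x) = c *\<^sub>C transfer n x" for c x
      using feedback_scaleC[of "(x, 0)" c n] Z0'(2) by (simp add: transfer_def scaleC_Pair)
    have "norm (transfer n x) \<le> 1 * norm x" for x
    proof -
      define u where "u k = (if k = 0 then x else 0)" for k :: nat
      have "transfer m 0 = 0" for m using feedback_scaleC[of 0 0 m] Z0'(2) by (simp add: transfer_def zero_prod_def)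
      then have "conv transfer u n = (\<Sum>k\<le>n. if k = 0 then transfer n x else 0)"
        unfolding conv_def by (intro sum.cong) (auto simp: u_def)
      then have c: "conv transfer u n = transfer n x" by simp
      have "(\<Sum>k\<le>n. (norm (u k))\<^sup>2) = (\<Sum>k\<le>n. if k = 0 then (norm x)\<^sup>2 else 0)"
        by (rule sum.cong) (auto simp: u_def)
      then have s: "(\<Sum>k\<le>n. (norm (u k))\<^sup>2) = (norm x)\<^sup>2" by simp
      have "(norm (conv transfer u n))\<^sup>2 \<le> (\<Sum>k\<le>n. (norm (conv transfer u k))\<^sup>2)"
        by (rule member_le_sum) auto
      also have "\<dots> \<le> (norm x)\<^sup>2" using en[of u n] s by simp
      finally show ?thesis unfolding c using power2_le_imp_le by fastforce
    qed
    then show ?thesis using add sc unfolding operators_def by (auto intro!: exI[of _ 1])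
  qed
  then show ?thesis using en by (auto simp: schur_coeffs_def)
qed

text \<open>With X the generating function of the states, the total input has generating function
  (u, \<zeta> X), and G(\<zeta>) sends it to the generating function of outputs and states, whose
  second entry is X again.\<close>

lemma redheffer_power_series:
  "redheffer Z0 (power_series_fun (UNIV \<times> Z0) G) = power_series_fun UNIV transfer"
proof
  fix \<zeta>
  let ?H = "UNIV \<times> Z0 :: ('u \<times> 'z) set" and ?H' = "UNIV \<times> Z0 :: ('y \<times> 'z) set"
  interpret g: bounded_coeffs ?H ?H' G by (rule bounded_coeffs_schur[OF G H H])
  interpret t: bounded_coeffs "UNIV :: 'u set" "UNIV :: 'y set" transfer
    by (rule bounded_coeffs_schur[OF transfer_schur]) simp_all
  show "redheffer Z0 g.F \<zeta> = t.F \<zeta>"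
  proof (cases "\<zeta> \<in> ball 0 1")
    case z: True
    have "redheffer Z0 g.F \<zeta> u = t.F \<zeta> u" for u
    proof -
      let ?x = "\<lambda>n. snd (feedback G (u, 0) n)"
      have uH: "(u, 0) \<in> ?H" using Z0'(2) by simp
      have xn: "norm (?x n) \<le> norm u" for n using norm_snd_feedback_le[OF uH, of n] by simp
      have "summable (\<lambda>n. norm (\<zeta> ^ n *\<^sub>C ?x n))"
      proof (rule summable_comparison_test')
        show "summable (\<lambda>n. norm \<zeta> ^ n * norm u)"
          using z by (intro summable_mult2 summable_geometric) simp
        show "norm (norm (\<zeta> ^ n *\<^sub>C ?x n)) \<le> norm \<zeta> ^ n * norm u" for n
          using xn[of n] by (simp add: norm_scaleC norm_power mult_left_mono)
      qed
      from summable_sums[OF summable_norm_cancel[OF this]]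
      obtain X where X: "(\<lambda>n. \<zeta> ^ n *\<^sub>C ?x n) sums X" by (rule that)
      have XZ: "X \<in> Z0"
      proof (rule closed_sequentially[OF Z0'(1)])
        show "(\<Sum>n<m. \<zeta> ^ n *\<^sub>C ?x n) \<in> Z0" for m
          by (intro subspace_sum Z0' snd_feedback_in uH)
        show "(\<lambda>m. \<Sum>n<m. \<zeta> ^ n *\<^sub>C ?x n) \<longlonglongrightarrow> X" using X by (simp add: sums_def)
      qed
      let ?v = "\<lambda>n. loop_input G n (u, 0)"
      have "bounded_linear (\<lambda>x::'z. \<zeta> *\<^sub>C (0::'u, x))"
        by (rule bounded_linear_compose[OF scaleC.bounded_linear_right bounded_linear_Pair[OF bounded_linear_zero bounded_linear_ident]])
      from bounded_linear.sums[OF this X]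
      have "(\<lambda>n. \<zeta> *\<^sub>C ((0::'u), \<zeta> ^ n *\<^sub>C ?x n)) sums (\<zeta> *\<^sub>C (0, X))" .
      then have "(\<lambda>n. \<zeta> ^ Suc n *\<^sub>C ?v (Suc n)) sums (\<zeta> *\<^sub>C (0, X))"
        unfolding loop_input_def by (simp only: scaleC_Pair scaleC.zero_right scaleC_scaleC power_Suc nat.case)
      from sums_Suc[OF this] have v: "(\<lambda>n. \<zeta> ^ n *\<^sub>C ?v n) sums (u, \<zeta> *\<^sub>C X)"
        by (simp add: loop_input_def scaleC_Pair)
      have "norm (?v n) \<le> norm u" for n
        using xn by (auto simp: loop_input_def norm_prod_def split: nat.split)
      from g.F_conv_sums[OF z loop_input_in[OF uH] this v] have
        fb: "(\<lambda>n. \<zeta> ^ n *\<^sub>C feedback G (u, 0) n) sums g.F \<zeta> (u, \<zeta> *\<^sub>C X)"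
        using XZ Z0'(4) by (simp add: conv_loop_input)
      have "snd (g.F \<zeta> (u, \<zeta> *\<^sub>C X)) = X"
        using bounded_linear.sums[OF bounded_linear_snd fb] X sums_unique2 by (simp, blast)
      moreover have "fst (g.F \<zeta> (u, \<zeta> *\<^sub>C X)) = t.F \<zeta> u"
        using bounded_linear.sums[OF bounded_linear_fst fb] t.F_sums[OF z, of u] sums_unique2
        by (simp add: transfer_def, blast)
      ultimately have eq: "g.F \<zeta> (u, \<zeta> *\<^sub>C X) = (t.F \<zeta> u, X)" by (simp add: prod_eq_iff)
      have "fst (g.F \<zeta> (u, 0)) + \<zeta> *\<^sub>C fst (g.F \<zeta> (0, inv_into Z0 (\<lambda>z. z - \<zeta> *\<^sub>C snd (g.F \<zeta> (0, z))) (snd (g.F \<zeta> (u, 0))))) = t.F \<zeta> u"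
        using z by (intro inv_into_feedback[OF g.F_operator[OF z] Z0 schur_coeffs_contraction[OF G H H z] _ XZ eq]) auto
      then show ?thesis using z by (simp add: redheffer_def Let_def)
    qed
    then show ?thesis by blast
  next
    case False
    then show ?thesis by (auto simp: redheffer_def power_series_fun_def)
  qed
qed

end

lemma taylor_coeff_power_series:
  fixes C :: "nat \<Rightarrow> 'u::chilbert_space \<Rightarrow> 'y::chilbert_space"
  assumes C: "C \<in> schur_coeffs UNIV UNIV"
  shows "taylor_coeff (power_series_fun UNIV C) = C"
proof -
  interpret bounded_coeffs UNIV UNIV C by (rule bounded_coeffs_schur[OF C]) simp_all
  show ?thesis
    unfolding taylor_coeff_def
  proof (rule the_equality)
    show "(\<forall>n. C n \<in> operators UNIV UNIV) \<and> (\<forall>\<zeta>\<in>ball 0 1. \<forall>u. (\<lambda>n. \<zeta> ^ n *\<^sub>C C n u) sums F \<zeta> u)"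
      using C F_sums schur_coeffsD(1) by blast
  next
    fix D assume D: "(\<forall>n. D n \<in> operators UNIV UNIV) \<and> (\<forall>\<zeta>\<in>ball 0 1. \<forall>u. (\<lambda>n. \<zeta> ^ n *\<^sub>C D n u) sums F \<zeta> u)"
    show "D = C"
    proof (intro ext)
      fix n u
      show "D n u = C n u"
        by (rule power_series_unique[where f = "\<lambda>\<zeta>. F \<zeta> u"]) (use D F_sums in auto)
    qed
  qed
qed

section \<open>Interpolation data\<close>

locale LTONP =
  fixes W :: "'y::chilbert_space ell2 \<Rightarrow> 'z::chilbert_space" and W' :: "'u::chilbert_space ell2 \<Rightarrow> 'z" and Z :: "'z \<Rightarrow> 'z"
  assumes data: "LTONP_data W W' Z"
    and stable: "pointwise_stable (cadjoint Z)"
    and pick_nonneg: "nonneg_operator (pick_operator W W')"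
begin

abbreviation "W_adj \<equiv> cadjoint W"
abbreviation "W'_adj \<equiv> cadjoint W'"
abbreviation "Z_adj \<equiv> cadjoint Z"
abbreviation "L \<equiv> op_sqrt (pick_operator W W')"
abbreviation "Z0 \<equiv> pick_space W W'"

text \<open>Explicit formulas for the adjoints of K_1 and K_2, as \<open>cadjoint_K1\<close> and
  \<open>cadjoint_K2\<close> confirm.\<close>

definition K1_adj :: "'z \<Rightarrow> 'u \<times> 'z" where "K1_adj z = (Rep_ell2 (W'_adj z) 0, L z)"
definition K2_adj :: "'z \<Rightarrow> 'y \<times> 'z" where "K2_adj z = (Rep_ell2 (W_adj z) 0, L (Z_adj z))"

lemma W_op: "W \<in> operators UNIV UNIV" and W'_op: "W' \<in> operators UNIV UNIV" and Z_op: "Z \<in> operators UNIV UNIV"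
  and ZW: "Z (W h) = W (shift h)" and ZW': "Z (W' g) = W' (shift g)"
  using data by (auto simp: LTONP_data_def fun_eq_iff)

lemmas adj_op = cadjoint_operators[OF W_op] cadjoint_operators[OF W'_op] cadjoint_operators[OF Z_op]
lemmas inner_adj = inner_cadjoint[OF W_op] inner_cadjoint[OF W'_op] inner_cadjoint[OF Z_op]

lemma W_adj_Z_adj: "W_adj (Z_adj z) = bshift (W_adj z)"
proof (rule eq_if_inner_eq)
  fix h
  have "inner h (W_adj (Z_adj z)) = inner h (bshift (W_adj z))"
    unfolding inner_adj[symmetric] inner_shift[symmetric] ZW ..
  then show "inner (W_adj (Z_adj z)) h = inner (bshift (W_adj z)) h" by (metis inner_commute)
qed

lemma W'_adj_Z_adj: "W'_adj (Z_adj z) = bshift (W'_adj z)"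
proof (rule eq_if_inner_eq)
  fix h
  have "inner h (W'_adj (Z_adj z)) = inner h (bshift (W'_adj z))"
    unfolding inner_adj[symmetric] inner_shift[symmetric] ZW' ..
  then show "inner (W'_adj (Z_adj z)) h = inner (bshift (W'_adj z)) h" by (metis inner_commute)
qed

lemma Rep_W_adj: "Rep_ell2 (W_adj z) n = Rep_ell2 (W_adj ((Z_adj ^^ n) z)) 0"
proof (induction n arbitrary: z)
  case (Suc n)
  have "Rep_ell2 (W_adj z) (Suc n) = Rep_ell2 (W_adj (Z_adj z)) n"
    by (simp add: W_adj_Z_adj bshift.rep_eq)
  then show ?case by (simp add: Suc funpow_swap1)
qed simp

lemma Rep_W'_adj: "Rep_ell2 (W'_adj z) n = Rep_ell2 (W'_adj ((Z_adj ^^ n) z)) 0"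
proof (induction n arbitrary: z)
  case (Suc n)
  have "Rep_ell2 (W'_adj z) (Suc n) = Rep_ell2 (W'_adj (Z_adj z)) n"
    by (simp add: W'_adj_Z_adj bshift.rep_eq)
  then show ?case by (simp add: Suc funpow_swap1)
qed simp

section \<open>The square root of the Pick operator and its range\<close>

lemmas L_nonneg = op_sqrt(1)[OF pick_nonneg]
lemmas L_L = op_sqrt(2)[OF pick_nonneg]
lemmas L_op = nonneg_operatorD(1)[OF L_nonneg]
lemmas L_sa = nonneg_operatorD(3)[OF L_nonneg]

lemma norm_L: "(norm (L z))\<^sup>2 = (norm (W_adj z))\<^sup>2 - (norm (W'_adj z))\<^sup>2"
proof -
  have "inner (L z) (L z) = inner (L (L z)) z" by (rule L_sa[symmetric])
  also have "\<dots> = inner (W_adj z) (W_adj z) - inner (W'_adj z) (W'_adj z)"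
    by (simp add: L_L pick_operator_def inner_diff_left inner_adj)
  finally show ?thesis by (simp add: power2_norm_eq_inner)
qed

lemma Z0: "closed_csubspace Z0"
  unfolding pick_space_def by (rule closed_csubspace_closure_range[OF nonneg_operatorD(1)[OF pick_nonneg]])

text \<open>Since \<Lambda> = L^2, a vector in the kernel of L is orthogonal to the range of
  \<Lambda>.\<close>

lemma L_zero_imp:
  assumes "d \<in> Z0" "L d = 0"
  shows "d = 0"
proof -
  have "range (pick_operator W W') \<subseteq> {v. inner d v = 0}"
    using assms(2) by (auto simp: L_L[symmetric] L_sa[symmetric] bounded_linear.linear[OF operators_bounded_linear[OF L_op]] linear_0)
  moreover have "closed {v. inner d v = 0}" by (intro closed_Collect_eq continuous_intros)
  ultimately have "Z0 \<subseteq> {v. inner d v = 0}" unfolding pick_space_def by (rule closure_minimal)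
  then show ?thesis using assms(1) by auto
qed

text \<open>The component d of L z orthogonal to Z_o satisfies L L d = 0, hence L d = 0, so it is
  orthogonal to L z and therefore to itself.\<close>

lemma L_in_Z0: "L z \<in> Z0"
proof -
  obtain p where p: "p \<in> Z0" "\<And>s. s \<in> Z0 \<Longrightarrow> inner (L z - p) s = 0"
    using orthogonal_projection_exists[OF closed_csubspaceD(1,5)[OF Z0]] by blast
  define d where "d = L z - p"
  have "inner (L (L d)) v = 0" for v
    using p(2)[of "pick_operator W W' v"] closure_subset[of "range (pick_operator W W')"]
    by (auto simp: d_def[symmetric] L_sa L_L[symmetric] pick_space_def)
  then have "inner (L d) (L d) = 0" using L_sa[of "L d" d] by (simp add: inner_commute)
  then have "inner d (L z) = 0" using L_sa[of d z] by simp
  moreover have "inner d p = 0" using p by (simp add: d_def)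
  ultimately have "inner d d = 0" by (subst (2) d_def) (simp add: inner_diff_right)
  then show ?thesis using p(1) by (simp add: d_def)
qed

lemma Z0_closure_range_L: "Z0 = closure (range L)"
proof
  show "closure (range L) \<subseteq> Z0"
    by (rule closure_minimal) (use L_in_Z0 closed_csubspaceD(1)[OF Z0] in auto)
  have "range (pick_operator W W') \<subseteq> range L" by (auto simp: L_L[symmetric])
  then show "Z0 \<subseteq> closure (range L)" unfolding pick_space_def by (rule closure_mono)
qed

section \<open>The operators K_1, K_2 and the unitary operator determined by the data\<close>

abbreviation HU :: "('u \<times> 'z) set" where "HU \<equiv> UNIV \<times> Z0"
abbreviation HY :: "('y \<times> 'z) set" where "HY \<equiv> UNIV \<times> Z0"

lemma HU: "closed_csubspace HU" and HY: "closed_csubspace HY"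
  by (intro closed_csubspace_Times Z0 closed_csubspace_UNIV)+

lemma K1_adj_in: "K1_adj z \<in> HU" and K2_adj_in: "K2_adj z \<in> HY"
  by (simp_all add: K1_adj_def K2_adj_def L_in_Z0)

lemma range_K_subset: "range K1_adj \<subseteq> HU" "range K2_adj \<subseteq> HY"
  by (rule image_subsetI, rule K1_adj_in) (rule image_subsetI, rule K2_adj_in)

lemma K1_adj_op: "K1_adj \<in> operators UNIV UNIV" and K2_adj_op: "K2_adj \<in> operators UNIV UNIV"
  unfolding K1_adj_def[abs_def] K2_adj_def[abs_def]
  by (intro operators_Pair operators_compose[OF Rep_ell2_operator] operators_compose[OF L_op] adj_op L_op)+

lemma K1_op: "K1_op W W' \<in> operators UNIV UNIV"
  unfolding K1_op_def case_prod_beta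
  by (intro operators_add operators_compose[OF W'_op] operators_compose[OF embed0_operator]
      operators_compose[OF L_op] operators_simple)

lemma K2_op: "K2_op W W' Z \<in> operators UNIV UNIV"
  unfolding K2_op_def case_prod_beta
  by (intro operators_add operators_compose[OF W_op] operators_compose[OF embed0_operator]
      operators_compose[OF Z_op] operators_compose[OF L_op] operators_simple)

lemma inner_K1: "inner (K1_op W W' p) z = inner p (K1_adj z)"
  by (simp add: K1_op_def K1_adj_def case_prod_beta inner_prod_def inner_add_left inner_adj inner_embed0 L_sa)

lemma inner_K2: "inner (K2_op W W' Z p) z = inner p (K2_adj z)"
  by (simp add: K2_op_def K2_adj_def case_prod_beta inner_prod_def inner_add_left inner_adj inner_embed0 L_sa)

lemma cadjoint_K1: "cadjoint (K1_op W W') = K1_adj"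
  by (rule cadjoint_eqI[OF K1_op K1_adj_op inner_K1])

lemma cadjoint_K2: "cadjoint (K2_op W W' Z) = K2_adj"
  by (rule cadjoint_eqI[OF K2_op K2_adj_op inner_K2])

text \<open>Both squares equal |W^* z|^2 minus the squared norm of the backward shift of W'^* z.
  This is K_1 K_1^* = K_2 K_2^* in the form that produces \<omega>.\<close>

lemma norm_K: "norm (K1_adj z) = norm (K2_adj z)"
proof -
  have "(norm (K1_adj z))\<^sup>2 = (norm (K2_adj z))\<^sup>2"
    using norm_bshift[of "W_adj z"] norm_bshift[of "W'_adj z"]
    by (simp add: K1_adj_def K2_adj_def norm_prod_power2 norm_L W_adj_Z_adj W'_adj_Z_adj)
  then show ?thesis by (simp add: power2_eq_iff_nonneg)
qed

lemma F_space: "closed_csubspace (F_space W W')" "F_space W W' = closure (range K1_adj)" "F_space W W' \<subseteq> HU"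
proof -
  show *: "F_space W W' = closure (range K1_adj)" by (simp add: F_space_def cadjoint_K1)
  show "closed_csubspace (F_space W W')" unfolding * by (rule closed_csubspace_closure_range[OF K1_adj_op])
  show "F_space W W' \<subseteq> HU"
    unfolding * by (rule closure_minimal[OF range_K_subset(1) closed_csubspaceD(1)[OF HU]])
qed

text \<open>C is the partial isometry taking K_1^* z to K_2^* z, defined on the whole space. The
  partial isometry D in the opposite direction inverts it on the closed ranges, which gives
  surjectivity, and isometry because both are contractions.\<close>

lemma omega_eq:
  obtains C where "C \<in> operators UNIV UNIV" "\<And>x. norm (C x) \<le> norm x" "\<And>z. C (K1_adj z) = K2_adj z"
    "\<And>x. C x \<in> HY" "omega W W' Z = restrict C (F_space W W')"
proof -
  obtain C where C: "C \<in> operators UNIV UNIV" "\<And>x. norm (C x) \<le> norm x" "\<And>z. C (K1_adj z) = K2_adj z"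
    "\<And>x. C x \<in> closure (range K2_adj)"
    by (rule contraction_exists[OF K1_adj_op K2_adj_op norm_K]) (rule that; assumption)
  obtain D where D: "D \<in> operators UNIV UNIV" "\<And>x. norm (D x) \<le> norm x" "\<And>z. D (K2_adj z) = K1_adj z"
    "\<And>x. D x \<in> closure (range K1_adj)"
    by (rule contraction_exists[OF K2_adj_op K1_adj_op norm_K[symmetric]]) (rule that; assumption)
  have DC: "D (C x) = x" if "x \<in> closure (range K1_adj)" for x
    using operators_eq_on_closure[OF operators_compose[OF D(1) C(1)] operators_simple(1) closed_csubspace_UNIV closed_csubspace_UNIV _ _ _ that]
    by (simp add: C(3) D(3))
  have CD: "C (D y) = y" if "y \<in> closure (range K2_adj)" for y
    using operators_eq_on_closure[OF operators_compose[OF C(1) D(1)] operators_simple(1) closed_csubspace_UNIV closed_csubspace_UNIV _ _ _ that]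
    by (simp add: C(3) D(3))
  have F': "F'_space W W' Z = closure (range K2_adj)" by (simp add: F'_space_def cadjoint_K2)
  let ?F = "F_space W W'" and ?\<omega> = "restrict C (F_space W W')"
  have "omega W W' Z = ?\<omega>"
    unfolding omega_def
  proof (rule the_equality)
    have img: "?\<omega> ` ?F = F'_space W W' Z"
    proof
      show "?\<omega> ` ?F \<subseteq> F'_space W W' Z" using C(4) by (auto simp: F')
      show "F'_space W W' Z \<subseteq> ?\<omega> ` ?F"
      proof
        fix y assume "y \<in> F'_space W W' Z"
        then have "y = ?\<omega> (D y)" "D y \<in> ?F" using CD D(4) by (auto simp: F' F_space(2))
        then show "y \<in> ?\<omega> ` ?F" by blast
      qed
    qed
    have "restrict C ?F \<in> operators ?F UNIV" by (rule restrict_operators[OF C(1) F_space(1)]) simp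
    then have op: "?\<omega> \<in> operators ?F (F'_space W W' Z)"
      using C(4) by (auto simp: operators_def F')
    have iso: "norm (C x) = norm x" if "x \<in> ?F" for x
      using C(2)[of x] D(2)[of "C x"] DC that by (simp add: F_space(2))
    interpret C: bounded_linear C by (rule operators_bounded_linear[OF C(1)])
    have inn: "inner (C x) (C y) = inner x y" if "x \<in> ?F" "y \<in> ?F" for x y
      by (rule contraction_isometric_vector[OF subspace_UNIV]) (auto simp: C.add C.scaleR C(2) iso that)
    have "cinner (C x) (C y) = cinner x y" if "x \<in> ?F" "y \<in> ?F" for x y
      using inn[OF that] inn[OF that(1) closed_csubspaceD(4)[OF F_space(1) that(2)], of \<i>]
      by (simp add: cinner_eq_Complex operators_scaleC[OF C(1)])
    moreover have "K1_adj z \<in> ?F" for z unfolding F_space(2) by (rule subsetD[OF closure_subset]) simp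
    ultimately show "?\<omega> \<in> unitary_operators ?F (F'_space W W' Z) \<and> ?\<omega> \<circ> cadjoint (K1_op W W') = cadjoint (K2_op W W' Z)"
      using img op by (simp add: unitary_operators_def cadjoint_K1 cadjoint_K2 fun_eq_iff C(3))
  next
    fix \<omega> assume "\<omega> \<in> unitary_operators ?F (F'_space W W' Z) \<and> \<omega> \<circ> cadjoint (K1_op W W') = cadjoint (K2_op W W' Z)"
    then have op: "\<omega> \<in> operators ?F (F'_space W W' Z)" and k: "\<And>z. \<omega> (K1_adj z) = K2_adj z"
      by (auto simp: unitary_operators_def cadjoint_K1 cadjoint_K2 fun_eq_iff)
    show "\<omega> = ?\<omega>"
    proof
      fix x
      show "\<omega> x = ?\<omega> x"
      proof (cases "x \<in> ?F")
        case True
        have "\<omega> x = C x"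
          by (rule operators_eq_on_closure[OF op C(1) F_space(1) closed_csubspace_UNIV, of K1_adj])
            (use k C(3) True closure_subset F_space(2) in simp_all)
        then show ?thesis using True by simp
      next
        case False
        then have "\<omega> x = undefined" using op unfolding operators_def by (blast dest: PiE_arb)
        then show ?thesis using False by simp
      qed
    qed
  qed
  moreover have "C x \<in> HY" for x
    using C(4)[of x] closure_minimal[of "range K2_adj" HY] K2_adj_in closed_csubspaceD(1)[OF HY] by blast
  ultimately show ?thesis using that C by blast
qed

lemma restrict_eq_omega_iff:
  assumes T: "T \<in> operators HU HY"
  shows "restrict T (F_space W W') = omega W W' Z \<longleftrightarrow> (\<forall>z. T (K1_adj z) = K2_adj z)"
proof -
  obtain C where C: "C \<in> operators UNIV UNIV" "\<And>z. C (K1_adj z) = K2_adj z" "omega W W' Z = restrict C (F_space W W')"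
    by (rule omega_eq) (rule that; assumption)
  have K: "K1_adj z \<in> F_space W W'" for z unfolding F_space(2) by (rule subsetD[OF closure_subset]) simp
  show ?thesis
  proof
    assume "restrict T (F_space W W') = omega W W' Z"
    then show "\<forall>z. T (K1_adj z) = K2_adj z" using K C(2,3) by (metis restrict_apply')
  next
    assume *: "\<forall>z. T (K1_adj z) = K2_adj z"
    have "T x = C x" if "x \<in> F_space W W'" for x
      by (rule operators_eq_on_closure[OF T C(1) HU closed_csubspace_UNIV, of K1_adj])
        (use * C(2) range_K_subset that F_space(2) in simp_all)
    then show "restrict T (F_space W W') = omega W W' Z" by (auto simp: C(3))
  qed
qed

section \<open>Parameters as coefficient sequences\<close>

definition parameter_coeffs :: "(nat \<Rightarrow> 'u \<times> 'z \<Rightarrow> 'y \<times> 'z) set" where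
  "parameter_coeffs = {G \<in> schur_coeffs HU HY. \<forall>z. G 0 (K1_adj z) = K2_adj z}"

lemma LTONP_parameters_eq: "LTONP_parameters W W' Z = power_series_fun HU ` parameter_coeffs"
proof (intro set_eqI iffI)
  fix F assume "F \<in> LTONP_parameters W W' Z"
  then have F: "F \<in> schur_class HU HY" "restrict (F 0) (F_space W W') = omega W W' Z"
    by (auto simp: LTONP_parameters_def)
  obtain C where C: "C \<in> schur_coeffs HU HY" "F = power_series_fun HU C"
    by (rule schur_class_imp_schur_coeffs[OF F(1) HU HY])
  have "F 0 \<in> operators HU HY" using F(1) by (auto simp: schur_class_def)
  then have "F 0 (K1_adj z) = K2_adj z" for z using restrict_eq_omega_iff F(2) by blast
  then have "C \<in> parameter_coeffs"
    using C power_series_fun_0[OF bounded_coeffs_schur[OF C(1) HU HY] K1_adj_in] by (simp add: parameter_coeffs_def)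
  then show "F \<in> power_series_fun HU ` parameter_coeffs" using C(2) by blast
next
  fix F assume "F \<in> power_series_fun HU ` parameter_coeffs"
  then obtain C where C: "C \<in> schur_coeffs HU HY" "\<forall>z. C 0 (K1_adj z) = K2_adj z" "F = power_series_fun HU C"
    by (auto simp: parameter_coeffs_def)
  note bounded = C(1) HU HY and CK = C(2) and FC = C(3)
  interpret bounded_coeffs HU HY C by (rule bounded_coeffs_schur[OF bounded])
  have "power_series_fun HU C 0 (K1_adj z) = K2_adj z" for z
    using power_series_fun_0[OF bounded_coeffs_axioms K1_adj_in] CK by simp
  then have "restrict (power_series_fun HU C 0) (F_space W W') = omega W W' Z"
    using restrict_eq_omega_iff[OF F_operator[of 0]] by simp
  then show "F \<in> LTONP_parameters W W' Z"
    using schur_coeffs_imp_schur_class[OF bounded] FC by (simp add: LTONP_parameters_def)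
qed

section \<open>From parameters to solutions\<close>

text \<open>
  The truncated Toeplitz operators of \<open>G\<close> are contractions that are isometric on vectors with the single
  entry \<open>K\<^sub>1\<^sup>* z\<close> in last position, so they preserve inner products with these vectors. This turns
  \<open>G(0) K\<^sub>1\<^sup>* = K\<^sub>2\<^sup>*\<close> into the dual identity \<open>K\<^sub>2 G(\<lambda>) = K\<^sub>1\<close>.
\<close>

lemma parameter_K2:
  assumes par: "G \<in> parameter_coeffs" and p: "p \<in> HU"
  shows "K2_op W W' Z (G n p) = (if n = 0 then K1_op W W' p else 0)"
proof -
  have GS: "G \<in> schur_coeffs HU HY" and G0: "\<And>z. G 0 (K1_adj z) = K2_adj z"
    using par by (auto simp: parameter_coeffs_def)
  note lin = operatorsD[OF schur_coeffsD(1)[OF GS] HU]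
  note HU' = closed_csubspaceD[OF HU]
  have scR: "G n (t *\<^sub>R x) = t *\<^sub>R G n x" if "x \<in> HU" for n t x
    using lin(3)[OF that, of n "of_real t"] by (simp add: scaleR_scaleC)
  have "inner (G n p) (K2_adj z) = (if n = 0 then inner p (K1_adj z) else 0)" for z
  proof (cases n)
    case 0
    have "inner (G 0 p) (G 0 (K1_adj z)) = inner p (K1_adj z)"
    proof (rule contraction_isometric_vector[OF HU'(5) K1_adj_in p])
      show "G 0 (p + t *\<^sub>R K1_adj z) = G 0 p + t *\<^sub>R G 0 (K1_adj z)" for t
        using lin(2)[OF p subspace_scale[OF HU'(5) K1_adj_in]] scR[OF K1_adj_in] by simp
      show "norm (G 0 x) \<le> norm x" if "x \<in> HU" for x by (rule schur_coeffs_column(2)[OF GS HU that])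
      show "norm (G 0 (K1_adj z)) = norm (K1_adj z)" by (simp add: G0 norm_K)
    qed
    then show ?thesis using 0 by (simp add: G0)
  next
    case (Suc m)
    have ineq: "2 * t * inner (G n p) (K2_adj z) \<le> (norm p)\<^sup>2" for t
    proof -
      \<comment> \<open>Input p at time 0 and t K_1^* z at time n give the output G_n p + t K_2^* z
        at time n. The squares of t cancel by \<open>norm_K\<close>, and a linear function of t
        bounded above for all t is constant.\<close>
      define w where "w k = (if k = 0 then p else if k = n then t *\<^sub>R K1_adj z else 0)" for k
      have w0: "w 0 = p" by (simp add: w_def)
      have wH: "w k \<in> HU" for k
        using p subspace_scale[OF HU'(5) K1_adj_in] HU'(2) by (simp add: w_def)
      have "conv G w n = G n (w 0) + (\<Sum>i<n. G (n - Suc i) (w (Suc i)))"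
        unfolding conv_def by (subst sum.atMost_shift) simp
      also have "(\<Sum>i<n. G (n - Suc i) (w (Suc i))) = (\<Sum>i<n. if i = m then G 0 (t *\<^sub>R K1_adj z) else 0)"
        by (rule sum.cong) (auto simp: w_def Suc lin(4))
      finally have c: "conv G w n = G n p + t *\<^sub>R K2_adj z"
        using Suc by (simp add: w0 scR[OF K1_adj_in] G0)
      have "(norm (conv G w n))\<^sup>2 \<le> (\<Sum>k\<le>n. (norm (conv G w k))\<^sup>2)"
        by (rule member_le_sum) auto
      also have "\<dots> \<le> (\<Sum>k\<le>n. (norm (w k))\<^sup>2)"
        by (rule schur_coeffsD(2)[OF GS wH])
      also have "\<dots> = (norm p)\<^sup>2 + (\<Sum>i<n. (norm (w (Suc i)))\<^sup>2)"
        by (subst sum.atMost_shift) (simp add: w_def)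
      also have "(\<Sum>i<n. (norm (w (Suc i)))\<^sup>2) = (\<Sum>i<n. if i = m then (norm (t *\<^sub>R K1_adj z))\<^sup>2 else 0)"
        by (rule sum.cong) (auto simp: w_def Suc)
      also have "\<dots> = t\<^sup>2 * (norm (K1_adj z))\<^sup>2" using Suc by (simp add: power_mult_distrib)
      finally have "(norm (G n p + t *\<^sub>R K2_adj z))\<^sup>2 \<le> (norm p)\<^sup>2 + t\<^sup>2 * (norm (K1_adj z))\<^sup>2"
        unfolding c .
      moreover have "(norm (G n p + t *\<^sub>R K2_adj z))\<^sup>2 = (norm (G n p))\<^sup>2 + 2 * t * inner (G n p) (K2_adj z) + t\<^sup>2 * (norm (K2_adj z))\<^sup>2"
        using dot_norm[of "G n p" "t *\<^sub>R K2_adj z"] by (simp add: power_mult_distrib)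
      moreover have "0 \<le> (norm (G n p))\<^sup>2" by simp
      ultimately show ?thesis unfolding norm_K by linarith
    qed
    have "inner (G n p) (K2_adj z) = 0"
    proof (rule ccontr)
      assume ne: "inner (G n p) (K2_adj z) \<noteq> 0"
      define a where "a = inner (G n p) (K2_adj z)"
      have "2 * (((norm p)\<^sup>2 + 1) / (2 * a)) * a = (norm p)\<^sup>2 + 1" using ne by (simp add: a_def[symmetric])
      then show False using ineq[of "((norm p)\<^sup>2 + 1) / (2 * a)"] unfolding a_def[symmetric] by linarith
    qed
    then show ?thesis using Suc by simp
  qed
  note inner_eq = this
  show ?thesis
  proof (rule eq_if_inner_eq)
    fix z
    show "inner (K2_op W W' Z (G n p)) z = inner (if n = 0 then K1_op W W' p else 0) z"
      unfolding inner_K2 inner_eq by (cases "n = 0") (simp_all add: inner_K1)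
  qed
qed

lemma K1_state: "K1_op W W' (0, x) = L x"
  by (simp add: K1_op_def bounded_linear.linear[OF operators_bounded_linear] linear_0 W'_op embed0_operator)

lemma parameter_loop: "G \<in> parameter_coeffs \<Longrightarrow> feedback_loop Z0 G"
  by (simp add: feedback_loop_def parameter_coeffs_def Z0)

text \<open>K_2 annihilates all coefficients of positive index, so of the whole history only the
  input entering at time n survives, with K_1 applied to it.\<close>

lemma feedback_K2:
  assumes par: "G \<in> parameter_coeffs" and p: "p \<in> HU"
  shows "K2_op W W' Z (feedback G p n) = (case n of 0 \<Rightarrow> K1_op W W' p | Suc k \<Rightarrow> L (snd (feedback G p k)))"
proof -
  interpret feedback_loop Z0 G by (rule parameter_loop[OF par])
  interpret K2: bounded_linear "K2_op W W' Z" by (rule operators_bounded_linear[OF K2_op])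
  have in_HU: "(0, snd (feedback G p k)) \<in> HU" for k by (simp add: snd_feedback_in p)
  show ?thesis
  proof (cases n)
    case 0
    then show ?thesis by (subst feedback.simps) (simp add: parameter_K2[OF par p])
  next
    case (Suc m)
    have "K2_op W W' Z (feedback G p n) = (\<Sum>k<n. if k = m then K1_op W W' (0, snd (feedback G p k)) else 0)"
      by (subst feedback.simps, unfold K2.add K2.sum parameter_K2[OF par p] parameter_K2[OF par in_HU])
        (use Suc in \<open>auto intro!: sum.cong\<close>)
    then show ?thesis using Suc by (simp add: K1_state)
  qed
qed

text \<open>Weakly, W h is the sum of Z^n B h_n, and likewise for W'.\<close>

lemma inner_W_sums:
  "(\<lambda>n. inner (W (embed0 (Rep_ell2 h n))) ((Z_adj ^^ n) z)) sums inner (W h) z"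
  "(\<lambda>n. inner (W' (embed0 (Rep_ell2 g n))) ((Z_adj ^^ n) z)) sums inner (W' g) z"
  using inner_ell2_sums[of h "W_adj z"] inner_ell2_sums[of g "W'_adj z"]
  by (simp_all add: inner_adj inner_embed0 Rep_W_adj[symmetric] Rep_W'_adj[symmetric])

lemma Z_adj_funpow: "inner (Z x) ((Z_adj ^^ n) z) = inner x ((Z_adj ^^ Suc n) z)"
  by (simp add: inner_adj)

lemma bounded_state_limit:
  assumes "\<And>n. norm (s n) \<le> M"
  shows "(\<lambda>n. inner (s n) ((Z_adj ^^ n) z)) \<longlonglongrightarrow> 0"
proof (rule Lim_null_comparison[OF always_eventually])
  show "\<forall>n. norm (inner (s n) ((Z_adj ^^ n) z)) \<le> M * norm ((Z_adj ^^ n) z)"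
    using order_trans[OF Cauchy_Schwarz_ineq2 mult_right_mono[OF assms norm_ge_zero]] by simp
  show "(\<lambda>n. M * norm ((Z_adj ^^ n) z)) \<longlonglongrightarrow> 0"
    using stable by (intro tendsto_mult_right_zero tendsto_norm_zero) (simp add: pointwise_stable_def)
qed

lemma L_bounded: "\<exists>M\<ge>0. \<forall>x. norm (L x) \<le> M * norm x"
  using bounded_linear.nonneg_bounded[OF operators_bounded_linear[OF L_op]] by (metis mult.commute)

lemma parameter_interpolates:
  assumes par: "G \<in> parameter_coeffs"
  shows "redheffer Z0 (power_series_fun HU G) \<in> LTONP_solutions W W'"
proof -
  interpret feedback_loop Z0 G by (rule parameter_loop[OF par])
  interpret K2: bounded_linear "K2_op W W' Z" by (rule operators_bounded_linear[OF K2_op])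
  interpret L: bounded_linear L by (rule operators_bounded_linear[OF L_op])
  let ?F = "power_series_fun UNIV transfer"
  have "W (toeplitz ?F g) = W' g" for g
  proof -
    let ?w = "\<lambda>k. (Rep_ell2 g k, 0::'z)"
    let ?out = "conv (\<lambda>n p. feedback G p n) ?w"
    have w: "?w k \<in> HU" for k using closed_csubspaceD(2)[OF Z0] by simp
    have g_le: "(\<Sum>n\<le>N. (norm (?w n))\<^sup>2) \<le> (norm g)\<^sup>2" for N
      using sum_le_power2_norm_ell2[of g "Suc N"] by (simp add: norm_prod_power2 lessThan_Suc_atMost)
    have en: "(\<Sum>n\<le>N. (norm (fst (?out n)))\<^sup>2) + (norm (snd (?out N)))\<^sup>2 \<le> (norm g)\<^sup>2" for N
      by (rule order_trans[OF feedback_energy[OF w] g_le]) simp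
    define h where "h = toeplitz ?F g"
    have "(\<lambda>n. \<Sum>k\<le>n. transfer (n - k) (Rep_ell2 g k)) = (\<lambda>n. fst (?out n))"
      using conv_transfer[of "Rep_ell2 g"] by (simp add: conv_def fun_eq_iff)
    then have h_eq: "h = Abs_ell2 (\<lambda>n. fst (?out n))"
      by (simp add: h_def toeplitz_def taylor_coeff_power_series[OF transfer_schur])
    have Rep_h: "Rep_ell2 h = (\<lambda>n. fst (?out n))"
      unfolding h_eq by (rule ell2_bounded_sums(1)[of _ "(norm g)\<^sup>2"]) (use en in \<open>smt (verit) zero_le_power2\<close>)
    have snd_le: "norm (snd (?out n)) \<le> norm g" for n
    proof (rule power2_le_imp_le)
      have "0 \<le> (\<Sum>k\<le>n. (norm (fst (?out k)))\<^sup>2)" by (rule sum_nonneg) simp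
      then show "(norm (snd (?out n)))\<^sup>2 \<le> (norm g)\<^sup>2" using en[of n] by linarith
    qed simp
    \<comment> \<open>s n is L applied to the state that enters at time n, hence produced at time n
      - 1; s 0 = 0 because the loop starts at rest.\<close>
    define s where "s n = (case n of 0 \<Rightarrow> 0 | Suc k \<Rightarrow> L (snd (?out k)))" for n
    obtain M where M: "0 \<le> M" "\<And>x. norm (L x) \<le> M * norm x" using L_bounded by blast
    have s_le: "norm (s n) \<le> M * norm g" for n
      using order_trans[OF M(2) mult_left_mono[OF snd_le M(1)]] M(1) by (simp add: s_def split: nat.split)
    have K2out: "K2_op W W' Z (?out n) = W' (embed0 (Rep_ell2 g n)) + s n" for n
    proof -
      have "K2_op W W' Z (?out n) = (\<Sum>k\<le>n. case n - k of 0 \<Rightarrow> K1_op W W' (?w k) | Suc j \<Rightarrow> L (snd (feedback G (?w k) j)))"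
        unfolding conv_def K2.sum by (simp only: feedback_K2[OF par w])
      also have "\<dots> = W' (embed0 (Rep_ell2 g n)) + s n"
      proof (cases n)
        case 0
        then show ?thesis by (simp add: K1_op_def s_def L.zero)
      next
        case (Suc m)
        have "(\<Sum>k\<le>m. case n - k of 0 \<Rightarrow> K1_op W W' (?w k) | Suc j \<Rightarrow> L (snd (feedback G (?w k) j)))
            = (\<Sum>k\<le>m. L (snd (feedback G (?w k) (m - k))))"
          by (rule sum.cong) (auto simp: Suc Suc_diff_le)
        also have "\<dots> = s n" by (simp add: s_def Suc conv_def snd_sum L.sum)
        finally show ?thesis using Suc by (simp add: K1_op_def L.zero add.commute)
      qed
      finally show ?thesis .
    qed
    have step: "W (embed0 (fst (?out n))) = W' (embed0 (Rep_ell2 g n)) + s n - Z (s (Suc n))" for n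
      using K2out[of n] by (simp add: K2_op_def case_prod_beta s_def algebra_simps)
    have "inner (W h) z = inner (W' g) z" for z
    proof -
      have tele: "(\<Sum>n<N. inner (W (embed0 (Rep_ell2 h n))) ((Z_adj ^^ n) z) - inner (W' (embed0 (Rep_ell2 g n))) ((Z_adj ^^ n) z))
          = - inner (s N) ((Z_adj ^^ N) z)" for N
      proof (induction N)
        case 0
        show ?case by (simp add: s_def)
      next
        case (Suc N)
        have "inner (W (embed0 (Rep_ell2 h N))) ((Z_adj ^^ N) z) - inner (W' (embed0 (Rep_ell2 g N))) ((Z_adj ^^ N) z)
          = inner (s N) ((Z_adj ^^ N) z) - inner (s (Suc N)) ((Z_adj ^^ Suc N) z)"
          unfolding Rep_h step by (simp only: inner_add_left inner_diff_left Z_adj_funpow)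
        then show ?case using Suc by simp
      qed
      have "(\<lambda>N. - inner (s N) ((Z_adj ^^ N) z)) \<longlonglongrightarrow> inner (W h) z - inner (W' g) z"
        using sums_diff[OF inner_W_sums(1)[of h z] inner_W_sums(2)[of g z]] unfolding sums_def tele .
      moreover have "(\<lambda>N. - inner (s N) ((Z_adj ^^ N) z)) \<longlonglongrightarrow> - 0"
        by (intro tendsto_minus bounded_state_limit[OF s_le])
      ultimately show ?thesis using LIMSEQ_unique by fastforce
    qed
    then show ?thesis unfolding h_def[symmetric] by (rule eq_if_inner_eq)
  qed
  then show ?thesis
    unfolding redheffer_power_series
    using schur_coeffs_imp_schur_class[OF transfer_schur] by (auto simp: LTONP_solutions_def)
qed

section \<open>Uniqueness of the parameter\<close>

text \<open>G(0) K_1^* z = K_2^* z already has the full norm of the impulse, so the column bound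
  makes the later coefficients vanish on K_1^* z. The loop thus emits K_2^* z and continues from its
  state component L Z^* z.\<close>

lemma parameter_feedback_K1s:
  assumes par: "G \<in> parameter_coeffs"
  shows "feedback G (K1_adj z) 0 = K2_adj z" "feedback G (K1_adj z) (Suc n) = feedback G (0, L (Z_adj z)) n"
proof -
  have GS: "G \<in> schur_coeffs HU HY" and G0: "G 0 (K1_adj z) = K2_adj z"
    using par by (auto simp: parameter_coeffs_def)
  interpret feedback_loop Z0 G by (rule parameter_loop[OF par])
  show f0: "feedback G (K1_adj z) 0 = K2_adj z" by (subst feedback.simps) (simp add: G0)
  have Gn: "G (Suc n) (K1_adj z) = 0" for n
  proof -
    have "(\<Sum>k\<le>Suc n. (norm (G k (K1_adj z)))\<^sup>2) \<le> (norm (K1_adj z))\<^sup>2"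
      by (rule schur_coeffs_column(1)[OF GS HU K1_adj_in])
    then have "(norm (G 0 (K1_adj z)))\<^sup>2 + (\<Sum>i\<le>n. (norm (G (Suc i) (K1_adj z)))\<^sup>2) \<le> (norm (K1_adj z))\<^sup>2"
      by (simp only: sum.atMost_Suc_shift)
    then have "(\<Sum>i\<le>n. (norm (G (Suc i) (K1_adj z)))\<^sup>2) \<le> 0" by (simp add: G0 norm_K)
    moreover have "(norm (G (Suc n) (K1_adj z)))\<^sup>2 \<le> (\<Sum>i\<le>n. (norm (G (Suc i) (K1_adj z)))\<^sup>2)"
      by (rule member_le_sum) auto
    ultimately have "(norm (G (Suc n) (K1_adj z)))\<^sup>2 \<le> 0" by linarith
    then show ?thesis by simp
  qed
  have "feedback G (K1_adj z) (Suc n) = feedback G (0, L (Z_adj z)) n" for n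
  proof (rule feedback_unique)
    fix n
    have "feedback G (K1_adj z) (Suc n) = (\<Sum>k<Suc n. G (n - k) (0, snd (feedback G (K1_adj z) k)))"
      by (subst feedback.simps) (simp add: Gn)
    also have "\<dots> = G n (0, L (Z_adj z)) + (\<Sum>k<n. G (n - Suc k) (0, snd (feedback G (K1_adj z) (Suc k))))"
      by (subst sum.lessThan_Suc_shift) (simp add: f0 K2_adj_def)
    finally show "feedback G (K1_adj z) (Suc n) = G n (0, L (Z_adj z)) + (\<Sum>k<n. G (n - Suc k) (0, snd (feedback G (K1_adj z) (Suc k))))" .
  qed
  then show "feedback G (K1_adj z) (Suc n) = feedback G (0, L (Z_adj z)) n" .
qed

text \<open>
  If two parameters have the same solution, the difference \<open>d\<^sub>n\<close> of their states satisfies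
  \<open>L d\<^sub>n = Z L d\<^sub>n\<^sub>+\<^sub>1\<close>, and stability of \<open>Z\<^sup>*\<close> forces \<open>d\<^sub>n = 0\<close>. The response to an initial state in the range
  of \<open>L\<close> then follows recursively, because \<open>(0, L z)\<close> and \<open>K\<^sub>1\<^sup>* z\<close> differ by an element of \<open>\<U>\<close>.
\<close>

lemma parameter_unique:
  assumes par: "G \<in> parameter_coeffs" and par': "G' \<in> parameter_coeffs"
    and eq: "\<And>n u. fst (feedback G (u, 0) n) = fst (feedback G' (u, 0) n)" and p: "p \<in> HU"
  shows "G n p = G' n p"
proof -
  interpret g: feedback_loop Z0 G by (rule parameter_loop[OF par])
  interpret g': feedback_loop Z0 G' by (rule parameter_loop[OF par'])
  interpret L: bounded_linear L by (rule operators_bounded_linear[OF L_op])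
  interpret Z: bounded_linear Z by (rule operators_bounded_linear[OF Z_op])
  note Z0' = closed_csubspaceD[OF Z0]
  have u_in: "(u, 0) \<in> HU" for u using Z0' by simp
  have snd_eq: "snd (feedback G (u, 0) n) = snd (feedback G' (u, 0) n)" for n u
  proof -
    define d where "d n = snd (feedback G (u, 0) n) - snd (feedback G' (u, 0) n)" for n
    have d_in: "d n \<in> Z0" for n
      unfolding d_def by (intro Z0'(6) g.snd_feedback_in g'.snd_feedback_in u_in)
    have rec: "L (d n) = Z (L (d (Suc n)))" for n
    proof -
      have "K2_op W W' Z (feedback G (u, 0) (Suc n)) - K2_op W W' Z (feedback G' (u, 0) (Suc n)) = L (d n)"
        by (simp add: feedback_K2[OF par u_in] feedback_K2[OF par' u_in] d_def L.diff)
      then show ?thesis by (simp add: K2_op_def case_prod_beta eq d_def L.diff Z.diff)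
    qed
    have d_le: "norm (d n) \<le> 2 * norm u" for n
      using norm_triangle_ineq4[of "snd (feedback G (u, 0) n)" "snd (feedback G' (u, 0) n)"]
        g.norm_snd_feedback_le[OF u_in, of u n] g'.norm_snd_feedback_le[OF u_in, of u n]
      by (simp add: d_def)
    obtain M where M: "0 \<le> M" "\<And>x. norm (L x) \<le> M * norm x" using L_bounded by blast
    have "inner (L (d n)) z = 0" for z
    proof -
      have "inner (L (d n)) z = inner (L (d (n + k))) ((Z_adj ^^ k) z)" for k
      proof (induction k)
        case (Suc k)
        have "inner (L (d (n + k))) ((Z_adj ^^ k) z) = inner (L (d (n + Suc k))) ((Z_adj ^^ Suc k) z)"
          by (subst rec, subst Z_adj_funpow) simp
        with Suc show ?case by (rule trans)
      qed simp
      moreover have "(\<lambda>k. inner (L (d (n + k))) ((Z_adj ^^ k) z)) \<longlonglongrightarrow> 0"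
        by (rule bounded_state_limit[of _ "M * (2 * norm u)"]) (rule order_trans[OF M(2) mult_left_mono[OF d_le M(1)]])
      ultimately show ?thesis using LIMSEQ_unique[OF tendsto_const] by simp
    qed
    then have "L (d n) = 0" by (rule zero_if_inner_zero)
    then have "d n = 0" by (rule L_zero_imp[OF d_in])
    then show ?thesis by (simp add: d_def)
  qed
  have u_eq: "feedback G (u, 0) n = feedback G' (u, 0) n" for u n
    using eq snd_eq by (simp add: prod_eq_iff)
  have split: "feedback G (0, L z) n = feedback G (K1_adj z) n - feedback G (Rep_ell2 (W'_adj z) 0, 0) n"
    "feedback G' (0, L z) n = feedback G' (K1_adj z) n - feedback G' (Rep_ell2 (W'_adj z) 0, 0) n" for z n
    using g.feedback_add[of "(0, L z)" "(Rep_ell2 (W'_adj z) 0, 0)" n]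
      g'.feedback_add[of "(0, L z)" "(Rep_ell2 (W'_adj z) 0, 0)" n] L_in_Z0[of z] Z0'(2)
    by (simp_all add: K1_adj_def)
  \<comment> \<open>The induction keeps z arbitrary because advancing time by one replaces z by Z^*
    z.\<close>
  have L_eq: "feedback G (0, L z) n = feedback G' (0, L z) n" for z n
  proof (induction n arbitrary: z)
    case 0
    show ?case unfolding split u_eq by (simp add: parameter_feedback_K1s(1)[OF par] parameter_feedback_K1s(1)[OF par'])
  next
    case (Suc n)
    show ?case unfolding split u_eq
      by (simp only: parameter_feedback_K1s(2)[OF par] parameter_feedback_K1s(2)[OF par'] Suc)
  qed
  \<comment> \<open>Deconvolution: the response at time n is G_n of the initial input plus terms
    with coefficients of smaller index, which agree by induction.\<close>
  have G_L: "G n (0, L z) = G' n (0, L z)" "G n (u, 0) = G' n (u, 0)" if IH: "\<And>k p. k < n \<Longrightarrow> p \<in> HU \<Longrightarrow> G k p = G' k p" for n z u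
  proof -
    have "(\<Sum>k<n. G (n - Suc k) (0, snd (feedback G p k))) = (\<Sum>k<n. G' (n - Suc k) (0, snd (feedback G p k)))"
      if "p \<in> HU" for p
      by (rule sum.cong[OF refl], rule IH) (use g.snd_feedback_in[OF that] in auto)
    from this[of "(0, L z)"] this[of "(u, 0)"]
    show "G n (0, L z) = G' n (0, L z)" "G n (u, 0) = G' n (u, 0)"
      using L_eq[of z n] u_eq[of u n] L_in_Z0 Z0'(2)
      unfolding feedback.simps[of G _ n] feedback.simps[of G' _ n] L_eq u_eq by simp_all
  qed
  show ?thesis
    using p
  proof (induction n arbitrary: p rule: less_induct)
    case (less n)
    obtain u x where ux: "p = (u, x)" "x \<in> Z0" using less.prems by auto
    have GH: "G n \<in> operators HU HY" "G' n \<in> operators HU HY"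
      using schur_coeffsD(1)[OF g.G] schur_coeffsD(1)[OF g'.G] by blast+
    have e: "(0, x) \<in> closure (range (\<lambda>z. (0::'u, L z)))"
    proof -
      obtain f where "\<forall>n. f n \<in> range L" "f \<longlonglongrightarrow> x"
        using ux(2) unfolding Z0_closure_range_L closure_sequential by blast
      then show ?thesis
        unfolding closure_sequential by (intro exI[of _ "\<lambda>n. (0, f n)"]) (auto intro: tendsto_Pair)
    qed
    have "G n (0, x) = G' n (0, x)"
      by (rule operators_eq_on_closure[OF GH HU HU G_L(1)[OF less.IH] _ _ e])
        (use L_in_Z0 in auto)
    moreover have "G n (u, 0) = G' n (u, 0)" by (rule G_L(2)[OF less.IH])
    moreover have "p = (u, 0) + (0, x)" by (simp add: ux)
    ultimately show ?case using ux(2) Z0'(2) by (simp only: g.G_lin(2) g'.G_lin(2) mem_Times_iff fst_conv snd_conv UNIV_I simp_thms)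
  qed
qed

lemma redheffer_inj: "inj_on (redheffer Z0) (LTONP_parameters W W' Z)"
proof (rule inj_onI)
  fix A B assume A: "A \<in> LTONP_parameters W W' Z" and B: "B \<in> LTONP_parameters W W' Z"
    and eq: "redheffer Z0 A = redheffer Z0 B"
  obtain G where G: "G \<in> parameter_coeffs" "A = power_series_fun HU G" using A unfolding LTONP_parameters_eq by blast
  obtain G' where G': "G' \<in> parameter_coeffs" "B = power_series_fun HU G'" using B unfolding LTONP_parameters_eq by blast
  interpret g: feedback_loop Z0 G by (rule parameter_loop[OF G(1)])
  interpret g': feedback_loop Z0 G' by (rule parameter_loop[OF G'(1)])
  have "power_series_fun UNIV g.transfer = power_series_fun UNIV g'.transfer"
    using eq unfolding G(2) G'(2) g.redheffer_power_series g'.redheffer_power_series .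
  from arg_cong[OF this, of taylor_coeff] have "g.transfer = g'.transfer"
    by (simp only: taylor_coeff_power_series g.transfer_schur g'.transfer_schur)
  then have "G n p = G' n p" if "p \<in> HU" for n p
    by (intro parameter_unique[OF G(1) G'(1) _ that]) (simp add: g.transfer_def[symmetric] g'.transfer_def[symmetric])
  then show "A = B"
    unfolding G G' power_series_fun_def by (intro ext) (auto simp: restrict_def)
qed

section \<open>Existence of parameters\<close>

text \<open>The constant function whose value is \<omega> extended by zero; it makes the problem
  solvable.\<close>

lemma parameter_coeffs_nonempty: "parameter_coeffs \<noteq> {}"
proof -
  obtain C where C: "C \<in> operators UNIV UNIV" "\<And>x. norm (C x) \<le> norm x" "\<And>z. C (K1_adj z) = K2_adj z" "\<And>x. C x \<in> HY"
    by (rule omega_eq) (rule that; assumption)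
  define c where "c n = (\<lambda>p. if n = 0 then C p else 0)" for n :: nat
  have c_op: "c n \<in> operators UNIV UNIV" for n
    using C(1) by (cases "n = 0") (simp_all add: c_def operators_UNIV_iff)
  have c_in: "c n p \<in> HY" for n p
    using C(4) closed_csubspaceD(2)[OF HY] by (simp add: c_def)
  define G where "G n = restrict (c n) HU" for n
  have "G \<in> schur_coeffs HU HY"
    unfolding schur_coeffs_def
  proof (intro CollectI conjI allI impI)
    fix n
    have "restrict (c n) HU \<in> operators HU UNIV" by (rule restrict_operators[OF c_op HU]) simp
    then show "G n \<in> operators HU HY" using c_in by (auto simp: operators_def G_def)
  next
    fix w :: "nat \<Rightarrow> 'u \<times> 'z" and N assume w: "range w \<subseteq> HU"
    then have wk: "w k \<in> HU" for k by blast
    have "conv G w n = C (w n)" for n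
    proof -
      have "conv G w n = (\<Sum>k\<le>n. if k = n then C (w n) else 0)"
        unfolding conv_def by (rule sum.cong) (use wk in \<open>simp_all add: G_def c_def\<close>)
      then show ?thesis by simp
    qed
    then show "(\<Sum>n\<le>N. (norm (conv G w n))\<^sup>2) \<le> (\<Sum>n\<le>N. (norm (w n))\<^sup>2)"
      by (simp add: sum_mono power_mono C(2))
  qed
  moreover have "G 0 (K1_adj z) = K2_adj z" for z by (simp add: G_def c_def K1_adj_in C(3))
  ultimately show ?thesis by (auto simp: parameter_coeffs_def)
qed

text \<open>
  \<open>M\<close> is the coisometric de Branges-Rovnyak colligation of \<open>F\<close> on the range of \<open>D = (I - T T\<^sup>*)\<^sup>1\<^sup>/\<^sup>2\<close>. Since
  \<open>\<Lambda> = W (I - T T\<^sup>*) W\<^sup>*\<close>, the space \<open>Z\<^sub>\<circ>\<close> embeds isometrically by \<open>V L z = D W\<^sup>* z\<close>, and \<open>G\<close> is obtained from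
  \<open>M\<close> by opening the loop through \<open>V Z\<^sub>\<circ>\<close> while keeping its orthogonal complement, the range of \<open>Q\<close>, as
  internal state space.
\<close>

lemma solution_from_parameter:
  assumes F: "F \<in> LTONP_solutions W W'"
  shows "\<exists>G\<in>parameter_coeffs. redheffer Z0 (power_series_fun HU G) = F"
proof -
  obtain C where C: "C \<in> schur_coeffs UNIV UNIV" and FC: "F = power_series_fun UNIV C"
  proof (rule schur_class_imp_schur_coeffs)
    show "F \<in> schur_class UNIV UNIV" using F by (simp add: LTONP_solutions_def)
  qed (rule closed_csubspace_UNIV closed_csubspace_UNIV that; assumption?)+
  note C_lin = operatorsD[OF schur_coeffsD(1)[OF C] closed_csubspace_UNIV, simplified]
  define T where "T = toeplitz F"
  have T_eq: "T h = Abs_ell2 (conv C (Rep_ell2 h))" for h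
    by (simp add: T_def toeplitz_def FC taylor_coeff_power_series[OF C] conv_def[abs_def])
  have en: "(\<Sum>n\<le>N. (norm (conv C (Rep_ell2 h) n))\<^sup>2) \<le> (norm h)\<^sup>2" for h N
    by (rule order_trans[OF schur_coeffsD(2)[OF C]])
      (use sum_le_power2_norm_ell2[of h "Suc N"] in \<open>simp_all add: lessThan_Suc_atMost\<close>)
  have Rep_T: "Rep_ell2 (T h) = conv C (Rep_ell2 h)" for h
    unfolding T_eq by (rule ell2_bounded_sums(1)[OF en])
  have T_le: "norm (T h) \<le> norm h" for h
    using ell2_bounded_sums(2)[OF en, of h] unfolding T_eq[symmetric] by (rule power2_le_imp_le) simp
  have T_op: "T \<in> operators UNIV UNIV"
  proof -
    have "T (x + y) = T x + T y" for x y
      by (rule ell2_eqI) (simp add: Rep_T plus_ell2.rep_eq conv_def C_lin sum.distrib)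
    moreover have "T (c *\<^sub>C x) = c *\<^sub>C T x" for c x
      by (rule ell2_eqI) (simp add: Rep_T scaleC_ell2.rep_eq conv_def C_lin scaleC.sum_right)
    ultimately show ?thesis unfolding operators_def using T_le by (auto intro!: exI[of _ 1])
  qed
  have T_shift: "T (shift h) = shift (T h)" for h
  proof (rule ell2_eqI)
    fix n
    show "Rep_ell2 (T (shift h)) n = Rep_ell2 (shift (T h)) n"
    proof (cases n)
      case 0
      then show ?thesis by (simp add: Rep_T Rep_shift conv_def C_lin)
    next
      case (Suc m)
      then show ?thesis unfolding Rep_T Rep_shift conv_def Suc
        by (subst sum.atMost_Suc_shift) (simp add: C_lin Rep_T conv_def)
    qed
  qed
  have T_embed0: "Rep_ell2 (T (embed0 u)) n = C n u" for u n
  proof -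
    have "conv C (Rep_ell2 (embed0 u)) n = (\<Sum>k\<le>n. if k = 0 then C n u else 0)"
      unfolding conv_def by (rule sum.cong) (auto simp: Rep_embed0 C_lin)
    then show ?thesis by (simp add: Rep_T)
  qed
  have WT: "W (T h) = W' h" for h
    using F by (auto simp: LTONP_solutions_def T_def fun_eq_iff)

  define Ts where "Ts = cadjoint T"
  have Ts_op: "Ts \<in> operators UNIV UNIV" unfolding Ts_def by (rule cadjoint_operators[OF T_op])
  have inner_T: "inner (T x) y = inner x (Ts y)" for x y unfolding Ts_def by (rule inner_cadjoint[OF T_op])
  interpret T: bounded_linear T by (rule operators_bounded_linear[OF T_op])
  have Ts_le: "norm (Ts x) \<le> norm x" for x
  proof (cases "Ts x = 0")
    case False
    have "norm (Ts x) * norm (Ts x) = inner (T (Ts x)) x"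
      by (simp add: inner_T power2_norm_eq_inner[symmetric] power2_eq_square)
    also have "\<dots> \<le> norm (T (Ts x)) * norm x" by (rule norm_cauchy_schwarz)
    also have "\<dots> \<le> norm (Ts x) * norm x" by (rule mult_right_mono[OF T_le]) simp
    finally show ?thesis using False by simp
  qed simp
  have Ts_bshift: "Ts (bshift f) = bshift (Ts f)" for f
  proof (rule eq_if_inner_eq)
    fix h
    have "inner h (Ts (bshift f)) = inner h (bshift (Ts f))"
      unfolding inner_T[symmetric] inner_shift[symmetric] T_shift ..
    then show "inner (Ts (bshift f)) h = inner (bshift (Ts f)) h" by (metis inner_commute)
  qed
  \<comment> \<open>The interpolation condition in adjoint form, T^* W^* = W'^*.\<close>
  have Ts_W_adj: "Ts (W_adj z) = W'_adj z" for z
  proof (rule eq_if_inner_eq)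
    fix h
    have "inner h (Ts (W_adj z)) = inner h (W'_adj z)"
      unfolding inner_T[symmetric] inner_adj[symmetric] WT ..
    then show "inner (Ts (W_adj z)) h = inner (W'_adj z) h" by (metis inner_commute)
  qed

  define D where "D = op_sqrt (\<lambda>x. x - T (Ts x))"
  have nonneg: "nonneg_operator (\<lambda>x. x - T (Ts x))"
  proof (rule nonneg_operatorI)
    show "(\<lambda>x. x - T (Ts x)) \<in> operators UNIV UNIV"
      by (intro operators_diff operators_simple operators_compose[OF T_op] Ts_op)
    show "inner (x - T (Ts x)) y = inner x (y - T (Ts y))" for x y
      using inner_T[of "Ts x" y] inner_T[of "Ts y" x]
      by (simp add: inner_diff_left inner_diff_right inner_commute)
    show "0 \<le> inner (x - T (Ts x)) x" for x
      using power_mono[OF Ts_le[of x], of 2]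
      by (simp add: inner_diff_left inner_T power2_norm_eq_inner)
  qed
  note D_nonneg = op_sqrt(1)[OF nonneg, folded D_def] and D_D = op_sqrt(2)[OF nonneg, folded D_def]
  note D_op = nonneg_operatorD(1)[OF D_nonneg] and D_sa = nonneg_operatorD(3)[OF D_nonneg]
  interpret D: bounded_linear D by (rule operators_bounded_linear[OF D_op])
  have norm_D: "(norm (D x))\<^sup>2 = (norm x)\<^sup>2 - (norm (Ts x))\<^sup>2" for x
  proof -
    have "inner (D x) (D x) = inner (D (D x)) x" by (rule D_sa[symmetric])
    then show ?thesis by (simp add: D_D power2_norm_eq_inner inner_diff_left inner_T)
  qed

  \<comment> \<open>A and B are K_1^* and K_2^* for the data W = I, W' = T, Z = S on the sequence
    space: there \<Lambda> = I - T T^*, its root is D, and Z^* is the backward shift. M plays the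
    part of \<omega>.\<close>
  define A where "A f = (Rep_ell2 (Ts f) 0, D f)" for f
  define B where "B f = (Rep_ell2 f 0, D (bshift f))" for f
  have A_op: "A \<in> operators UNIV UNIV" and B_op: "B \<in> operators UNIV UNIV"
    unfolding A_def[abs_def] B_def[abs_def]
    by (intro operators_Pair operators_compose[OF Rep_ell2_operator] operators_compose[OF D_op] Ts_op D_op bshift_operator Rep_ell2_operator)+
  have AB: "norm (A f) = norm (B f)" for f
  proof -
    have "(norm (A f))\<^sup>2 = (norm (B f))\<^sup>2"
      using norm_bshift[of f] norm_bshift[of "Ts f"] by (simp add: A_def B_def norm_prod_power2 norm_D Ts_bshift)
    then show ?thesis by (simp add: power2_eq_iff_nonneg)
  qed
  obtain M where M_op: "M \<in> operators UNIV UNIV" and M_le: "\<And>x. norm (M x) \<le> norm x"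
    and MA: "\<And>f. M (A f) = B f" and MB: "\<And>x f. inner (M x) (B f) = inner x (A f)"
    by (rule contraction_exists[OF A_op B_op AB]) (rule that; assumption)
  interpret M: bounded_linear M by (rule operators_bounded_linear[OF M_op])
  \<comment> \<open>The adjoint form of M A = B for this data, namely K_2 M = K_1. It says how one
    step of the colligation splits off the leading entry of a sequence.\<close>
  have colligation: "embed0 (fst (M (u, s))) + shift (D (snd (M (u, s)))) = T (embed0 u) + D s" for u s
  proof (rule eq_if_inner_eq)
    fix f
    show "inner (embed0 (fst (M (u, s))) + shift (D (snd (M (u, s))))) f = inner (T (embed0 u) + D s) f"
      using MB[of "(u, s)" f]
      by (simp add: A_def B_def inner_prod_def inner_add_left inner_embed0 inner_shift inner_T D_sa)
  qed

  have DW_op: "(\<lambda>z. D (W_adj z)) \<in> operators UNIV UNIV" by (intro operators_compose[OF D_op] adj_op)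
  have LDW: "norm (L z) = norm (D (W_adj z))" for z
  proof -
    have "(norm (L z))\<^sup>2 = (norm (D (W_adj z)))\<^sup>2" by (simp add: norm_D norm_L Ts_W_adj)
    then show ?thesis by (simp add: power2_eq_iff_nonneg)
  qed
  obtain V where V_op: "V \<in> operators UNIV UNIV" and V_le: "\<And>x. norm (V x) \<le> norm x"
    and VL: "\<And>z. V (L z) = D (W_adj z)"
    by (rule contraction_exists[OF L_op DW_op LDW]) (rule that; assumption)
  \<comment> \<open>The partial isometry opposite to V; it is the inverse of V on the image of Z_o
    and acts as the adjoint of V restricted to Z_o.\<close>
  obtain V' where V'_op: "V' \<in> operators UNIV UNIV" and V'_le: "\<And>x. norm (V' x) \<le> norm x"
    and V'DW: "\<And>z. V' (D (W_adj z)) = L z" and V'_closure: "\<And>s. V' s \<in> closure (range L)"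
    by (rule contraction_exists[OF DW_op L_op LDW[symmetric]]) (rule that; assumption)
  have V'_in: "V' s \<in> Z0" for s using V'_closure by (simp add: Z0_closure_range_L)
  interpret V: bounded_linear V by (rule operators_bounded_linear[OF V_op])
  interpret V': bounded_linear V' by (rule operators_bounded_linear[OF V'_op])
  have V'V: "V' (V x) = x" if "x \<in> Z0" for x
    using operators_eq_on_closure[OF operators_compose[OF V'_op V_op] operators_simple(1) closed_csubspace_UNIV closed_csubspace_UNIV, of L x]
      that by (simp add: VL V'DW Z0_closure_range_L[symmetric])
  have norm_V: "norm (V x) = norm x" if "x \<in> Z0" for x
    using V_le[of x] V'_le[of "V x"] V'V[OF that] by simp
  have inner_V': "inner (V' s) x = inner s (V x)" if x: "x \<in> Z0" for s x
  proof -
    have "inner (V' s) (V' (V x)) = inner s (V x)"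
      by (rule contraction_isometric_vector[OF subspace_UNIV])
        (auto simp: V'.add V'.scaleR V'_le V'V[OF x] norm_V[OF x])
    then show ?thesis by (simp add: V'V[OF x])
  qed
  \<comment> \<open>V V' is the orthogonal projection onto the image of Z_o under V, and Q is the
    complementary one.\<close>
  define Q where "Q s = s - V (V' s)" for s
  have Q_op: "Q \<in> operators UNIV UNIV"
    unfolding Q_def[abs_def] by (intro operators_diff operators_simple operators_compose[OF V_op] V'_op)
  have norm_Q: "(norm s)\<^sup>2 = (norm (V' s))\<^sup>2 + (norm (Q s))\<^sup>2" for s
  proof -
    have "inner s (V (V' s)) = (norm (V' s))\<^sup>2"
      unfolding inner_V'[OF V'_in, symmetric] power2_norm_eq_inner ..
    then show ?thesis
      using dot_norm_neg[of s "V (V' s)"] norm_V[OF V'_in, of s] by (simp add: Q_def)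
  qed
  have VQ: "inner (V x) (Q s) = 0" if "x \<in> Z0" for x s
    using inner_V'[OF that, of s] inner_V'[OF V'_in, of "V x" s] V'V[OF that]
    by (simp add: Q_def inner_diff_right inner_commute)

  \<comment> \<open>One time step of the opened system: no external input, and only the internal
    part of the state passes on. The response t begins with (u, V x) and iterates J; applying V' to
    its state component gives G.\<close>
  define J where "J q = M (0, Q (snd q))" for q :: "'y \<times> 'y ell2"
  define t where "t n p = (J ^^ n) (M (fst p, V (snd p)))" for n p
  have J_op: "J \<in> operators UNIV UNIV"
    unfolding J_def[abs_def]
    by (intro operators_compose[OF M_op] operators_Pair operators_compose[OF Q_op] operators_simple)
      (simp add: operators_UNIV_iff)
  interpret J: bounded_linear J by (rule operators_bounded_linear[OF J_op])
  have t0: "t 0 p = M (fst p, V (snd p))" and tS: "t (Suc n) p = J (t n p)" for n p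
    by (simp_all add: t_def)
  have t_op: "t n \<in> operators UNIV UNIV" for n
  proof (induction n)
    case 0
    have "(\<lambda>p. M (fst p, V (snd p))) \<in> operators UNIV UNIV"
      by (intro operators_compose[OF M_op] operators_Pair operators_compose[OF V_op] operators_simple)
    then show ?case by (simp add: t0[abs_def])
  next
    case (Suc n)
    then show ?case using operators_compose[OF J_op Suc] by (simp add: tS[abs_def])
  qed
  have conv_t: "conv t w 0 = M (fst (w 0), V (snd (w 0)))"
    "conv t w (Suc n) = M (fst (w (Suc n)), V (snd (w (Suc n))) + Q (snd (conv t w n)))" for w n
  proof -
    show "conv t w 0 = M (fst (w 0), V (snd (w 0)))" by (simp add: conv_def t0)
    have "conv t w (Suc n) = (\<Sum>k\<le>n. J (t (n - k) (w k))) + t 0 (w (Suc n))"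
      by (simp add: conv_def Suc_diff_le tS)
    also have "(\<Sum>k\<le>n. J (t (n - k) (w k))) = J (conv t w n)"
      by (simp add: conv_def J.sum)
    finally show "conv t w (Suc n) = M (fst (w (Suc n)), V (snd (w (Suc n))) + Q (snd (conv t w n)))"
      by (simp add: t0 J_def M.add[symmetric] add.commute)
  qed
  define g where "g n p = (fst (t n p), V' (snd (t n p)))" for n p
  define G where "G n = restrict (g n) HU" for n
  have g_op: "g n \<in> operators UNIV UNIV" for n
    unfolding g_def[abs_def]
    by (intro operators_Pair operators_compose[OF V'_op] operators_compose[OF operators_simple(2)]
        operators_compose[OF operators_simple(3)] t_op)
  have g_in: "g n p \<in> HY" for n p by (simp add: g_def V'_in)
  have conv_g: "conv g w n = (fst (conv t w n), V' (snd (conv t w n)))" for w n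
    by (simp add: conv_def g_def V'.sum fst_sum snd_sum prod_eq_iff)
  have conv_G: "conv G w n = conv g w n" if "\<And>k. w k \<in> HU" for w n
    unfolding conv_def G_def by (rule sum.cong) (use that in auto)
  have G_schur: "G \<in> schur_coeffs HU HY"
    unfolding schur_coeffs_def
  proof (intro CollectI conjI allI impI)
    fix n
    have "restrict (g n) HU \<in> operators HU UNIV" by (rule restrict_operators[OF g_op HU]) simp
    then show "G n \<in> operators HU HY" using g_in by (auto simp: operators_def G_def)
  next
    fix w :: "nat \<Rightarrow> 'u \<times> 'z" and N assume "range w \<subseteq> HU"
    then have w: "w k \<in> HU" for k by blast
    have wZ: "snd (w k) \<in> Z0" for k using w[of k] by (simp add: mem_Times_iff)
    \<comment> \<open>The energy of the internal state is carried along for the induction; it adds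
      to that of the next input because V x and the range of Q are orthogonal.\<close>
    have "(\<Sum>n\<le>N. (norm (conv g w n))\<^sup>2) + (norm (Q (snd (conv t w N))))\<^sup>2 \<le> (\<Sum>n\<le>N. (norm (w n))\<^sup>2)"
    proof (induction N)
      case 0
      have "(norm (conv g w 0))\<^sup>2 + (norm (Q (snd (conv t w 0))))\<^sup>2 = (norm (conv t w 0))\<^sup>2"
        using norm_Q[of "snd (conv t w 0)"] by (simp add: conv_g norm_prod_power2)
      also have "\<dots> \<le> (norm (fst (w 0), V (snd (w 0))))\<^sup>2"
        unfolding conv_t by (intro power_mono M_le) simp
      also have "\<dots> = (norm (w 0))\<^sup>2" by (simp add: norm_prod_power2 norm_V[OF wZ])
      finally show ?case by simp
    next
      case (Suc N)
      let ?s = "Q (snd (conv t w N))" and ?x = "snd (w (Suc N))"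
      have "(norm (conv g w (Suc N)))\<^sup>2 + (norm (Q (snd (conv t w (Suc N)))))\<^sup>2 = (norm (conv t w (Suc N)))\<^sup>2"
        using norm_Q[of "snd (conv t w (Suc N))"] by (simp add: conv_g norm_prod_power2)
      also have "\<dots> \<le> (norm (fst (w (Suc N)), V ?x + ?s))\<^sup>2"
        unfolding conv_t by (intro power_mono M_le) simp
      also have "\<dots> = (norm (fst (w (Suc N))))\<^sup>2 + (norm (V ?x + ?s))\<^sup>2" by (simp add: norm_prod_power2)
      also have "(norm (V ?x + ?s))\<^sup>2 = (norm ?x)\<^sup>2 + (norm ?s)\<^sup>2"
        using dot_norm[of "V ?x" ?s] by (simp add: VQ[OF wZ] norm_V[OF wZ])
      finally show ?case using Suc by (simp add: norm_prod_power2[of "w (Suc N)"])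
    qed
    then show "(\<Sum>n\<le>N. (norm (conv G w n))\<^sup>2) \<le> (\<Sum>n\<le>N. (norm (w n))\<^sup>2)"
      using zero_le_power2[of "norm (Q (snd (conv t w N)))"] unfolding conv_G[OF w] by linarith
  qed
  have G_K: "G 0 (K1_adj z) = K2_adj z" for z
  proof -
    \<comment> \<open>V maps L z to D W^* z, which turns K_1^* z into A (W^* z); M then gives B (W^*
      z), and V' returns its state component to Z_o.\<close>
    have "t 0 (K1_adj z) = M (A (W_adj z))" by (simp add: t0 K1_adj_def A_def VL Ts_W_adj)
    also have "\<dots> = B (W_adj z)" by (rule MA)
    finally show ?thesis
      by (simp add: G_def K1_adj_in g_def B_def K2_adj_def W_adj_Z_adj[symmetric] V'DW)
  qed
  have G_par: "G \<in> parameter_coeffs" using G_schur G_K by (simp add: parameter_coeffs_def)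

  have fb: "fst (feedback G (u, 0) n) = C n u" for u n
  proof -
    define m where "m n = ((\<lambda>q. M (0, snd q)) ^^ n) (M (u, 0))" for n
    have m0: "m 0 = M (u, 0)" and mS: "m (Suc n) = M (0, snd (m n))" for n by (simp_all add: m_def)
    \<comment> \<open>The input feeding V' of the full state back into the opened system. Since V V'
      s + Q s = s, this closes the loop again and restores the original colligation, whose
      trajectory is m.\<close>
    define w where "w n = (case n of 0 \<Rightarrow> (u, 0) | Suc k \<Rightarrow> (0, V' (snd (m k))))" for n
    have wH: "w n \<in> HU" for n
      using closed_csubspaceD(2)[OF Z0] V'_in by (simp add: w_def split: nat.split)
    have tm: "conv t w n = m n" for n
    proof (induction n)
      case 0
      show ?case by (simp add: conv_t w_def m0 V.zero)
    next
      case (Suc n)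
      show ?case by (simp add: conv_t(2) Suc mS) (simp add: w_def Q_def)
    qed
    define r where "r n = (fst (m n), V' (snd (m n)))" for n
    have "r n = feedback G (u, 0) n" for n
    proof (rule feedback_unique)
      fix n
      have "r n = conv G w n" by (simp add: conv_G[OF wH] conv_g tm r_def)
      also have "\<dots> = G n (u, 0) + (\<Sum>k<n. G (n - Suc k) (0, snd (r k)))"
        unfolding conv_def by (subst sum.atMost_shift) (simp add: w_def r_def)
      finally show "r n = G n (u, 0) + (\<Sum>k<n. G (n - Suc k) (0, snd (r k)))" .
    qed
    \<comment> \<open>D times the state at time n is the remaining coefficient sequence from index n
      + 1 on; each step of the colligation emits its leading entry and shifts the rest.\<close>
    moreover have "fst (m n) = C n u \<and> (\<forall>j. Rep_ell2 (D (snd (m n))) j = C (Suc (n + j)) u)" for n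
    proof (induction n)
      case 0
      have *: "Rep_ell2 (embed0 (fst (m 0)) + shift (D (snd (m 0)))) j = C j u" for j
        unfolding m0 colligation by (simp add: D.zero T_embed0)
      show ?case using *[of 0] *[of "Suc j" for j] by (simp add: plus_ell2.rep_eq Rep_embed0 Rep_shift)
    next
      case (Suc n)
      have e0: "embed0 (0::'u) = 0" by (rule ell2_eqI) (simp add: Rep_embed0 zero_ell2.rep_eq)
      have *: "Rep_ell2 (embed0 (fst (m (Suc n))) + shift (D (snd (m (Suc n))))) j = C (Suc (n + j)) u" for j
        unfolding mS colligation using Suc by (simp add: e0 T.zero)
      show ?case using *[of 0] *[of "Suc j" for j] by (simp add: plus_ell2.rep_eq Rep_embed0 Rep_shift)
    qed
    ultimately show ?thesis by (metis fst_conv r_def)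
  qed
  interpret feedback_loop Z0 G by (rule parameter_loop[OF G_par])
  have "transfer = C" by (intro ext) (simp add: transfer_def fb)
  then have "redheffer Z0 (power_series_fun HU G) = F" using redheffer_power_series by (simp add: FC)
  then show ?thesis using G_par by blast
qed

end

theorem theorem2p1:
  fixes W :: "'y :: chilbert_space ell2 \<Rightarrow> 'z :: chilbert_space"
    and W' :: "'u :: chilbert_space ell2 \<Rightarrow> 'z"
    and Z :: "'z \<Rightarrow> 'z"
  assumes "LTONP_data W W' Z"
    and "pointwise_stable (cadjoint Z)"
    and "nonneg_operator (pick_operator W W')"
  shows "LTONP_solutions W W' \<noteq> {} \<and>
    LTONP_solutions W W' = redheffer (pick_space W W') ` LTONP_parameters W W' Z \<and>
    bij_betw (redheffer (pick_space W W')) (LTONP_parameters W W' Z) (LTONP_solutions W W')"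
proof -
  interpret LTONP W W' Z by (rule LTONP.intro[OF assms])
  have eq: "LTONP_solutions W W' = redheffer (pick_space W W') ` LTONP_parameters W W' Z"
  proof
    show "LTONP_solutions W W' \<subseteq> redheffer (pick_space W W') ` LTONP_parameters W W' Z"
      using solution_from_parameter unfolding LTONP_parameters_eq by blast
    show "redheffer (pick_space W W') ` LTONP_parameters W W' Z \<subseteq> LTONP_solutions W W'"
      using parameter_interpolates unfolding LTONP_parameters_eq by blast
  qed
  moreover have "LTONP_parameters W W' Z \<noteq> {}"
    using parameter_coeffs_nonempty by (simp add: LTONP_parameters_eq)
  ultimately show ?thesis using redheffer_inj by (simp add: bij_betw_def)
qed

end
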